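(* Let $k$ be an arbitrary field of characteristic $p>0$, $n\ge 1$, $\mathbf t=(t_1,\ldots,t_n)$ indeterminates. Let $f\in k[[\mathbf t]]$ be an algebraic power series with degree $d$, total height $h$, and partial height $(h_1,\ldots,h_n)$. Set $$N:=(d+1)\cdot\min\left\{\prod_{i=1}^n(h_i+1)-\prod_{i=1}^n h_i,\ \binom{n+h}{n}-\binom{h}{n}\right\}.$$ Then there exist $c_0,c_1,\ldots,c_N\in k[t]$, not all zero, such that $$c_0\cdot\Delta(f)+c_1\cdot\Delta(f)^p+\cdots+c_N\cdot\Delta(f)^{p^N}=0.$$ In particular, $\Delta(f)$ has degree at most $p^N-1$ (over $k(t)$).
   Context: A power series in $k[[\mathbf t]]$ is algebraic if it is algebraic over $k(\mathbf t)$. Its degree is $d=[k(\mathbf t)(f):k(\mathbf t)]$; $h_i$ is the minimal degree in $t_i$ of a nonzero polynomial $A(\mathbf t,y)\in k[\mathbf t,y]$ with $A(\mathbf t,f)=0$; the total height $h$ is the minimal total degree in $\mathbf t$ of a nonzero polynomial $A(\mathbf t,y)\in k[\mathbf t,y]$ with $A(\mathbf t,f)=0$. The diagonal of $f=\sum_{(i_1,\ldots,i_n)\in\mathbb N^n}a(i_1,\ldots,i_n)t_1^{i_1}\cdots t_n^{i_n}$ is the univariate power series $\Delta(f)(t)=\sum_{i=0}^{\infty}a(i,\ldots,i)t^i\in k[[t]]$. *)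

theory Defs
  imports
    "HOL-Algebra.Algebraic_Closure_Type"
    "HOL-Algebra.Generated_Fields"
    "HOL-Algebra.Finite_Extensions"
    "HOL-Library.Function_Algebras"
begin

section \<open>Multivariate formal power series\<close>

text \<open>
  Power series in the variables \<open>t\<^sub>i\<close>, where \<open>i\<close> ranges over a finite index type \<open>'n\<close>.
  The monomial with exponent vector \<open>m :: 'n \<Rightarrow> nat\<close> has coefficient \<open>mfps_nth f m\<close>;
  exponent vectors are added pointwise.
\<close>

typedef ('n, 'a) mfps = "UNIV :: (('n \<Rightarrow> nat) \<Rightarrow> 'a) set"
  morphisms mfps_nth Abs_mfps ..

setup_lifting type_definition_mfps

lemma mfps_eqI: "(\<And>m. mfps_nth f m = mfps_nth g m) \<Longrightarrow> f = g"
  by transfer auto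

definition exponent_splits :: "('n \<Rightarrow> nat) \<Rightarrow> (('n \<Rightarrow> nat) \<times> ('n \<Rightarrow> nat)) set" where
  "exponent_splits m = {(u, v). u + v = m}"

lemma finite_exponents_le: "finite {u :: 'n::finite \<Rightarrow> nat. u \<le> m}"
proof (rule finite_subset)
  show "{u. u \<le> m} \<subseteq> Pi\<^sub>E UNIV (\<lambda>i. {..m i})"
    by (auto simp: le_fun_def)
  show "finite (Pi\<^sub>E (UNIV :: 'n set) (\<lambda>i. {..m i}))"
    by (rule finite_PiE) auto
qed

lemma finite_exponent_splits [simp, intro]:
  "finite (exponent_splits (m :: 'n::finite \<Rightarrow> nat))"
proof (rule finite_subset)
  show "exponent_splits m \<subseteq> {u. u \<le> m} \<times> {v. v \<le> m}"
    by (auto simp: exponent_splits_def le_fun_def)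
qed (intro finite_cartesian_product finite_exponents_le)

instantiation mfps :: (finite, comm_ring_1) comm_ring_1
begin

lift_definition zero_mfps :: "('a, 'b) mfps" is "\<lambda>_. 0" .

lift_definition one_mfps :: "('a, 'b) mfps" is "\<lambda>m. if m = 0 then 1 else 0" .

lift_definition plus_mfps :: "('a, 'b) mfps \<Rightarrow> ('a, 'b) mfps \<Rightarrow> ('a, 'b) mfps"
  is "\<lambda>f g m. f m + g m" .

lift_definition minus_mfps :: "('a, 'b) mfps \<Rightarrow> ('a, 'b) mfps \<Rightarrow> ('a, 'b) mfps"
  is "\<lambda>f g m. f m - g m" .

lift_definition uminus_mfps :: "('a, 'b) mfps \<Rightarrow> ('a, 'b) mfps"
  is "\<lambda>f m. - f m" .

lift_definition times_mfps :: "('a, 'b) mfps \<Rightarrow> ('a, 'b) mfps \<Rightarrow> ('a, 'b) mfps"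
  is "\<lambda>f g m. \<Sum>(u, v)\<in>exponent_splits m. f u * g v" .

instance
proof
  fix a b c :: "('a, 'b) mfps"
  show "a + b + c = a + (b + c)" by transfer (simp add: add.assoc)
  show "a + b = b + a" by transfer (simp add: add.commute)
  show "0 + a = a" by transfer simp
  show "- a + a = 0" by transfer simp
  show "a - b = a + - b" by transfer simp
  show "(0 :: ('a, 'b) mfps) \<noteq> 1" by transfer (auto simp: fun_eq_iff)
  show "(a + b) * c = a * c + b * c"
    by transfer (simp add: fun_eq_iff distrib_right sum.distrib case_prod_unfold)
  show "a * b = b * a"
  proof (rule mfps_eqI)
    fix m
    show "mfps_nth (a * b) m = mfps_nth (b * a) m"
      unfolding times_mfps.rep_eq
      by (rule sum.reindex_bij_witness[of _ prod.swap prod.swap])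
         (auto simp: exponent_splits_def add.commute mult.commute)
  qed
  show "1 * a = a"
  proof (rule mfps_eqI)
    fix m
    have "mfps_nth (1 * a) m =
        (\<Sum>x\<in>exponent_splits m. if x = (0, m) then mfps_nth a m else 0)"
      unfolding times_mfps.rep_eq one_mfps.rep_eq
      by (rule sum.cong) (auto simp: exponent_splits_def split: if_splits)
    also have "\<dots> = mfps_nth a m"
      by simp (simp add: exponent_splits_def)
    finally show "mfps_nth (1 * a) m = mfps_nth a m" .
  qed
  show "a * b * c = a * (b * c)"
  proof (rule mfps_eqI)
    fix m
    have "mfps_nth (a * b * c) m = (\<Sum>(x, y)\<in>Sigma (exponent_splits m)
        (\<lambda>x. exponent_splits (fst x)).
        mfps_nth a (fst y) * mfps_nth b (snd y) * mfps_nth c (snd x))"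
      unfolding times_mfps.rep_eq
      by (simp add: sum.Sigma sum_distrib_right case_prod_unfold)
    also have "\<dots> = (\<Sum>(x, y)\<in>Sigma (exponent_splits m)
        (\<lambda>x. exponent_splits (snd x)).
        mfps_nth a (fst x) * (mfps_nth b (fst y) * mfps_nth c (snd y)))"
      by (rule sum.reindex_bij_witness[of _
            "\<lambda>((u, v), (u', v')). ((u + u', v'), (u, u'))"
            "\<lambda>((u, v), (u', v')). ((u', v' + v), (v', v))"])
         (auto simp: exponent_splits_def add.assoc mult.assoc)
    also have "\<dots> = mfps_nth (a * (b * c)) m"
      unfolding times_mfps.rep_eq
      by (simp add: sum.Sigma sum_distrib_left case_prod_unfold)
    finally show "mfps_nth (a * b * c) m = mfps_nth (a * (b * c)) m" .
  qed
qed

end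

lemma exponent_extremal_pair:
  fixes S T :: "('n \<Rightarrow> nat) set"
  assumes "finite V" "S \<noteq> {}" "T \<noteq> {}"
  shows "\<exists>u\<in>S. \<exists>v\<in>T. \<forall>u'\<in>S. \<forall>v'\<in>T. u' + v' = u + v \<longrightarrow>
           (\<forall>x\<in>V. u' x = u x \<and> v' x = v x)"
  using assms
proof (induction V arbitrary: S T rule: finite_induct)
  case empty
  thus ?case by auto
next
  case (insert x V)
  define a where "a = (LEAST r. r \<in> (\<lambda>u. u x) ` S)"
  define b where "b = (LEAST r. r \<in> (\<lambda>v. v x) ` T)"
  have a: "a \<in> (\<lambda>u. u x) ` S" unfolding a_def
    by (rule LeastI_ex[of "\<lambda>r. r \<in> (\<lambda>u. u x) ` S"]) (use insert.prems in auto)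
  have b: "b \<in> (\<lambda>v. v x) ` T" unfolding b_def
    by (rule LeastI_ex[of "\<lambda>r. r \<in> (\<lambda>v. v x) ` T"]) (use insert.prems in auto)
  have a_le: "a \<le> u x" if "u \<in> S" for u unfolding a_def
    by (rule Least_le[of "\<lambda>r. r \<in> (\<lambda>u. u x) ` S"]) (use that in auto)
  have b_le: "b \<le> v x" if "v \<in> T" for v unfolding b_def
    by (rule Least_le[of "\<lambda>r. r \<in> (\<lambda>v. v x) ` T"]) (use that in auto)
  have "{u\<in>S. u x = a} \<noteq> {}" "{v\<in>T. v x = b} \<noteq> {}"
    using a b by blast+
  from insert.IH[OF this] obtain u v
    where uv: "u \<in> S" "u x = a" "v \<in> T" "v x = b"
      and *: "\<And>u' v'. u' \<in> S \<Longrightarrow> u' x = a \<Longrightarrow> v' \<in> T \<Longrightarrow> v' x = b \<Longrightarrow> u' + v' = u + v \<Longrightarrow>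
                (\<forall>y\<in>V. u' y = u y \<and> v' y = v y)"
    by blast
  have "\<forall>y\<in>insert x V. u' y = u y \<and> v' y = v y"
    if "u' \<in> S" "v' \<in> T" "u' + v' = u + v" for u' v'
  proof -
    have "u' x + v' x = a + b"
      using fun_cong[OF that(3), of x] uv by simp
    hence "u' x = a" "v' x = b"
      using a_le[OF that(1)] b_le[OF that(2)] by auto
    thus ?thesis using *[of u' v'] that uv by auto
  qed
  thus ?case using uv by blast
qed

instance mfps :: (finite, idom) idom
proof
  fix f g :: "('a, 'b) mfps"
  assume "f \<noteq> 0" "g \<noteq> 0"
  then obtain u0 v0 where "mfps_nth f u0 \<noteq> 0" "mfps_nth g v0 \<noteq> 0"
    by (metis mfps_eqI zero_mfps.rep_eq)
  hence "\<exists>u\<in>{u. mfps_nth f u \<noteq> 0}. \<exists>v\<in>{v. mfps_nth g v \<noteq> 0}.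
      \<forall>u'\<in>{u. mfps_nth f u \<noteq> 0}. \<forall>v'\<in>{v. mfps_nth g v \<noteq> 0}. u' + v' = u + v \<longrightarrow>
        (\<forall>x\<in>UNIV. u' x = u x \<and> v' x = v x)"
    by (intro exponent_extremal_pair) auto
  then obtain u v where u: "mfps_nth f u \<noteq> 0" and v: "mfps_nth g v \<noteq> 0"
    and uniq': "\<And>u' v' x. mfps_nth f u' \<noteq> 0 \<Longrightarrow> mfps_nth g v' \<noteq> 0 \<Longrightarrow> u' + v' = u + v \<Longrightarrow>
                 u' x = u x \<and> v' x = v x"
    by blast
  have uniq: "u' = u \<and> v' = v"
    if "mfps_nth f u' \<noteq> 0" "mfps_nth g v' \<noteq> 0" "u' + v' = u + v" for u' v'
    using uniq'[OF that] by (auto intro: ext)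
  have "mfps_nth (f * g) (u + v) = (\<Sum>x\<in>exponent_splits (u + v).
      if x = (u, v) then mfps_nth f u * mfps_nth g v else 0)"
    unfolding times_mfps.rep_eq
    by (rule sum.cong) (use uniq in \<open>auto simp: exponent_splits_def\<close>)
  also have "\<dots> = mfps_nth f u * mfps_nth g v"
    by simp (simp add: exponent_splits_def)
  finally have "mfps_nth (f * g) (u + v) \<noteq> 0" using u v by simp
  thus "f * g \<noteq> 0" by (auto simp: zero_mfps.rep_eq)
qed

text \<open>The polynomial ring \<open>k[t]\<close>, as a subring of \<open>k[[t]]\<close>.\<close>

definition mpolys :: "('n, 'a::zero) mfps set" where
  "mpolys = {g. finite {m. mfps_nth g m \<noteq> 0}}"

definition diagonal :: "('n, 'a) mfps \<Rightarrow> 'a fps" where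
  "diagonal f = Abs_fps (\<lambda>i. mfps_nth f (\<lambda>_. i))"


section \<open>Algebraicity and degree over the rational functions\<close>

text \<open>
  Rational functions and power series are compared in the fraction field of the power series
  ring: if \<open>P\<close> is the polynomial ring inside a ring of power series, \<open>quotients P\<close>
  is the corresponding field of rational functions.
\<close>

definition quotients :: "'a::idom set \<Rightarrow> 'a fract set" where
  "quotients P = {Fract a b | a b. a \<in> P \<and> b \<in> P \<and> b \<noteq> 0}"

definition algebraic_over :: "'a::field set \<Rightarrow> 'a \<Rightarrow> bool" where
  "algebraic_over K x \<longleftrightarrow> (ring.algebraic ring_of_type_algebra over K) x"

text \<open>The degree \<open>[K(x) : K]\<close>; only meaningful if \<open>x\<close> is algebraic over \<open>K\<close>.\<close>

definition extension_degree :: "'a::field set \<Rightarrow> 'a \<Rightarrow> nat" where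
  "extension_degree K x =
     (ring.dim ring_of_type_algebra over K) (generate_field ring_of_type_algebra (insert x K))"

definition mfps_algebraic :: "('n::finite, 'k::field) mfps \<Rightarrow> bool" where
  "mfps_algebraic f \<longleftrightarrow> algebraic_over (quotients mpolys) (to_fract f)"

definition mfps_degree :: "('n::finite, 'k::field) mfps \<Rightarrow> nat" where
  "mfps_degree f = extension_degree (quotients mpolys) (to_fract f)"

definition fps_algebraic :: "'k::field fps \<Rightarrow> bool" where
  "fps_algebraic g \<longleftrightarrow> algebraic_over (quotients (range fps_of_poly)) (to_fract g)"

definition fps_degree :: "'k::field fps \<Rightarrow> nat" where
  "fps_degree g = extension_degree (quotients (range fps_of_poly)) (to_fract g)"


section \<open>Heights\<close>

text \<open>
  A polynomial \<open>A(t, y)\<close> is a polynomial in \<open>y\<close> over \<open>k[[t]]\<close> with coefficients in \<open>k[t]\<close>.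
\<close>

definition annihilates :: "('n::finite, 'k::field) mfps poly \<Rightarrow> ('n, 'k) mfps \<Rightarrow> bool" where
  "annihilates A f \<longleftrightarrow> A \<noteq> 0 \<and> (\<forall>j. Polynomial.coeff A j \<in> mpolys) \<and> poly A f = 0"

definition t_exponents :: "('n::finite, 'k::field) mfps poly \<Rightarrow> ('n \<Rightarrow> nat) set" where
  "t_exponents A = (\<Union>j. {m. mfps_nth (Polynomial.coeff A j) m \<noteq> 0})"

definition partial_height :: "('n::finite, 'k::field) mfps \<Rightarrow> 'n \<Rightarrow> nat" where
  "partial_height f i = (LEAST r. \<exists>A. annihilates A f \<and> r = Max ((\<lambda>m. m i) ` t_exponents A))"

definition total_height :: "('n::finite, 'k::field) mfps \<Rightarrow> nat" where
  "total_height f =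
     (LEAST r. \<exists>A. annihilates A f \<and> r = Max ((\<lambda>m. \<Sum>i\<in>UNIV. m i) ` t_exponents A))"

end

theory Submission
  imports Defs
begin

text \<open>
  Let \<open>A\<close> be the primitive minimal polynomial of \<open>f\<close>. By Gauss's lemma it attains all heights of
  \<open>f\<close> at once, and \<open>A\<^sub>y(t, f) \<noteq> 0\<close>. The power series of the form \<open>P(t, f) / A\<^sub>y(t, f)\<close>, with
  \<open>P\<close> bounded in degree and heights like \<open>A\<close>, contain \<open>f\<close> and are stable under the section
  (Cartier) operators: these turn \<open>P / A = P * A ^ (p - 1) / A ^ p\<close> into a fraction with the same
  denominator and the same bounds. Hence the diagonals of these series lie in the \<open>k[t]\<close>-span of
  the \<open>p\<close>-th powers of such diagonals. Since \<open>\<Delta>(t\<^sub>1 \<dots> t\<^sub>n g) = t \<Delta>(g)\<close>, only the exponents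
  of \<open>P\<close> in \<open>t\<close> with a vanishing entry matter for their rank over \<open>k[t]\<close>, which is therefore at
  most \<open>N\<close>. So the \<open>N + 1\<close> powers \<open>\<Delta>(f) ^ p\<^sup>j\<close> all lie in the \<open>k(t)\<close>-span of at most \<open>N\<close>
  elements.
\<close>

section \<open>Factorial subrings and Gauss's lemma\<close>

text \<open>The denominator \<open>A\<^sub>y(t, f)\<close> stems from the residue of
  \<open>P / A\<close> at the simple root \<open>y = f\<close>, and \<open>f\<close> itself is the
  fraction with numerator \<open>y * A\<^sub>y\<close>. This numerator may have the full degree of
  \<open>A\<close> in \<open>y\<close>, whence the factor \<open>d + 1\<close>. The other factor
  counts the admissible exponents with a vanishing entry, in a box for the partial heights and in a
  simplex for the total height. Two obstacles shape the proof. One polynomial has to meet all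
  partial heights at once although each is defined by a minimum of its own; this is why unique
  factorisation in \<open>k[t]\<close> is developed. And \<open>k\<close> may be imperfect, even of
  infinite degree over its subfield of p-th powers: then coordinates replace p-th roots of
  coefficients, and the finiteness of expansions has to come from the polynomial numerators. The
  degree bound is \<open>p ^ N - 1\<close> rather than \<open>p ^ N\<close> because
  \<open>\<Delta>(f)\<close> can be cancelled from the additive relation.\<close>

text \<open>
  Divisibility is taken relative to a subset \<open>R\<close> of an integral domain: the number of variables is
  fixed by the index type, so the induction on it runs through the subrings \<open>k[t\<^sub>i : i \<in> V]\<close>
  of \<open>k[[t]]\<close>.
\<close>

definition dvd_in :: "'a::idom set \<Rightarrow> 'a \<Rightarrow> 'a \<Rightarrow> bool" where
  "dvd_in R a b \<longleftrightarrow> (\<exists>c\<in>R. b = a * c)"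

definition prime_in :: "'a::idom set \<Rightarrow> 'a \<Rightarrow> bool" where
  "prime_in R q \<longleftrightarrow> q \<in> R \<and> q \<noteq> 0 \<and> \<not> dvd_in R q 1 \<and>
     (\<forall>a\<in>R. \<forall>b\<in>R. dvd_in R q (a * b) \<longrightarrow> dvd_in R q a \<or> dvd_in R q b)"

text \<open>The number of prime factors is recorded as an induction measure for splitting constants
  off a polynomial. A factorisation into prime, not merely irreducible, elements is unique up to
  units, so \<open>factorial_in\<close> asks for existence.\<close>

inductive prime_product :: "'a::idom set \<Rightarrow> nat \<Rightarrow> 'a \<Rightarrow> bool" for R where
  unit: "a \<in> R \<Longrightarrow> dvd_in R a 1 \<Longrightarrow> prime_product R 0 a"
| step: "prime_in R q \<Longrightarrow> prime_product R n a \<Longrightarrow> prime_product R (Suc n) (q * a)"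

definition factorial_in :: "'a::idom set \<Rightarrow> bool" where
  "factorial_in R \<longleftrightarrow> (\<forall>a\<in>R. a \<noteq> 0 \<longrightarrow> (\<exists>n. prime_product R n a))"

definition polys_over :: "'a::zero set \<Rightarrow> 'a poly set" where
  "polys_over R = {P. \<forall>j. Polynomial.coeff P j \<in> R}"

locale sub_idom =
  fixes R :: "'a::idom set"
  assumes one: "1 \<in> R"
    and diff: "a \<in> R \<Longrightarrow> b \<in> R \<Longrightarrow> a - b \<in> R"
    and mult: "a \<in> R \<Longrightarrow> b \<in> R \<Longrightarrow> a * b \<in> R"
begin

lemma zero: "0 \<in> R"
  using diff[OF one one] by simp

lemma uminus: "a \<in> R \<Longrightarrow> - a \<in> R"
  using diff[OF zero, of a] by simp

lemma add: "a \<in> R \<Longrightarrow> b \<in> R \<Longrightarrow> a + b \<in> R"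
  using diff[OF _ uminus, of a b] by simp

lemma sum: "(\<And>i. i \<in> I \<Longrightarrow> g i \<in> R) \<Longrightarrow> sum g I \<in> R"
  by (induction I rule: infinite_finite_induct) (auto intro: zero add)

lemma power: "a \<in> R \<Longrightarrow> a ^ n \<in> R"
  by (induction n) (auto intro: one mult)

lemma of_nat: "of_nat n \<in> R"
  by (induction n) (auto intro: zero one add)

lemma polys_over: "sub_idom (polys_over R)"
proof
  show "1 \<in> polys_over R"
    by (auto simp: polys_over_def coeff_1 zero one)
  show "P - Q \<in> polys_over R" if "P \<in> polys_over R" "Q \<in> polys_over R" for P Q
    using that by (auto simp: polys_over_def intro: diff)
  show "P * Q \<in> polys_over R" if "P \<in> polys_over R" "Q \<in> polys_over R" for P Q
    using that by (auto simp: polys_over_def coeff_mult intro: sum mult)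
qed

lemma pCons_polys_over: "pCons a P \<in> polys_over R \<longleftrightarrow> a \<in> R \<and> P \<in> polys_over R"
  by (auto simp: polys_over_def coeff_pCons split: nat.splits)

lemma monom_polys_over: "a \<in> R \<Longrightarrow> Polynomial.monom a n \<in> polys_over R"
  by (auto simp: polys_over_def zero)

lemma smult_polys_over: "a \<in> R \<Longrightarrow> P \<in> polys_over R \<Longrightarrow> smult a P \<in> polys_over R"
  by (auto simp: polys_over_def mult)

lemma poly_in: "P \<in> polys_over R \<Longrightarrow> x \<in> R \<Longrightarrow> poly P x \<in> R"
  by (auto simp: poly_altdef polys_over_def intro!: sum mult power)

lemma dvd_in_const:
  assumes "P \<in> polys_over R"
  shows "dvd_in (polys_over R) [:c:] P \<longleftrightarrow> (\<forall>j. dvd_in R c (Polynomial.coeff P j))"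
proof
  assume "dvd_in (polys_over R) [:c:] P"
  thus "\<forall>j. dvd_in R c (Polynomial.coeff P j)"
    by (auto simp: dvd_in_def polys_over_def)
next
  assume *: "\<forall>j. dvd_in R c (Polynomial.coeff P j)"
  show "dvd_in (polys_over R) [:c:] P"
  \<comment> \<open>For \<open>c = 0\<close> the cofactors are arbitrary and could fail to form a
    polynomial; otherwise cancelling \<open>c\<close> makes them vanish for large
    \<open>j\<close>.\<close>
  proof (cases "c = 0")
    case True
    hence "P = 0" using * by (auto simp: dvd_in_def poly_eq_iff)
    thus ?thesis
      by (auto simp: dvd_in_def intro!: bexI[of _ 0] sub_idom.zero[OF polys_over])
  next
    case False
    from * obtain s where s: "\<And>j. s j \<in> R" "\<And>j. Polynomial.coeff P j = c * s j"
      unfolding dvd_in_def by metis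
    have "\<forall>\<^sub>\<infinity>j. s j = 0"
      using MOST_coeff_eq_0[of P] s(2) False by (simp add: MOST_mono)
    hence "Polynomial.coeff (Abs_poly s) = s" by (intro Abs_poly_inverse) auto
    thus ?thesis
      unfolding dvd_in_def using s
      by (intro bexI[of _ "Abs_poly s"]) (auto simp: polys_over_def poly_eq_iff)
  qed
qed

lemma dvd_in_const_1:
  assumes "dvd_in R c 1"
  shows "dvd_in (polys_over R) [:c:] 1"
proof -
  obtain e where "e \<in> R" "1 = c * e" using assms by (auto simp: dvd_in_def)
  thus ?thesis
    by (auto simp: dvd_in_def one_pCons pCons_polys_over sub_idom.zero[OF polys_over]
             intro!: bexI[of _ "[:e:]"])
qed

lemma dvd_in_trans_mult: "dvd_in R a b \<Longrightarrow> c \<in> R \<Longrightarrow> dvd_in R a (b * c)"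
  by (auto simp: dvd_in_def mult.assoc intro!: mult)

lemma dvd_in_add: "dvd_in R a b \<Longrightarrow> dvd_in R a c \<Longrightarrow> dvd_in R a (b + c)"
  unfolding dvd_in_def by (metis add distrib_left)

lemma dvd_in_diff: "dvd_in R a b \<Longrightarrow> dvd_in R a c \<Longrightarrow> dvd_in R a (b - c)"
  unfolding dvd_in_def by (metis diff right_diff_distrib)

lemma dvd_in_0: "dvd_in R a 0"
  unfolding dvd_in_def using zero by force

lemma dvd_in_sum: "(\<And>i. i \<in> I \<Longrightarrow> dvd_in R a (g i)) \<Longrightarrow> dvd_in R a (sum g I)"
  by (induction I rule: infinite_finite_induct) (auto intro: dvd_in_add dvd_in_0)

text \<open>Gauss's lemma: take the lowest coefficients of \<open>P\<close> and \<open>Q\<close>, at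
  \<open>i\<close> and \<open>j\<close>, that \<open>q\<close> does not divide. In the coefficient
  of the product at \<open>i + j\<close> every other summand is divisible by \<open>q\<close>, so
  \<open>q\<close> would divide the product of these two.\<close>

lemma prime_in_const:
  assumes q: "prime_in R q"
  shows "prime_in (polys_over R) [:q:]"
  unfolding prime_in_def
proof (intro conjI ballI impI)
  show "[:q:] \<in> polys_over R" "[:q:] \<noteq> 0"
    using q by (auto simp: prime_in_def pCons_polys_over sub_idom.zero[OF polys_over])
  show "\<not> dvd_in (polys_over R) [:q:] 1"
  proof
    assume "dvd_in (polys_over R) [:q:] 1"
    hence "dvd_in R q (Polynomial.coeff 1 0)"
      using dvd_in_const sub_idom.one[OF polys_over] by blast
    thus False using q by (auto simp: prime_in_def)
  qed
  fix P Q assume PQ: "P \<in> polys_over R" "Q \<in> polys_over R"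
    and dvd: "dvd_in (polys_over R) [:q:] (P * Q)"
  show "dvd_in (polys_over R) [:q:] P \<or> dvd_in (polys_over R) [:q:] Q"
  proof (rule ccontr)
    assume "\<not> ?thesis"
    hence ex: "\<exists>i. \<not> dvd_in R q (Polynomial.coeff P i)" "\<exists>j. \<not> dvd_in R q (Polynomial.coeff Q j)"
      using PQ by (auto simp: dvd_in_const)
    define i where "i = (LEAST i. \<not> dvd_in R q (Polynomial.coeff P i))"
    define j where "j = (LEAST j. \<not> dvd_in R q (Polynomial.coeff Q j))"
    have i: "\<not> dvd_in R q (Polynomial.coeff P i)" and j: "\<not> dvd_in R q (Polynomial.coeff Q j)"
      unfolding i_def j_def using LeastI_ex[OF ex(1)] LeastI_ex[OF ex(2)] by auto
    have i': "dvd_in R q (Polynomial.coeff P k)" if "k < i" for k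
      using not_less_Least[OF that[unfolded i_def]] by auto
    have j': "dvd_in R q (Polynomial.coeff Q k)" if "k < j" for k
      using not_less_Least[OF that[unfolded j_def]] by auto
    have "Polynomial.coeff (P * Q) (i + j)
        = Polynomial.coeff P i * Polynomial.coeff Q (i + j - i)
        + (\<Sum>k\<in>{..i+j}-{i}. Polynomial.coeff P k * Polynomial.coeff Q (i + j - k))"
      unfolding coeff_mult by (subst sum.remove[of _ i]) auto
    moreover have "dvd_in R q (\<Sum>k\<in>{..i+j}-{i}. Polynomial.coeff P k * Polynomial.coeff Q (i + j - k))"
    proof (rule dvd_in_sum)
      fix k assume "k \<in> {..i+j}-{i}"
      hence "k < i \<or> i + j - k < j" by auto
      thus "dvd_in R q (Polynomial.coeff P k * Polynomial.coeff Q (i + j - k))"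
        using i'[of k] j'[of "i+j-k"] PQ
          dvd_in_trans_mult[of q "Polynomial.coeff P k" "Polynomial.coeff Q (i + j - k)"]
          dvd_in_trans_mult[of q "Polynomial.coeff Q (i + j - k)" "Polynomial.coeff P k"]
        by (auto simp: polys_over_def mult.commute)
    qed
    moreover have "dvd_in R q (Polynomial.coeff (P * Q) (i + j))"
      using dvd dvd_in_const[OF sub_idom.mult[OF polys_over PQ]] by blast
    ultimately have "dvd_in R q (Polynomial.coeff P i * Polynomial.coeff Q j)"
      using dvd_in_diff by fastforce
    moreover have "Polynomial.coeff P i \<in> R" "Polynomial.coeff Q j \<in> R"
      using PQ by (auto simp: polys_over_def)
    ultimately show False using q i j unfolding prime_in_def by blast
  qed
qed

lemma prime_product_in: "prime_product R n a \<Longrightarrow> a \<in> R"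
  by (induction rule: prime_product.induct) (auto simp: prime_in_def intro: mult)

lemma prime_product_0: "prime_product R 0 a \<longleftrightarrow> a \<in> R \<and> dvd_in R a 1"
  by (auto intro: prime_product.unit elim: prime_product.cases)

lemma prime_product_mult_unit:
  assumes "prime_product R n a" "u \<in> R" "dvd_in R u 1"
  shows "prime_product R n (u * a)"
  using assms
proof (induction rule: prime_product.induct)
  case (unit a)
  then obtain s t where "s \<in> R" "t \<in> R" "1 = a * s" "1 = u * t"
    by (auto simp: dvd_in_def)
  moreover from this have "1 = (u * a) * (s * t)"
    by (metis mult.assoc mult.commute mult.left_neutral)
  ultimately show ?case
    using unit by (auto simp: prime_product_0 dvd_in_def intro!: mult bexI[of _ "s * t"])
next
  case (step q n a)
  thus ?case using prime_product.step[of R q n "u * a"] by (simp add: mult.left_commute)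
qed

lemma prime_product_mult:
  "prime_product R n a \<Longrightarrow> prime_product R m b \<Longrightarrow> prime_product R (n + m) (a * b)"
proof (induction rule: prime_product.induct)
  case (unit a)
  thus ?case using prime_product_mult_unit by simp
next
  case (step q n a)
  thus ?case using prime_product.step by (simp add: mult.assoc)
qed

text \<open>Each prime of \<open>c\<close> divides \<open>a\<close> or \<open>b\<close> and is
  cancelled there, so the primes are shared out between the two factors.\<close>

lemma prime_product_split:
  assumes "prime_product R n c" "c = a * b" "a \<in> R" "b \<in> R"
  shows "\<exists>i j. n = i + j \<and> prime_product R i a \<and> prime_product R j b"
  using assms
proof (induction arbitrary: a b rule: prime_product.induct)
  case (unit c a b)
  then obtain s where s: "s \<in> R" "1 = a * b * s" by (auto simp: dvd_in_def)
  have "1 = a * (b * s)" "1 = b * (a * s)" using s by (simp_all add: mult_ac)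
  hence "dvd_in R a 1" "dvd_in R b 1"
    unfolding dvd_in_def using s unit by (metis mult)+
  thus ?case using unit by (auto simp: prime_product_0)
next
  case (step q n c a b)
  have "dvd_in R q (a * b)"
    using step prime_product_in[of n c] unfolding dvd_in_def by metis
  then consider "dvd_in R q a" | "dvd_in R q b"
    using step.hyps(1) step.prems(2,3) unfolding prime_in_def by blast
  thus ?case
  proof cases
    case 1
    then obtain a' where a': "a' \<in> R" "a = q * a'" by (auto simp: dvd_in_def)
    have "c = a' * b" using step a' by (simp add: prime_in_def mult.assoc)
    with step.IH[OF this a'(1) step.prems(3)] obtain i j
      where "n = i + j" "prime_product R i a'" "prime_product R j b" by blast
    thus ?thesis using prime_product.step[OF step.hyps(1)] a' 
      by (metis add_Suc)
  next
    case 2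
    then obtain b' where b': "b' \<in> R" "b = q * b'" by (auto simp: dvd_in_def)
    have "c = a * b'" using step b' by (simp add: prime_in_def mult.left_commute)
    with step.IH[OF this step.prems(2) b'(1)] obtain i j
      where "n = i + j" "prime_product R i a" "prime_product R j b'" by blast
    thus ?thesis using prime_product.step[OF step.hyps(1)] b'
      by (metis add_Suc_right)
  qed
qed

text \<open>The primes of \<open>c\<close> stay prime among polynomials, so they are taken one at a
  time out of \<open>Q\<close> or \<open>S\<close>. This removes a constant from a product without
  passing to the fraction field.\<close>

lemma split_constant:
  assumes "prime_product R n c" "P \<in> polys_over R" "Q \<in> polys_over R" "S \<in> polys_over R"
    "smult c P = Q * S"
  shows "\<exists>c1\<in>R. \<exists>c2\<in>R. \<exists>Q'\<in>polys_over R. \<exists>S'\<in>polys_over R.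
           c = c1 * c2 \<and> Q = smult c1 Q' \<and> S = smult c2 S' \<and> P = Q' * S'"
  using assms
proof (induction arbitrary: Q S rule: prime_product.induct)
  case (unit c)
  then obtain s where s: "s \<in> R" "1 = c * s" by (auto simp: dvd_in_def)
  have "smult s (smult c P) = P" using s by (simp add: mult.commute)
  hence "P = Q * smult s S" using unit by simp
  moreover have "S = smult c (smult s S)" using s by simp
  ultimately show ?case
    using unit s one smult_polys_over
    by (metis mult_1 smult_1_left)
next
  case (step q n c)
  have q: "q \<in> R" "q \<noteq> 0" using step.hyps by (auto simp: prime_in_def)
  have "dvd_in (polys_over R) [:q:] (Q * S)"
    unfolding dvd_in_def
    using step.prems(1,4) prime_product_in[OF step.hyps(2)] smult_polys_over
    by (intro bexI[of _ "smult c P"]) (auto simp: mult_ac)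
  then consider "dvd_in (polys_over R) [:q:] Q" | "dvd_in (polys_over R) [:q:] S"
    using prime_in_const[OF step.hyps(1)] step.prems by (auto simp: prime_in_def)
  thus ?case
  proof cases
    case 1
    then obtain Q0 where Q0: "Q0 \<in> polys_over R" "Q = smult q Q0" by (auto simp: dvd_in_def)
    have "smult q (smult c P) = smult q (Q0 * S)" using step.prems Q0 by simp
    hence "smult c P = Q0 * S" using q(2) by (simp only: poly_eq_iff coeff_smult) simp
    from step.IH[OF step.prems(1) Q0(1) step.prems(3) this] obtain c1 c2 Q' S'
      where *: "c1 \<in> R" "c2 \<in> R" "Q' \<in> polys_over R" "S' \<in> polys_over R"
       "c = c1 * c2" "Q0 = smult c1 Q'" "S = smult c2 S'" "P = Q' * S'" by (elim bexE conjE) (rule that)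
    moreover have "q * c1 \<in> R" using q(1) *(1) by (rule mult)
    moreover have "q * c = q * c1 * c2" "Q = smult (q * c1) Q'" using * Q0(2) by simp_all
    ultimately show ?thesis by metis
  next
    case 2
    then obtain S0 where S0: "S0 \<in> polys_over R" "S = smult q S0" by (auto simp: dvd_in_def)
    have "smult q (smult c P) = smult q (Q * S0)" using step.prems S0 by simp
    hence "smult c P = Q * S0" using q(2) by (simp only: poly_eq_iff coeff_smult) simp
    from step.IH[OF step.prems(1,2) S0(1) this] obtain c1 c2 Q' S'
      where *: "c1 \<in> R" "c2 \<in> R" "Q' \<in> polys_over R" "S' \<in> polys_over R"
       "c = c1 * c2" "Q = smult c1 Q'" "S0 = smult c2 S'" "P = Q' * S'" by (elim bexE conjE) (rule that)
    moreover have "q * c2 \<in> R" using q(1) *(2) by (rule mult)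
    moreover have "q * c = c1 * (q * c2)" "S = smult (q * c2) S'" using * S0(2) by simp_all
    ultimately show ?thesis by metis
  qed
qed

text \<open>Long division without inverses: before each step the dividend is multiplied by the
  leading coefficient of \<open>M\<close>, and \<open>c\<close> collects these factors.\<close>

lemma pseudo_division:
  assumes M: "M \<in> polys_over R" "M \<noteq> 0" and Z: "Z \<in> polys_over R"
  shows "\<exists>c\<in>R. \<exists>S\<in>polys_over R. \<exists>T\<in>polys_over R. c \<noteq> 0 \<and> smult c Z = M * S + T \<and>
           (T = 0 \<or> Polynomial.degree T < Polynomial.degree M)"
  using Z
proof (induction "Polynomial.degree Z" arbitrary: Z rule: less_induct)
  case less
  interpret P: sub_idom "polys_over R" by (rule polys_over)
  show ?case
  proof (cases "Z = 0 \<or> Polynomial.degree Z < Polynomial.degree M")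
    case True
    thus ?thesis using less.prems one P.zero
      by (intro bexI[of _ 1] bexI[of _ 0] bexI[of _ Z]) auto
  next
    case False
    define l where "l = Polynomial.lead_coeff M"
    define k where "k = Polynomial.degree Z - Polynomial.degree M"
    define N where "N = Polynomial.monom (Polynomial.lead_coeff Z) k"
    have l: "l \<in> R" "l \<noteq> 0" using M by (auto simp: l_def polys_over_def)
    have N: "N \<in> polys_over R" unfolding N_def
      using less.prems by (intro monom_polys_over) (auto simp: polys_over_def)
    define Y where "Y = smult l Z - M * N"
    have Y: "Y \<in> polys_over R"
      unfolding Y_def using l less.prems M N by (intro P.diff smult_polys_over P.mult)
    have degMN: "Polynomial.degree (M * N) = Polynomial.degree Z"
      using False M by (subst degree_mult_eq) (auto simp: N_def k_def degree_monom_eq monom_eq_0_iff)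
    have lcMN: "Polynomial.coeff (M * N) (Polynomial.degree Z) = l * Polynomial.lead_coeff Z"
      using lead_coeff_mult[of M N] degMN False by (auto simp: N_def l_def degree_monom_eq)
    have "Polynomial.degree Y \<le> Polynomial.degree Z"
      unfolding Y_def by (rule degree_diff_le) (use degMN degree_smult_le in auto)
    moreover have "Polynomial.coeff Y (Polynomial.degree Z) = 0"
      unfolding Y_def using lcMN by simp
    ultimately have degY: "Y = 0 \<or> Polynomial.degree Y < Polynomial.degree Z"
      by (metis leading_coeff_0_iff le_neq_implies_less)
    show ?thesis
    proof (cases "Y = 0")
      case True
      thus ?thesis using l N P.zero
        by (intro bexI[of _ l] bexI[of _ N] bexI[of _ 0]) (auto simp: Y_def)
    next
      case Yne: False
      with degY less.hyps[of Y] Y obtain c S T where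
        *: "c \<in> R" "S \<in> polys_over R" "T \<in> polys_over R" "c \<noteq> 0" "smult c Y = M * S + T"
        "T = 0 \<or> Polynomial.degree T < Polynomial.degree M" by blast
      have "smult (c * l) Z = smult c Y + smult c (M * N)"
        by (simp add: Y_def smult_diff_right)
      also have "\<dots> = M * (S + smult c N) + T"
        using * by (simp add: algebra_simps)
      finally show ?thesis using * l N
        by (intro bexI[of _ "c * l"] bexI[of _ "S + smult c N"] bexI[of _ T])
           (auto intro: mult P.add smult_polys_over)
    qed
  qed
qed

end

section \<open>Primitive polynomials and factoriality of the polynomial ring\<close>

definition primitive_in :: "'a::idom set \<Rightarrow> 'a poly \<Rightarrow> bool" where
  "primitive_in R P \<longleftrightarrow> (\<forall>c\<in>R. dvd_in (polys_over R) [:c:] P \<longrightarrow> dvd_in R c 1)"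

locale factorial_sub_idom = sub_idom +
  assumes factorial: "factorial_in R"
begin

text \<open>Splitting \<open>c\<close> over the two cofactors puts a constant \<open>c1\<close> into
  \<open>P\<close>; primitivity makes it a unit, whose inverse moves to the other cofactor.\<close>

lemma primitive_dvd_cancel:
  assumes c: "c \<in> R" "c \<noteq> 0" and P: "P \<in> polys_over R" "primitive_in R P"
    and W: "W \<in> polys_over R" and dvd: "dvd_in (polys_over R) P (smult c W)"
  shows "dvd_in (polys_over R) P W"
proof -
  interpret Q: sub_idom "polys_over R" by (rule polys_over)
  obtain n where n: "prime_product R n c" using c factorial by (auto simp: factorial_in_def)
  from dvd obtain S where S: "S \<in> polys_over R" "smult c W = P * S"
    by (auto simp: dvd_in_def)
  from split_constant[OF n W P(1) S] obtain c1 c2 P' S'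
    where *: "c1 \<in> R" "c2 \<in> R" "P' \<in> polys_over R" "S' \<in> polys_over R"
       "P = smult c1 P'" "W = P' * S'" by (elim bexE conjE) (rule that)
  have "dvd_in (polys_over R) [:c1:] P"
    unfolding dvd_in_def using *(3,5) by (intro bexI[of _ P']) simp
  hence "dvd_in R c1 1"
    using P(2) *(1) unfolding primitive_in_def by blast
  then obtain e where e: "e \<in> R" "1 = c1 * e"
    unfolding dvd_in_def by blast
  have "P * smult e S' = smult (c1 * e) (P' * S')"
    unfolding *(5) by (simp add: mult.commute)
  hence "W = P * smult e S'" unfolding *(6) e(2)[symmetric] by simp
  thus ?thesis
    unfolding dvd_in_def using smult_polys_over[OF e(1) *(4)] by (intro bexI[of _ "smult e S'"])
qed

text \<open>Every nonunit constant divisor takes at least one prime out of the leading coefficient,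
  so extracting such divisors terminates.\<close>

lemma primitive_part:
  assumes "P \<in> polys_over R" "P \<noteq> 0"
  shows "\<exists>c\<in>R. \<exists>P'\<in>polys_over R. c \<noteq> 0 \<and> P = smult c P' \<and> primitive_in R P'"
proof -
  have "\<exists>c\<in>R. \<exists>P'\<in>polys_over R. c \<noteq> 0 \<and> P = smult c P' \<and> primitive_in R P'"
    if "prime_product R n (Polynomial.lead_coeff P)" "P \<in> polys_over R" "P \<noteq> 0" for n P
    using that
  proof (induction n arbitrary: P rule: less_induct)
    case (less n)
    show ?case
    proof (cases "primitive_in R P")
      case True
      thus ?thesis using less.prems one by (intro bexI[of _ 1] bexI[of _ P]) auto
    next
      case False
      then obtain c Q where c: "c \<in> R" "\<not> dvd_in R c 1" "Q \<in> polys_over R" "P = smult c Q"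
        unfolding primitive_in_def dvd_in_def by auto
      have "c \<noteq> 0" "Q \<noteq> 0" using c less.prems by auto
      have "Polynomial.lead_coeff P = c * Polynomial.lead_coeff Q" using c by simp
      moreover have "Polynomial.lead_coeff Q \<in> R" using c by (auto simp: polys_over_def)
      ultimately obtain i j where ij: "n = i + j" "prime_product R i c"
          "prime_product R j (Polynomial.lead_coeff Q)"
        using prime_product_split[OF less.prems(1)] c(1) by blast
      have "i \<noteq> 0" using ij(2) c(2) prime_product_0 by metis
      hence "j < n" using ij by simp
      from less.IH[OF this ij(3) c(3) \<open>Q \<noteq> 0\<close>] obtain c' P'
        where *: "c' \<in> R" "P' \<in> polys_over R" "c' \<noteq> 0" "Q = smult c' P'" "primitive_in R P'"
        by blast
      show ?thesis using * c \<open>c \<noteq> 0\<close>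
        by (intro bexI[of _ "c * c'"] bexI[of _ P']) (auto intro: mult)
    qed
  qed
  moreover have "Polynomial.lead_coeff P \<in> R" "Polynomial.lead_coeff P \<noteq> 0"
    using assms by (auto simp: polys_over_def)
  then obtain n where "prime_product R n (Polynomial.lead_coeff P)"
    using factorial unfolding factorial_in_def by blast
  ultimately show ?thesis using assms by blast
qed

text \<open>The Bezout argument over the fraction field, carried out inside \<open>R\<close>: an
  element \<open>M\<close> of least degree in the ideal generated by \<open>P\<close> and
  \<open>A\<close> divides all of it up to nonzero constants. As \<open>P\<close> has no two factors
  of positive degree, \<open>M\<close> is a constant multiple of \<open>P\<close>, whence
  \<open>P\<close> divides \<open>A\<close>, or a constant, whence \<open>P\<close> divides
  \<open>B\<close>.\<close>

lemma irreducible_primitive_prime: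
  assumes P: "P \<in> polys_over R" "Polynomial.degree P > 0" and prim: "primitive_in R P"
    and irr: "\<And>Q S. Q \<in> polys_over R \<Longrightarrow> S \<in> polys_over R \<Longrightarrow> P = Q * S \<Longrightarrow>
                Polynomial.degree Q = 0 \<or> Polynomial.degree S = 0"
  shows "prime_in (polys_over R) P"
  unfolding prime_in_def
proof (intro conjI ballI impI)
  interpret Q: sub_idom "polys_over R" by (rule polys_over)
  show "P \<in> polys_over R" and "P \<noteq> 0" using P by auto
  show "\<not> dvd_in (polys_over R) P 1"
  proof
    assume "dvd_in (polys_over R) P 1"
    then obtain S where "1 = P * S" by (auto simp: dvd_in_def)
    hence "Polynomial.degree P + Polynomial.degree S = 0"
      by (metis degree_1 degree_mult_eq mult_zero_left mult_zero_right zero_neq_one)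
    thus False using P by simp
  qed
  fix A B assume AB: "A \<in> polys_over R" "B \<in> polys_over R"
    and dvd: "dvd_in (polys_over R) P (A * B)"
  show "dvd_in (polys_over R) P A \<or> dvd_in (polys_over R) P B"
  proof -
    define J where "J = {W * P + Y * A | W Y. W \<in> polys_over R \<and> Y \<in> polys_over R}"
    have J_sub: "J \<subseteq> polys_over R"
      using P AB by (auto simp: J_def intro: Q.add Q.mult)
    have "P \<in> J" unfolding J_def using Q.one Q.zero by force
    have "A \<in> J" unfolding J_def using Q.one Q.zero by force
    define M where "M = arg_min Polynomial.degree (\<lambda>Z. Z \<in> J \<and> Z \<noteq> 0)"
    have M: "M \<in> J" "M \<noteq> 0" and M_min: "\<And>Z. Z \<in> J \<Longrightarrow> Z \<noteq> 0 \<Longrightarrow> Polynomial.degree M \<le> Polynomial.degree Z"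
      using arg_min_nat_lemma[of "\<lambda>Z. Z \<in> J \<and> Z \<noteq> 0" P Polynomial.degree] \<open>P \<in> J\<close> \<open>P \<noteq> 0\<close>
      unfolding M_def by blast+
    have M': "M \<in> polys_over R" using M J_sub by auto
    have J_mult: "Z * W \<in> J" if "Z \<in> J" "W \<in> polys_over R" for Z W
    proof -
      from that(1) obtain W1 Y1 where "Z = W1 * P + Y1 * A" "W1 \<in> polys_over R" "Y1 \<in> polys_over R"
        by (auto simp: J_def)
      hence "Z * W = (W1 * W) * P + (Y1 * W) * A" "W1 * W \<in> polys_over R" "Y1 * W \<in> polys_over R"
        using that by (auto simp: algebra_simps intro: Q.mult)
      thus ?thesis unfolding J_def by blast
    qed
    have J_diff: "Z - Z' \<in> J" if "Z \<in> J" "Z' \<in> J" for Z Z'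
    proof -
      from that obtain W1 Y1 W2 Y2 where "Z = W1 * P + Y1 * A" "W1 \<in> polys_over R" "Y1 \<in> polys_over R"
        "Z' = W2 * P + Y2 * A" "W2 \<in> polys_over R" "Y2 \<in> polys_over R"
        by (auto simp: J_def)
      hence "Z - Z' = (W1 - W2) * P + (Y1 - Y2) * A" "W1 - W2 \<in> polys_over R" "Y1 - Y2 \<in> polys_over R"
        by (auto simp: algebra_simps intro: Q.diff)
      thus ?thesis unfolding J_def by blast
    qed
    have M_dvd: "\<exists>c\<in>R. \<exists>S\<in>polys_over R. c \<noteq> 0 \<and> smult c Z = M * S" if Z: "Z \<in> J" for Z
    proof -
      from pseudo_division[OF M' M(2), of Z] Z J_sub obtain c S T where
        *: "c \<in> R" "S \<in> polys_over R" "T \<in> polys_over R" "c \<noteq> 0" "smult c Z = M * S + T"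
        "T = 0 \<or> Polynomial.degree T < Polynomial.degree M" by blast
      have "T = Z * [:c:] - M * S" using *(5) by simp
      moreover have "[:c:] \<in> polys_over R" using * by (simp add: pCons_polys_over Q.zero)
      ultimately have "T \<in> J" using Z M * J_mult J_diff by metis
      hence "T = 0" using M_min[of T] *(6) by fastforce
      thus ?thesis using * by auto
    qed
    from M_dvd[OF \<open>P \<in> J\<close>] obtain c S where c: "c \<in> R" "S \<in> polys_over R" "c \<noteq> 0" "smult c P = M * S"
      by blast
    obtain n where n: "prime_product R n c" using c factorial by (auto simp: factorial_in_def)
    from split_constant[OF n P(1) M' c(2,4)] obtain c1 c2 M1 S1 where
      c1: "c1 \<in> R" "c2 \<in> R" "M1 \<in> polys_over R" "S1 \<in> polys_over R" "c = c1 * c2"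
        "M = smult c1 M1" "S = smult c2 S1" "P = M1 * S1" by (elim bexE conjE) (rule that)
    from irr[OF c1(3,4,8)] show ?thesis
    proof
      assume "Polynomial.degree S1 = 0"
      then obtain s where s: "S1 = [:s:]" by (metis degree_eq_zeroE)
      hence "s \<in> R" using c1 by (simp add: pCons_polys_over)
      moreover have "dvd_in (polys_over R) [:s:] P"
        unfolding dvd_in_def using c1(3,8) s by (intro bexI[of _ M1]) simp_all
      ultimately have "dvd_in R s 1" using prim unfolding primitive_in_def by blast
      then obtain e where e: "e \<in> R" "1 = s * e" unfolding dvd_in_def by blast
      have "smult e P = smult (s * e) M1" unfolding c1(8) s by (simp add: mult.commute)
      hence "smult e P = M1" using e(2) by (metis smult_1_left)
      hence M_eq: "M = P * [:c1 * e:]" unfolding c1(6) by (simp flip: smult_smult)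
      from M_dvd[OF \<open>A \<in> J\<close>] obtain c' S' where
        c': "c' \<in> R" "S' \<in> polys_over R" "c' \<noteq> 0" "smult c' A = M * S'" by blast
      have "smult c' A = P * ([:c1 * e:] * S')" using c' M_eq by (simp add: mult.assoc)
      moreover have "[:c1 * e:] * S' \<in> polys_over R"
        using c1 e c' by (intro Q.mult) (auto simp: pCons_polys_over Q.zero mult)
      ultimately have "dvd_in (polys_over R) P (smult c' A)"
        unfolding dvd_in_def by (intro bexI[of _ "[:c1 * e:] * S'"])
      thus ?thesis using primitive_dvd_cancel[OF c'(1,3) P(1) prim AB(1)] by blast
    next
      assume "Polynomial.degree M1 = 0"
      hence "Polynomial.degree M = 0" using c1 by simp
      then obtain s where s: "M = [:s:]" by (metis degree_eq_zeroE)
      have sR: "s \<in> R" "s \<noteq> 0" using M M' s by (auto simp: pCons_polys_over)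
      obtain W Y where XY: "M = W * P + Y * A" "W \<in> polys_over R" "Y \<in> polys_over R"
        using M by (auto simp: J_def)
      obtain T where T: "A * B = P * T" "T \<in> polys_over R" using dvd by (auto simp: dvd_in_def)
      \<comment> \<open>Multiplying the Bezout relation for the constant \<open>M\<close> by
        \<open>B\<close> leaves a multiple of \<open>P\<close>, since \<open>P\<close> divides
        \<open>A * B\<close>.\<close>
      have "smult s B = M * B" using s by simp
      also have "\<dots> = W * P * B + Y * (A * B)" using XY by (simp add: algebra_simps)
      also have "\<dots> = P * (W * B + Y * T)" using T by (simp add: algebra_simps)
      finally have "dvd_in (polys_over R) P (smult s B)"
        unfolding dvd_in_def using XY T AB by (auto intro!: Q.add Q.mult)
      thus ?thesis using primitive_dvd_cancel[OF sR P(1) prim AB(2)] by blast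
    qed
  qed
qed

text \<open>The content is a product of constant primes; the primitive part is either prime or
  splits into factors of smaller degree.\<close>

theorem factorial_polys_over: "factorial_in (polys_over R)"
proof -
  interpret Q: sub_idom "polys_over R" by (rule polys_over)
  have const: "prime_product (polys_over R) n [:c:]" if "prime_product R n c" for n c
    using that
  proof (induction rule: prime_product.induct)
    case (unit c)
    thus ?case using dvd_in_const_1 by (auto simp: Q.prime_product_0 pCons_polys_over Q.zero)
  next
    case (step q n c)
    thus ?case using prime_product.step[OF prime_in_const[OF step.hyps(1)]] by force
  qed
  have const': "\<exists>n. prime_product (polys_over R) n [:c:]" if "c \<in> R" "c \<noteq> 0" for c
    using factorial that const unfolding factorial_in_def by blast
  have "\<exists>n. prime_product (polys_over R) n P" if "P \<in> polys_over R" "P \<noteq> 0" for P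
    using that
  proof (induction "Polynomial.degree P" arbitrary: P rule: less_induct)
    case less
    show ?case
    proof (cases "Polynomial.degree P = 0")
      case True
      then obtain c where "P = [:c:]" by (metis degree_eq_zeroE)
      thus ?thesis using less.prems const'[of c] by (auto simp: pCons_polys_over)
    next
      case False
      obtain c P' where c: "c \<in> R" "P' \<in> polys_over R" "c \<noteq> 0" "P = smult c P'" "primitive_in R P'"
        using primitive_part less.prems by blast
      have deg: "Polynomial.degree P' = Polynomial.degree P" using c by simp
      have "\<exists>n. prime_product (polys_over R) n P'"
      proof (cases "\<exists>Q\<in>polys_over R. \<exists>S\<in>polys_over R. P' = Q * S \<and>
                      Polynomial.degree Q \<noteq> 0 \<and> Polynomial.degree S \<noteq> 0")
        case True
        then obtain Q S where QS: "Q \<in> polys_over R" "S \<in> polys_over R" "P' = Q * S"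
          "Polynomial.degree Q \<noteq> 0" "Polynomial.degree S \<noteq> 0" by blast
        have "Q \<noteq> 0" "S \<noteq> 0" using QS by auto
        hence "Polynomial.degree Q < Polynomial.degree P" "Polynomial.degree S < Polynomial.degree P"
          using QS deg by (auto simp: degree_mult_eq)
        with less.hyps[of Q] less.hyps[of S] QS \<open>Q \<noteq> 0\<close> \<open>S \<noteq> 0\<close> Q.prime_product_mult
        show ?thesis by blast
      next
        case irr: False
        have "prime_in (polys_over R) P'"
          using irreducible_primitive_prime[OF c(2) _ c(5)] irr deg False by fastforce
        from prime_product.step[OF this prime_product.unit[of 1]] show ?thesis
          using Q.one by (auto simp: dvd_in_def)
      qed
      moreover obtain m where "prime_product (polys_over R) m [:c:]" using const' c by blast
      moreover have "P = [:c:] * P'" using c by simp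
      ultimately show ?thesis using Q.prime_product_mult by metis
    qed
  qed
  thus ?thesis by (auto simp: factorial_in_def)
qed

end

text \<open>Primes, units and factorisations are expressed by multiplication, 0 and 1, so an
  injective map respecting these carries them over.\<close>

lemma factorial_in_image:
  assumes S: "sub_idom S" "factorial_in S"
    and hom: "\<And>a b. a \<in> S \<Longrightarrow> b \<in> S \<Longrightarrow> \<phi> (a * b) = \<phi> a * \<phi> b" "\<phi> 1 = 1" "\<phi> 0 = 0"
    and inj: "inj_on \<phi> S"
  shows "factorial_in (\<phi> ` S)"
proof -
  interpret S: sub_idom S by (rule S(1))
  have dvd: "dvd_in (\<phi> ` S) (\<phi> a) (\<phi> b) \<longleftrightarrow> dvd_in S a b" if "a \<in> S" "b \<in> S" for a b
  proof -
    have "\<phi> b = \<phi> a * \<phi> c \<longleftrightarrow> b = a * c" if "c \<in> S" for c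
      using inj that \<open>a \<in> S\<close> \<open>b \<in> S\<close> hom(1)[of a c] S.mult[of a c] by (auto simp: inj_on_def)
    thus ?thesis by (auto simp: dvd_in_def)
  qed
  have nz: "\<phi> a = 0 \<longleftrightarrow> a = 0" if "a \<in> S" for a
    using inj that hom(3) S.zero by (auto simp: inj_on_def)
  have prime: "prime_in (\<phi> ` S) (\<phi> q)" if "prime_in S q" for q
    unfolding prime_in_def
  proof (intro conjI ballI impI)
    show "\<phi> q \<in> \<phi> ` S" "\<phi> q \<noteq> 0" "\<not> dvd_in (\<phi> ` S) (\<phi> q) 1"
      using that nz dvd[of q 1] S.one hom(2) by (auto simp: prime_in_def)
    fix a b assume "a \<in> \<phi> ` S" "b \<in> \<phi> ` S" "dvd_in (\<phi> ` S) (\<phi> q) (a * b)"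
    then obtain a' b' where "a = \<phi> a'" "b = \<phi> b'" "a' \<in> S" "b' \<in> S" by auto
    thus "dvd_in (\<phi> ` S) (\<phi> q) a \<or> dvd_in (\<phi> ` S) (\<phi> q) b"
      using \<open>dvd_in (\<phi> ` S) (\<phi> q) (a * b)\<close> that dvd S.mult hom(1)
      unfolding prime_in_def by metis
  qed
  have "prime_product (\<phi> ` S) n (\<phi> a)" if "prime_product S n a" for n a
    using that
  proof (induction rule: prime_product.induct)
    case (unit a)
    thus ?case using dvd[of a 1] S.one hom(2) by (auto intro: prime_product.unit)
  next
    case (step q n a)
    thus ?case using prime_product.step[OF prime[OF step.hyps(1)] step.IH] hom(1)[of q a]
        S.prime_product_in[OF step.hyps(2)] by (auto simp: prime_in_def)
  qed
  thus ?thesis using S(2) nz unfolding factorial_in_def by blast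
qed

section \<open>Polynomials inside the power series ring\<close>

lemma mfps_nth_Abs [simp]: "mfps_nth (Abs_mfps g) = g"
  by (simp add: Abs_mfps_inverse)

lemmas mfps_nth_ops = zero_mfps.rep_eq one_mfps.rep_eq plus_mfps.rep_eq minus_mfps.rep_eq
  uminus_mfps.rep_eq

lemma mfps_nth_sum: "mfps_nth (sum g I) m = (\<Sum>i\<in>I. mfps_nth (g i) m)"
  by (induction I rule: infinite_finite_induct) (auto simp: mfps_nth_ops)

lemma mfps_mult_nonzeroE:
  assumes "mfps_nth (f * g) m \<noteq> 0"
  obtains u v where "m = u + v" "mfps_nth f u \<noteq> 0" "mfps_nth g v \<noteq> 0"
proof -
  from assms obtain z where "z \<in> exponent_splits m"
      "(case z of (u, v) \<Rightarrow> mfps_nth f u * mfps_nth g v) \<noteq> 0"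
    unfolding times_mfps.rep_eq by (rule sum.not_neutral_contains_not_neutral)
  thus ?thesis using that[of "fst z" "snd z"]
    by (cases z) (auto simp: exponent_splits_def dest: mult_not_zero)
qed

definition mfps_monom :: "'a::zero \<Rightarrow> ('n \<Rightarrow> nat) \<Rightarrow> ('n, 'a) mfps" where
  "mfps_monom c e = Abs_mfps (\<lambda>m. if m = e then c else 0)"

lemma mfps_nth_monom_mult:
  fixes g :: "('n::finite, 'a::comm_ring_1) mfps"
  shows "mfps_nth (mfps_monom c e * g) m = (if e \<le> m then c * mfps_nth g (m - e) else 0)"
proof -
  have le: "e \<le> e + u" "e + u - e = u" for u :: "'n \<Rightarrow> nat"
    by (auto simp: le_fun_def)
  have le': "e + (m - e) = m" if "e \<le> m"
    using that by (auto simp: le_fun_def)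
  have "mfps_nth (mfps_monom c e * g) m =
      (\<Sum>z\<in>exponent_splits m. if z = (e, m - e) then c * mfps_nth g (m - e) else 0)"
    unfolding times_mfps.rep_eq
    by (rule sum.cong) (auto simp: mfps_monom_def exponent_splits_def le split: if_splits)
  also have "\<dots> = (if e \<le> m then c * mfps_nth g (m - e) else 0)"
    using le' le(1)[of "m - e"]
    by (subst sum.delta[OF finite_exponent_splits]) (auto simp: exponent_splits_def)
  finally show ?thesis .
qed

lemma mfps_monom_0: "mfps_monom 1 0 = 1"
  by (rule mfps_eqI) (simp add: mfps_monom_def mfps_nth_ops)

lemma mfps_monom_mult:
  fixes a b :: "'a::comm_ring_1" and u v :: "'n::finite \<Rightarrow> nat"
  shows "mfps_monom a u * mfps_monom b v = mfps_monom (a * b) (u + v)"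
proof (rule mfps_eqI)
  fix m
  have "u \<le> m \<and> m - u = v \<longleftrightarrow> m = u + v"
    by (auto simp: le_fun_def fun_eq_iff)
       (metis le_add_diff_inverse)+
  thus "mfps_nth (mfps_monom a u * mfps_monom b v) m = mfps_nth (mfps_monom (a * b) (u + v)) m"
    unfolding mfps_nth_monom_mult by (auto simp: mfps_monom_def)
qed

lemma sub_idom_mpolys: "sub_idom (mpolys :: ('n::finite, 'a::idom) mfps set)"
proof
  show "1 \<in> (mpolys :: ('n, 'a) mfps set)"
    by (simp add: mpolys_def mfps_nth_ops)
  fix f g :: "('n, 'a) mfps"
  assume fg: "f \<in> mpolys" "g \<in> mpolys"
  show "f - g \<in> mpolys"
    unfolding mpolys_def mem_Collect_eq
    by (rule finite_subset[of _ "{m. mfps_nth f m \<noteq> 0} \<union> {m. mfps_nth g m \<noteq> 0}"])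
       (use fg in \<open>auto simp: mpolys_def mfps_nth_ops\<close>)
  show "f * g \<in> mpolys"
    unfolding mpolys_def mem_Collect_eq
    by (rule finite_subset[of _ "(\<lambda>(u, v). u + v) ` ({m. mfps_nth f m \<noteq> 0} \<times> {m. mfps_nth g m \<noteq> 0})"])
       (use fg in \<open>auto simp: mpolys_def elim!: mfps_mult_nonzeroE\<close>)
qed

interpretation mpolys: sub_idom mpolys by (rule sub_idom_mpolys)

lemma mfps_monom_mpolys: "mfps_monom c e \<in> mpolys"
  by (auto simp: mpolys_def mfps_monom_def)

definition mpolys_in :: "'n set \<Rightarrow> ('n, 'a::zero) mfps set" where
  "mpolys_in V = {g \<in> mpolys. \<forall>m. mfps_nth g m \<noteq> 0 \<longrightarrow> (\<forall>i. i \<notin> V \<longrightarrow> m i = 0)}"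

lemma sub_idom_mpolys_in: "sub_idom (mpolys_in V :: ('n::finite, 'a::idom) mfps set)"
proof
  show "1 \<in> (mpolys_in V :: ('n, 'a) mfps set)"
    using mpolys.one by (auto simp: mpolys_in_def mfps_nth_ops split: if_splits)
  fix f g :: "('n, 'a) mfps"
  assume fg: "f \<in> mpolys_in V" "g \<in> mpolys_in V"
  have nz: "mfps_nth f m \<noteq> 0 \<or> mfps_nth g m \<noteq> 0" if "mfps_nth (f - g) m \<noteq> 0" for m
    using that by (auto simp: mfps_nth_ops)
  show "f - g \<in> mpolys_in V"
    using fg mpolys.diff nz unfolding mpolys_in_def by blast
  show "f * g \<in> mpolys_in V"
    using fg mpolys.mult by (fastforce simp: mpolys_in_def elim!: mfps_mult_nonzeroE)
qed

lemma factorial_mpolys_in_empty: "factorial_in (mpolys_in {} :: ('n::finite, 'a::field) mfps set)"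
  unfolding factorial_in_def
proof (intro ballI impI)
  interpret S: sub_idom "mpolys_in {} :: ('n, 'a) mfps set" by (rule sub_idom_mpolys_in)
  fix g :: "('n, 'a) mfps" assume g: "g \<in> mpolys_in {}" "g \<noteq> 0"
  define c where "c = mfps_nth g 0"
  have nz: "mfps_nth g m = 0" if "m \<noteq> 0" for m
    using g that by (auto simp: mpolys_in_def fun_eq_iff)
  have g_eq: "g = mfps_monom c 0"
    by (rule mfps_eqI) (auto simp: mfps_monom_def c_def nz)
  have "c \<noteq> 0"
    using g g_eq by (auto simp: mfps_monom_def mfps_eqI mfps_nth_ops)
  hence "1 = g * mfps_monom (inverse c) 0"
    by (simp add: g_eq mfps_monom_mult mfps_monom_0)
  moreover have "mfps_monom (inverse c) 0 \<in> (mpolys_in {} :: ('n, 'a) mfps set)"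
    using mfps_monom_mpolys by (auto simp: mpolys_in_def mfps_monom_def split: if_splits)
  ultimately have "prime_product (mpolys_in {}) 0 g"
    using g by (auto simp: S.prime_product_0 dvd_in_def)
  thus "\<exists>n. prime_product (mpolys_in {}) n g" by blast
qed

definition unit_exponent :: "'n \<Rightarrow> nat \<Rightarrow> 'n \<Rightarrow> nat" where
  "unit_exponent x j = (\<lambda>i. if i = x then j else 0)"

lemma mfps_monom_unit_power:
  "mfps_monom 1 (unit_exponent x 1) ^ j = (mfps_monom 1 (unit_exponent x j) :: ('n::finite, 'a::comm_ring_1) mfps)"
proof (induction j)
  case 0
  have "unit_exponent x 0 = 0" by (auto simp: unit_exponent_def)
  thus ?case by (simp only: mfps_monom_0 power_0)
next
  case (Suc j)
  have "unit_exponent x 1 + unit_exponent x j = unit_exponent x (Suc j)"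
    by (auto simp: unit_exponent_def)
  thus ?case using Suc by (simp add: mfps_monom_mult)
qed

text \<open>No coefficient involves the variable \<open>x\<close>, so the entry \<open>m x\<close>
  tells which coefficient contributes at \<open>m\<close>, and different powers cannot cancel. The
  description of \<open>mpolys_in (insert x V)\<close> as a polynomial ring and the uniqueness of
  the coefficients rest on this.\<close>

lemma mfps_nth_poly_var:
  fixes P :: "('n::finite, 'a::idom) mfps poly"
  assumes P: "P \<in> polys_over (mpolys_in V)" and x: "x \<notin> V"
  shows "mfps_nth (poly P (mfps_monom 1 (unit_exponent x 1))) m =
           mfps_nth (Polynomial.coeff P (m x)) (m(x := 0))"
proof -
  have *: "mfps_nth (Polynomial.coeff P j * mfps_monom 1 (unit_exponent x j)) m =
      (if j = m x then mfps_nth (Polynomial.coeff P (m x)) (m(x := 0)) else 0)" for j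
  proof -
    have le: "unit_exponent x j \<le> m \<longleftrightarrow> j \<le> m x"
      by (auto simp: unit_exponent_def le_fun_def)
    have eq: "m - unit_exponent x (m x) = m(x := 0)"
      by (auto simp: unit_exponent_def)
    have zero: "mfps_nth (Polynomial.coeff P j) (m - unit_exponent x j) = 0" if "j < m x"
    proof (rule ccontr)
      assume "\<not> ?thesis"
      hence "(m - unit_exponent x j) x = 0"
        using P x unfolding polys_over_def mpolys_in_def by blast
      thus False using that by (simp add: unit_exponent_def)
    qed
    show ?thesis
      unfolding mult.commute[of "Polynomial.coeff P j"] mfps_nth_monom_mult le
      using zero eq by auto
  qed
  have "mfps_nth (poly P (mfps_monom 1 (unit_exponent x 1))) m =
     (\<Sum>j\<le>Polynomial.degree P. if j = m x then mfps_nth (Polynomial.coeff P (m x)) (m(x := 0)) else 0)"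
    unfolding poly_altdef mfps_nth_sum mfps_monom_unit_power * ..
  also have "\<dots> = mfps_nth (Polynomial.coeff P (m x)) (m(x := 0))"
    by (auto simp: coeff_eq_0 mfps_nth_ops)
  finally show ?thesis .
qed

lemma polys_over_mono: "R \<subseteq> S \<Longrightarrow> polys_over R \<subseteq> polys_over S"
  by (auto simp: polys_over_def)

lemma mpolys_in_insert:
  assumes x: "x \<notin> V"
  shows "(mpolys_in (insert x V) :: ('n::finite, 'a::idom) mfps set) =
           (\<lambda>P. poly P (mfps_monom 1 (unit_exponent x 1))) ` polys_over (mpolys_in V)"
    (is "?R = ?\<phi> ` _")
proof (intro equalityI subsetI)
  interpret S: sub_idom "mpolys_in (insert x V) :: ('n, 'a) mfps set" by (rule sub_idom_mpolys_in)
  have t: "mfps_monom 1 (unit_exponent x 1) \<in> (mpolys_in (insert x V) :: ('n, 'a) mfps set)"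
    using mfps_monom_mpolys
    by (auto simp: mpolys_in_def mfps_monom_def unit_exponent_def split: if_splits)
  have "mpolys_in V \<subseteq> (mpolys_in (insert x V) :: ('n, 'a) mfps set)"
    by (auto simp: mpolys_in_def)
  hence "polys_over (mpolys_in V) \<subseteq> polys_over (mpolys_in (insert x V) :: ('n, 'a) mfps set)"
    by (rule polys_over_mono)
  thus "g \<in> ?R" if "g \<in> ?\<phi> ` polys_over (mpolys_in V)" for g
    using that S.poly_in[OF _ t] by blast
next
  fix g :: "('n, 'a) mfps" assume g: "g \<in> ?R"
  hence fin: "finite {m. mfps_nth g m \<noteq> 0}" by (auto simp: mpolys_in_def mpolys_def)
  \<comment> \<open>\<open>s j\<close> is the coefficient of the \<open>j\<close>-th power of the
    variable \<open>x\<close> in \<open>g\<close>; its monomials have exponent 0 at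
    \<open>x\<close>.\<close>
  define s :: "nat \<Rightarrow> ('n, 'a) mfps"
    where "s = (\<lambda>j. Abs_mfps (\<lambda>m. if m x = 0 then mfps_nth g (m(x := j)) else 0))"
  have "\<forall>\<^sub>\<infinity>j. s j = 0"
    unfolding MOST_iff_cofinite
  proof (rule finite_subset)
    show "{j. s j \<noteq> 0} \<subseteq> (\<lambda>m. m x) ` {m. mfps_nth g m \<noteq> 0}"
    proof
      fix j assume "j \<in> {j. s j \<noteq> 0}"
      then obtain m where "mfps_nth (s j) m \<noteq> 0"
        using mfps_eqI[of "s j" 0] by (auto simp only: zero_mfps.rep_eq mem_Collect_eq)
      hence "mfps_nth g (m(x := j)) \<noteq> 0" by (auto simp: s_def split: if_splits)
      thus "j \<in> (\<lambda>m. m x) ` {m. mfps_nth g m \<noteq> 0}"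
        by (intro image_eqI[of _ _ "m(x := j)"]) auto
    qed
  qed (use fin in auto)
  hence coeff: "Polynomial.coeff (Abs_poly s) = s" by (intro Abs_poly_inverse) auto
  have "s j \<in> mpolys_in V" for j
  proof -
    have "{m. mfps_nth (s j) m \<noteq> 0} \<subseteq> (\<lambda>m. m(x := 0)) ` {m. mfps_nth g m \<noteq> 0}"
    proof
      fix m assume "m \<in> {m. mfps_nth (s j) m \<noteq> 0}"
      hence "m x = 0" "mfps_nth g (m(x := j)) \<noteq> 0" by (auto simp: s_def split: if_splits)
      thus "m \<in> (\<lambda>m. m(x := 0)) ` {m. mfps_nth g m \<noteq> 0}"
        by (intro image_eqI[of _ _ "m(x := j)"]) auto
    qed
    hence "finite {m. mfps_nth (s j) m \<noteq> 0}" using fin finite_subset by blast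
    moreover have "m i = 0" if "mfps_nth (s j) m \<noteq> 0" "i \<notin> V" for m i
    proof (cases "i = x")
      case True
      thus ?thesis using that by (auto simp: s_def split: if_splits)
    next
      case False
      have "mfps_nth g (m(x := j)) \<noteq> 0" using that by (auto simp: s_def split: if_splits)
      hence "(m(x := j)) i = 0" using g that False unfolding mpolys_in_def by blast
      thus ?thesis using False by simp
    qed
    ultimately show ?thesis by (auto simp: mpolys_in_def mpolys_def)
  qed
  hence P: "Abs_poly s \<in> polys_over (mpolys_in V)" by (auto simp: polys_over_def coeff)
  have "?\<phi> (Abs_poly s) = g"
    by (rule mfps_eqI) (simp only: mfps_nth_poly_var[OF P x] coeff, simp add: s_def)
  thus "g \<in> ?\<phi> ` polys_over (mpolys_in V)" using P by blast
qed

text \<open>Gauss's theorem once for each variable, transported into the fixed power series ring by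
  evaluation at the new variable.\<close>

lemma factorial_mpolys_in: "finite V \<Longrightarrow> factorial_in (mpolys_in V :: ('n::finite, 'a::field) mfps set)"
proof (induction V rule: finite_induct)
  case empty
  show ?case by (rule factorial_mpolys_in_empty)
next
  case (insert x V)
  interpret S: factorial_sub_idom "mpolys_in V :: ('n, 'a) mfps set"
    by (intro factorial_sub_idom.intro sub_idom_mpolys_in factorial_sub_idom_axioms.intro insert.IH)
  show ?case
    unfolding mpolys_in_insert[OF insert.hyps(2)]
  proof (rule factorial_in_image)
    show "inj_on (\<lambda>P. poly P (mfps_monom 1 (unit_exponent x 1)))
        (polys_over (mpolys_in V) :: ('n, 'a) mfps poly set)"
    proof (rule inj_onI)
      fix P Q :: "('n, 'a) mfps poly"
      assume PQ: "P \<in> polys_over (mpolys_in V)" "Q \<in> polys_over (mpolys_in V)"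
        and eq: "poly P (mfps_monom 1 (unit_exponent x 1)) = poly Q (mfps_monom 1 (unit_exponent x 1))"
      have "mfps_nth (Polynomial.coeff P j) m = mfps_nth (Polynomial.coeff Q j) m" for j m
      proof (cases "m x = 0")
        case True
        hence "m(x := 0) = m" by auto
        \<comment> \<open>The exponent \<open>m(x := j)\<close> isolates the coefficient of index
          \<open>j\<close> on both sides.\<close>
        thus ?thesis
          using arg_cong[OF eq, of "\<lambda>g. mfps_nth g (m(x := j))"]
          unfolding mfps_nth_poly_var[OF PQ(1) insert.hyps(2)] mfps_nth_poly_var[OF PQ(2) insert.hyps(2)]
          by simp
      next
        case False
        have "mfps_nth (Polynomial.coeff C j) m = 0" if "C \<in> polys_over (mpolys_in V)"
          for C :: "('n, 'a) mfps poly"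
        proof -
          have "Polynomial.coeff C j \<in> mpolys_in V" using that by (simp add: polys_over_def)
          thus ?thesis using False insert.hyps(2) by (auto simp: mpolys_in_def)
        qed
        thus ?thesis using PQ by simp
      qed
      thus "P = Q" by (intro poly_eqI mfps_eqI)
    qed
  qed (use S.polys_over S.factorial_polys_over in auto)
qed

lemma factorial_mpolys: "factorial_in (mpolys :: ('n::finite, 'a::field) mfps set)"
proof -
  have "factorial_in (mpolys_in UNIV :: ('n, 'a) mfps set)"
    by (rule factorial_mpolys_in) simp
  thus ?thesis by (simp add: mpolys_in_def)
qed

interpretation mpolys: factorial_sub_idom "mpolys :: ('n::finite, 'a::field) mfps set"
  by (intro factorial_sub_idom.intro sub_idom_mpolys factorial_sub_idom_axioms.intro factorial_mpolys)

section \<open>Weighted degrees and an annihilator that minimises all of them\<close>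

definition weighted_degree :: "('n::finite \<Rightarrow> nat) \<Rightarrow> ('n \<Rightarrow> nat) \<Rightarrow> nat" where
  "weighted_degree w m = (\<Sum>i\<in>UNIV. w i * m i)"

lemma weighted_degree_add: "weighted_degree w (u + v) = weighted_degree w u + weighted_degree w v"
  by (simp add: weighted_degree_def sum.distrib distrib_left)

lemma finite_t_exponents:
  assumes "A \<in> polys_over mpolys"
  shows "finite (t_exponents A)"
proof (rule finite_subset)
  show "t_exponents A \<subseteq> (\<Union>j\<le>Polynomial.degree A. {m. mfps_nth (Polynomial.coeff A j) m \<noteq> 0})"
  proof
    fix m assume "m \<in> t_exponents A"
    then obtain j where j: "mfps_nth (Polynomial.coeff A j) m \<noteq> 0" by (auto simp: t_exponents_def)
    have "j \<le> Polynomial.degree A"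
      by (rule ccontr) (use j in \<open>simp add: coeff_eq_0 mfps_nth_ops\<close>)
    thus "m \<in> (\<Union>j\<le>Polynomial.degree A. {m. mfps_nth (Polynomial.coeff A j) m \<noteq> 0})"
      using j by blast
  qed
  show "finite (\<Union>j\<le>Polynomial.degree A. {m. mfps_nth (Polynomial.coeff A j) m \<noteq> 0})"
    using assms by (auto simp: polys_over_def mpolys_def)
qed

lemma t_exponents_nonempty:
  assumes "A \<noteq> 0"
  shows "t_exponents A \<noteq> {}"
proof
  assume "t_exponents A = {}"
  hence "mfps_nth (Polynomial.coeff A j) m = mfps_nth 0 m" for j m
    by (auto simp: t_exponents_def mfps_nth_ops)
  hence "A = 0" by (intro poly_eqI) (auto intro: mfps_eqI)
  thus False using assms by simp
qed

text \<open>The leading form of \<open>A\<close> when \<open>a\<close> is its largest weighted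
  degree in \<open>t\<close>; powers of \<open>y\<close> carry weight 0.\<close>

definition top_part :: "('n::finite \<Rightarrow> nat) \<Rightarrow> nat \<Rightarrow> ('n, 'a::comm_ring_1) mfps poly \<Rightarrow> ('n, 'a) mfps poly" where
  "top_part w a A =
     map_poly (\<lambda>c. Abs_mfps (\<lambda>m. if weighted_degree w m = a then mfps_nth c m else 0)) A"

lemma nth_coeff_top_part:
  "mfps_nth (Polynomial.coeff (top_part w a A) j) m =
     (if weighted_degree w m = a then mfps_nth (Polynomial.coeff A j) m else 0)"
  unfolding top_part_def
  by (subst coeff_map_poly) (auto simp: mfps_nth_ops intro: mfps_eqI)

text \<open>Weighted degrees add up in a product: the leading forms have a nonzero product because
  the ring is a domain, and in weight \<open>a + b\<close> this product agrees with
  \<open>A * B\<close>. Since \<open>b\<close> is nonnegative, the product reaches at least the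
  weight \<open>a\<close>.\<close>

lemma weighted_degree_mult_ge:
  fixes A B :: "('n::finite, 'a::field) mfps poly"
  assumes A: "A \<in> polys_over mpolys" "A \<noteq> 0" and B: "B \<in> polys_over mpolys" "B \<noteq> 0"
    and m: "m \<in> t_exponents A"
  shows "\<exists>m'\<in>t_exponents (A * B). weighted_degree w m \<le> weighted_degree w m'"
proof -
  let ?top = "\<lambda>A. Max (weighted_degree w ` t_exponents A)"
  define a b where "a = ?top A" and "b = ?top B"
  have le_top: "weighted_degree w u \<le> ?top C"
    if "C \<in> polys_over mpolys" "mfps_nth (Polynomial.coeff C j) u \<noteq> 0"
    for C :: "('n, 'a) mfps poly" and u j
    using that finite_t_exponents[OF that(1)] by (intro Max_ge) (auto simp: t_exponents_def)
  have top_nz: "top_part w (?top C) C \<noteq> 0" if "C \<in> polys_over mpolys" "C \<noteq> 0"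
    for C :: "('n, 'a) mfps poly"
  proof -
    have "?top C \<in> weighted_degree w ` t_exponents C"
      using finite_t_exponents[OF that(1)] t_exponents_nonempty[OF that(2)] by (intro Max_in) auto
    then obtain u j where "mfps_nth (Polynomial.coeff C j) u \<noteq> 0" "weighted_degree w u = ?top C"
      by (auto simp: t_exponents_def)
    hence "mfps_nth (Polynomial.coeff (top_part w (?top C) C) j) u \<noteq> 0"
      by (simp add: nth_coeff_top_part)
    moreover have "mfps_nth (Polynomial.coeff 0 j) u = (0 :: 'a)" by (simp add: mfps_nth_ops)
    ultimately show ?thesis by metis
  qed
  let ?A = "top_part w a A" and ?B = "top_part w b B"
  have "?A * ?B \<noteq> 0" using top_nz A B by (simp add: a_def b_def)
  then obtain u where "u \<in> t_exponents (?A * ?B)"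
    using t_exponents_nonempty by blast
  then obtain j where ju: "mfps_nth (Polynomial.coeff (?A * ?B) j) u \<noteq> 0"
    unfolding t_exponents_def by blast
  have nth_mult: "mfps_nth (Polynomial.coeff (C * D) j) u =
      (\<Sum>i\<le>j. \<Sum>(x, y)\<in>exponent_splits u.
        mfps_nth (Polynomial.coeff C i) x * mfps_nth (Polynomial.coeff D (j - i)) y)"
    for C D :: "('n, 'a) mfps poly"
    by (simp add: coeff_mult mfps_nth_sum times_mfps.rep_eq)
  from ju obtain i where "i \<le> j" "(\<Sum>(x, y)\<in>exponent_splits u.
        mfps_nth (Polynomial.coeff ?A i) x * mfps_nth (Polynomial.coeff ?B (j - i)) y) \<noteq> 0"
    unfolding nth_mult by (meson atMost_iff sum.not_neutral_contains_not_neutral)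
  then obtain z where "z \<in> exponent_splits u"
    "(case z of (x, y) \<Rightarrow> mfps_nth (Polynomial.coeff ?A i) x *
       mfps_nth (Polynomial.coeff ?B (j - i)) y) \<noteq> 0"
    by (meson sum.not_neutral_contains_not_neutral)
  hence "weighted_degree w u = a + b"
    by (auto simp: nth_coeff_top_part exponent_splits_def weighted_degree_add split: if_splits)
  have "mfps_nth (Polynomial.coeff (A * B) j) u = mfps_nth (Polynomial.coeff (?A * ?B) j) u"
    unfolding nth_mult
  \<comment> \<open>Exponents with nonzero coefficients have weights at most \<open>a\<close> and
    \<open>b\<close>; if they add up to \<open>a + b\<close>, they are exactly these.\<close>
  proof (intro sum.cong refl, clarify)
    fix i x y assume "(x, y) \<in> exponent_splits u"
    hence "weighted_degree w x + weighted_degree w y = a + b"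
      using \<open>weighted_degree w u = a + b\<close> by (auto simp: exponent_splits_def weighted_degree_add)
    thus "mfps_nth (Polynomial.coeff A i) x * mfps_nth (Polynomial.coeff B (j - i)) y =
       mfps_nth (Polynomial.coeff ?A i) x * mfps_nth (Polynomial.coeff ?B (j - i)) y"
      using le_top[OF A(1), of i x] le_top[OF B(1), of "j - i" y]
      unfolding nth_coeff_top_part a_def[symmetric] b_def[symmetric]
      by (cases "mfps_nth (Polynomial.coeff A i) x = 0";
          cases "mfps_nth (Polynomial.coeff B (j - i)) y = 0") auto
  qed
  with ju have "mfps_nth (Polynomial.coeff (A * B) j) u \<noteq> 0" by argo
  hence "u \<in> t_exponents (A * B)" unfolding t_exponents_def by blast
  moreover have "weighted_degree w m \<le> a" using m le_top[OF A(1)] by (auto simp: t_exponents_def a_def)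
  ultimately show ?thesis using \<open>weighted_degree w u = a + b\<close> by (intro bexI[of _ u]) auto
qed

lemma annihilates_iff: "annihilates A f \<longleftrightarrow> A \<noteq> 0 \<and> A \<in> polys_over mpolys \<and> poly A f = 0"
  by (auto simp: annihilates_def polys_over_def)

text \<open>
  By Gauss's lemma a primitive annihilator of minimal degree divides every annihilator, so it
  minimises all weighted degrees in the variables at once.
\<close>

lemma minimal_annihilator:
  fixes f :: "('n::finite, 'k::field) mfps"
  assumes ex: "annihilates A0 f"
  obtains A where "annihilates A f"
    and "\<And>B. annihilates B f \<Longrightarrow> Polynomial.degree A \<le> Polynomial.degree B"
    and "\<And>B w m. annihilates B f \<Longrightarrow> m \<in> t_exponents A \<Longrightarrow>
           \<exists>m'\<in>t_exponents B. weighted_degree w m \<le> weighted_degree w m'"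
proof -
  interpret P: sub_idom "polys_over mpolys :: ('n, 'k) mfps poly set" by (rule mpolys.polys_over)
  define A1 where "A1 = arg_min Polynomial.degree (\<lambda>A. annihilates A f)"
  have A1: "annihilates A1 f"
    and A1_min: "\<And>B. annihilates B f \<Longrightarrow> Polynomial.degree A1 \<le> Polynomial.degree B"
    using arg_min_nat_lemma[of "\<lambda>A. annihilates A f", OF ex] unfolding A1_def by blast+
  from A1 have "A1 \<in> polys_over mpolys" "A1 \<noteq> 0" by (auto simp: annihilates_iff)
  from mpolys.primitive_part[OF this] obtain c A where
    A: "c \<noteq> 0" "A \<in> polys_over mpolys" "A1 = smult c A" "primitive_in mpolys A" by blast
  have ann: "annihilates A f" using A1 A by (auto simp: annihilates_iff)
  have deg: "Polynomial.degree A = Polynomial.degree A1" using A by simp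
  have dvd: "dvd_in (polys_over mpolys) A B" if B: "annihilates B f" for B
  proof -
    from B have B': "B \<in> polys_over mpolys" by (auto simp: annihilates_iff)
    from mpolys.pseudo_division[OF A(2) _ B'] ann obtain b S T where
      *: "b \<in> mpolys" "b \<noteq> 0" "S \<in> polys_over mpolys" "T \<in> polys_over mpolys"
        "smult b B = A * S + T" "T = 0 \<or> Polynomial.degree T < Polynomial.degree A"
      unfolding annihilates_iff by blast
    \<comment> \<open>The remainder annihilates \<open>f\<close> as well, and its degree is too
      small for a nonzero annihilator.\<close>
    have "poly T f = poly (smult b B) f - poly (A * S) f" using *(5) by simp
    also have "\<dots> = 0" using B ann by (simp add: annihilates_iff)
    finally have "T \<noteq> 0 \<Longrightarrow> annihilates T f" using *(4) by (simp add: annihilates_iff)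
    hence "T = 0" using *(6) A1_min[of T] deg by linarith
    hence "dvd_in (polys_over mpolys) A (smult b B)" using * by (auto simp: dvd_in_def)
    thus ?thesis using mpolys.primitive_dvd_cancel[OF *(1,2) A(2,4) B'] by blast
  qed
  show ?thesis
  proof (rule that[OF ann])
    show "Polynomial.degree A \<le> Polynomial.degree B" if "annihilates B f" for B
      using A1_min[OF that] deg by simp
    fix B w m assume B: "annihilates B f" and m: "m \<in> t_exponents A"
    from dvd[OF B] obtain S where "S \<in> polys_over mpolys" "B = A * S" by (auto simp: dvd_in_def)
    thus "\<exists>m'\<in>t_exponents B. weighted_degree w m \<le> weighted_degree w m'"
      using weighted_degree_mult_ge[of A S m w] m B ann by (auto simp: annihilates_iff)
  qed
qed

section \<open>Cartier operators\<close>

lemma mfps_nth_of_nat_mult: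
  fixes g :: "('n::finite, 'a::comm_ring_1) mfps"
  shows "mfps_nth (of_nat k * g) m = of_nat k * mfps_nth g m"
  by (induction k) (simp_all add: mfps_nth_ops distrib_right)

lemma semiring_char_mfps: "CHAR(('n::finite, 'a::comm_ring_1) mfps) = CHAR('a)"
proof (rule CHAR_eqI)
  have nth: "mfps_nth (of_nat k :: ('n, 'a) mfps) m = of_nat k * mfps_nth 1 m" for k m
    using mfps_nth_of_nat_mult[of k 1 m] by (simp only: mult_1_right)
  show "of_nat CHAR('a) = (0 :: ('n, 'a) mfps)"
    by (rule mfps_eqI) (simp only: nth zero_mfps.rep_eq of_nat_CHAR mult_zero_left)
  fix x assume "of_nat x = (0 :: ('n, 'a) mfps)"
  hence "mfps_nth (of_nat x :: ('n, 'a) mfps) 0 = mfps_nth (0 :: ('n, 'a) mfps) 0" by (simp only:)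
  hence "of_nat x = (0 :: 'a)"
    by (simp only: nth one_mfps.rep_eq zero_mfps.rep_eq refl if_True mult_1_right)
  thus "CHAR('a) dvd x" by (simp add: of_nat_eq_0_iff_char_dvd)
qed

text \<open>
  As \<open>n \<mapsto> c\<^sup>p * n\<close> makes a field of characteristic \<open>p\<close> a vector space over itself, it has
  coordinate functions that are \<open>p\<close>-semilinear; no perfectness of the field is needed.
\<close>

locale frobenius_coordinates =
  fixes p :: nat and coord :: "'k::field \<Rightarrow> 'k \<Rightarrow> 'k"
  assumes p_def: "p = CHAR('k)" and p_pos: "p > 0"
    and coord_add: "coord b (x + y) = coord b x + coord b y"
    and coord_power_mult: "coord b (c ^ p * x) = c * coord b x"
    and finite_coord: "finite {b. coord b x \<noteq> 0}"
    and sum_coord: "(\<Sum>b | coord b x \<noteq> 0. coord b x ^ p * b) = x"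

lemma frobenius_coordinates_exist:
  assumes p: "p = CHAR('k::field)" "p > 0"
  shows "\<exists>coord. frobenius_coordinates p (coord :: 'k \<Rightarrow> 'k \<Rightarrow> 'k)"
proof -
  have prime: "prime CHAR('k)" using p prime_CHAR_semidom by blast
  \<comment> \<open>Distributivity over sums of scalars is the additivity of the Frobenius
    map.\<close>
  interpret vector_space "\<lambda>c x. c ^ p * x :: 'k"
    by standard (auto simp: algebra_simps freshmans_dream[OF prime p(1)])
  define B where "B = extend_basis ({} :: 'k set)"
  have B: "\<not> dependent B" "span B = UNIV"
    unfolding B_def using independent_extend_basis[OF independent_empty]
      span_extend_basis[OF independent_empty] by auto
  have mem: "x \<in> span B" for x using B(2) by simp
  have "frobenius_coordinates p (\<lambda>b x. representation B x b)"
  proof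
    show "(\<Sum>b | representation B x b \<noteq> 0. representation B x b ^ p * b) = x" for x
      by (rule sum_nonzero_representation_eq[OF B(1) mem])
    show "representation B (x + y) b = representation B x b + representation B y b" for b x y
      by (simp add: representation_add[OF B(1) mem mem])
    show "representation B (c ^ p * x) b = c * representation B x b" for b c x
      by (simp add: representation_scale[OF B(1) mem])
    show "finite {b. representation B x b \<noteq> 0}" for x
      by (rule finite_representation)
  qed (fact p)+
  thus ?thesis by blast
qed

lemma mult_coeff_vanish:
  fixes g h :: "('n::finite, 'a::comm_ring_1) mfps"
  assumes "\<And>e. e \<le> m \<Longrightarrow> mfps_nth g e = 0"
  shows "mfps_nth (g * h) m = 0"
proof (rule ccontr)
  assume "\<not> ?thesis"
  then obtain u v where "m = u + v" "mfps_nth g u \<noteq> 0" by (rule mfps_mult_nonzeroE)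
  moreover from this have "u \<le> m" by (auto simp: le_fun_def)
  ultimately show False using assms by blast
qed

context frobenius_coordinates
begin

lemma prime_p: "prime p"
  using p_def p_pos prime_CHAR_semidom by blast

lemma p_gt_1: "p > 1"
  using prime_p prime_gt_1_nat by blast

lemma prime_CHAR_mfps: "prime CHAR(('n::finite, 'k) mfps)" "p = CHAR(('n, 'k) mfps)"
  using prime_p p_def semiring_char_mfps by metis+

text \<open>Additivity of the Frobenius map applies to finite sums of monomials, so \<open>g\<close>
  is truncated to the exponents below \<open>m\<close>; the p-th power of the rest does not reach
  \<open>m\<close>.\<close>

lemma mfps_nth_power_p:
  fixes g :: "('n::finite, 'k) mfps"
  shows "mfps_nth (g ^ p) m =
           (if \<forall>i. p dvd m i then mfps_nth g (\<lambda>i. m i div p) ^ p else 0)"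
proof -
  define g1 where "g1 = (\<Sum>e | e \<le> m. mfps_monom (mfps_nth g e) e)"
  have fin: "finite {e. e \<le> m}" by (rule finite_exponents_le)
  have nth_g1: "mfps_nth g1 e = (if e \<le> m then mfps_nth g e else 0)" for e
    using fin by (auto simp: g1_def mfps_nth_sum mfps_monom_def)
  have monom_power: "mfps_monom c e ^ k = mfps_monom (c ^ k) (\<lambda>i. k * e i)"
    for c :: 'k and e :: "'n \<Rightarrow> nat" and k
  proof (induction k)
    case 0
    have "(\<lambda>i. 0 * e i) = 0" by auto
    thus ?case by (simp only: mfps_monom_0 power_0)
  next
    case (Suc k)
    have "e + (\<lambda>i. k * e i) = (\<lambda>i. Suc k * e i)" by auto
    thus ?case using Suc by (simp add: mfps_monom_mult)
  qed
  have "g ^ p = (g1 + (g - g1)) ^ p" by simp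
  also have "\<dots> = g1 ^ p + (g - g1) ^ p"
    by (rule freshmans_dream[OF prime_CHAR_mfps])
  finally have "mfps_nth (g ^ p) m = mfps_nth (g1 ^ p) m + mfps_nth ((g - g1) ^ p) m"
    by (simp add: mfps_nth_ops)
  also have "mfps_nth ((g - g1) ^ p) m = 0"
  proof -
    have "(g - g1) ^ p = (g - g1) * (g - g1) ^ (p - 1)"
      using p_pos by (simp add: power_eq_if)
    thus ?thesis by (simp add: mult_coeff_vanish mfps_nth_ops nth_g1)
  qed
  also have "g1 ^ p = (\<Sum>e | e \<le> m. mfps_monom (mfps_nth g e ^ p) (\<lambda>i. p * e i))"
    unfolding g1_def freshmans_dream_sum[OF prime_CHAR_mfps] monom_power ..
  also have "mfps_nth \<dots> m =
      (\<Sum>e | e \<le> m. if m = (\<lambda>i. p * e i) then mfps_nth g e ^ p else 0)"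
    by (simp add: mfps_nth_sum mfps_monom_def)
  also have "\<dots> = (if \<forall>i. p dvd m i then mfps_nth g (\<lambda>i. m i div p) ^ p else 0)"
  proof (cases "\<forall>i. p dvd m i")
    case True
    have "m = (\<lambda>i. p * e i) \<longleftrightarrow> e = (\<lambda>i. m i div p)" for e
      using True p_pos by (auto simp: fun_eq_iff)
    hence "(\<Sum>e | e \<le> m. if m = (\<lambda>i. p * e i) then mfps_nth g e ^ p else 0) =
        (\<Sum>e | e \<le> m. if e = (\<lambda>i. m i div p) then mfps_nth g (\<lambda>i. m i div p) ^ p else 0)"
      by (intro sum.cong) auto
    also have "\<dots> = mfps_nth g (\<lambda>i. m i div p) ^ p"
      using fin by (subst sum.delta) (auto simp: le_fun_def)
    finally show ?thesis using True by simp
  next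
    case False
    hence "m \<noteq> (\<lambda>i. p * e i)" for e by auto
    thus ?thesis using False by (simp only: if_False sum.neutral_const)
  qed
  finally show ?thesis by simp
qed

lemma coord_0: "coord b 0 = 0"
  using coord_power_mult[of b 0 0] p_pos by simp

lemma coord_nonzeroD: "coord b x \<noteq> 0 \<Longrightarrow> x \<noteq> 0"
  using coord_0 by auto

lemma coord_sum: "coord b (sum g I) = (\<Sum>i\<in>I. coord b (g i))"
  by (induction I rule: infinite_finite_induct) (auto simp: coord_0 coord_add)

lemma ex_coord_nonzero:
  assumes "x \<noteq> 0"
  shows "\<exists>b. coord b x \<noteq> 0"
proof (rule ccontr)
  assume "\<not> ?thesis"
  hence "{b. coord b x \<noteq> 0} = {}" by auto
  thus False using sum_coord[of x] assms by simp
qed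

text \<open>\<open>r\<close> selects the exponents congruent to it modulo \<open>p\<close>, and
  \<open>b\<close> one coordinate of the coefficients. The coordinate stands in for the p-th root
  that is available over a perfect field.\<close>

definition cartier :: "'k \<Rightarrow> ('n \<Rightarrow> nat) \<Rightarrow> ('n, 'k) mfps \<Rightarrow> ('n, 'k) mfps" where
  "cartier b r g = Abs_mfps (\<lambda>m. coord b (mfps_nth g (\<lambda>i. p * m i + r i)))"

lemma nth_cartier: "mfps_nth (cartier b r g) m = coord b (mfps_nth g (\<lambda>i. p * m i + r i))"
  by (simp add: cartier_def)

lemma cartier_0: "cartier b r (0 :: ('n::finite, 'k) mfps) = 0"
  by (rule mfps_eqI) (simp add: nth_cartier mfps_nth_ops coord_0)

lemma cartier_add:
  "cartier b r (g + h :: ('n::finite, 'k) mfps) = cartier b r g + cartier b r h"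
  by (rule mfps_eqI) (simp add: nth_cartier mfps_nth_ops coord_add)

lemma cartier_sum:
  fixes g :: "'i \<Rightarrow> ('n::finite, 'k) mfps"
  shows "cartier b r (sum g I) = (\<Sum>i\<in>I. cartier b r (g i))"
  by (induction I rule: infinite_finite_induct) (auto simp: cartier_0 cartier_add)

text \<open>Projection formula: \<open>h ^ p\<close> lives on exponents divisible by
  \<open>p\<close>, so in a splitting of \<open>p * m + r\<close> the other exponent is again of the
  form \<open>p * v + r\<close>, and semilinearity takes the p-th power off the coefficient of
  \<open>h\<close>.\<close>

lemma cartier_power_mult:
  fixes g h :: "('n::finite, 'k) mfps"
  assumes r: "\<And>i. r i < p"
  shows "cartier b r (h ^ p * g) = h * cartier b r g"
proof (rule mfps_eqI)
  fix m
  let ?m = "\<lambda>i. p * m i + r i"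
  let ?E = "exponent_splits ?m"
  have "mfps_nth (h ^ p * g) ?m =
      (\<Sum>(u, v)\<in>?E. mfps_nth (h ^ p) u * mfps_nth g v)"
    by (simp add: times_mfps.rep_eq)
  also have "\<dots> = (\<Sum>(u, v)\<in>{(u, v)\<in>?E. \<forall>i. p dvd u i}. mfps_nth (h ^ p) u * mfps_nth g v)"
    by (rule sum.mono_neutral_right) (auto simp: mfps_nth_power_p split: if_splits)
  also have "\<dots> = (\<Sum>(u, v)\<in>exponent_splits m. mfps_nth h u ^ p * mfps_nth g (\<lambda>i. p * v i + r i))"
  proof (rule sum.reindex_bij_witness[of _ "\<lambda>(u, v). ((\<lambda>i. p * u i), (\<lambda>i. p * v i + r i))"
              "\<lambda>(u, v). ((\<lambda>i. u i div p), (\<lambda>i. v i div p))"])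
    fix z assume z: "z \<in> exponent_splits m"
    then obtain u v where uv: "z = (u, v)" "\<And>i. m i = u i + v i"
      by (auto simp: exponent_splits_def)
    show "(case case z of (u, v) \<Rightarrow> ((\<lambda>i. p * u i), (\<lambda>i. p * v i + r i)) of
        (u, v) \<Rightarrow> ((\<lambda>i. u i div p), (\<lambda>i. v i div p))) = z"
      using r p_pos uv by auto
    show "(case z of (u, v) \<Rightarrow> ((\<lambda>i. p * u i), (\<lambda>i. p * v i + r i)))
        \<in> {(u, v)\<in>?E. \<forall>i. p dvd u i}"
      using uv by (auto simp: exponent_splits_def algebra_simps)
  next
    fix z assume z: "z \<in> {(u, v)\<in>?E. \<forall>i. p dvd u i}"
    then obtain u v where uv: "z = (u, v)" "\<And>i. p dvd u i" "\<And>i. u i + v i = p * m i + r i"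
      by (auto simp: exponent_splits_def fun_eq_iff)
    have v: "p * (v i div p) + r i = v i" "u i div p + v i div p = m i" for i
    proof -
      obtain k where k: "u i = p * k" using uv(2) by blast
      have "p * k \<le> p * m i + r i" using uv(3)[of i] k by simp
      hence "k \<le> m i" using r[of i]
        by (metis add_less_mono1 add.commute le_less_trans less_Suc_eq_le mult_Suc_right mult_less_cancel1 nat_add_left_cancel_less)
      then obtain l where "m i = k + l" using le_Suc_ex by blast
      hence "v i = p * l + r i" using uv(3)[of i] k by (simp add: algebra_simps)
      thus "p * (v i div p) + r i = v i" "u i div p + v i div p = m i"
        using r[of i] p_pos k \<open>m i = k + l\<close> by simp_all
    qed
    show "(case case z of (u, v) \<Rightarrow> ((\<lambda>i. u i div p), (\<lambda>i. v i div p)) of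
        (u, v) \<Rightarrow> ((\<lambda>i. p * u i), (\<lambda>i. p * v i + r i))) = z"
      using uv v by auto
    show "(case z of (u, v) \<Rightarrow> ((\<lambda>i. u i div p), (\<lambda>i. v i div p))) \<in> exponent_splits m"
      using uv v by (auto simp: exponent_splits_def)
    show "(case case z of (u, v) \<Rightarrow> ((\<lambda>i. u i div p), (\<lambda>i. v i div p)) of
        (u, v) \<Rightarrow> mfps_nth h u ^ p * mfps_nth g (\<lambda>i. p * v i + r i)) =
       (case z of (u, v) \<Rightarrow> mfps_nth (h ^ p) u * mfps_nth g v)"
      using uv v by (auto simp: mfps_nth_power_p)
  qed
  finally show "mfps_nth (cartier b r (h ^ p * g)) m = mfps_nth (h * cartier b r g) m"
    unfolding nth_cartier times_mfps.rep_eq[of h]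
    by (simp add: coord_sum coord_power_mult case_prod_unfold nth_cartier)
qed

lemma cartier_mpolys:
  assumes "g \<in> mpolys"
  shows "cartier b r g \<in> mpolys"
proof -
  have "inj (\<lambda>m i. p * m i + r i)" using p_pos by (auto simp: inj_on_def fun_eq_iff)
  hence "finite ((\<lambda>m i. p * m i + r i) -` {m. mfps_nth g m \<noteq> 0})"
    using assms by (intro finite_vimageI) (auto simp: mpolys_def)
  moreover have "{m. mfps_nth (cartier b r g) m \<noteq> 0} \<subseteq> (\<lambda>m i. p * m i + r i) -` {m. mfps_nth g m \<noteq> 0}"
    by (auto simp: nth_cartier coord_0)
  ultimately show ?thesis unfolding mpolys_def using finite_subset by blast
qed

text \<open>The section operator in the variables \<open>t\<close> and \<open>y\<close> jointly,
  with residue \<open>s\<close> for \<open>y\<close>.\<close>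

definition poly_cartier :: "'k \<Rightarrow> ('n::finite \<Rightarrow> nat) \<Rightarrow> nat \<Rightarrow> ('n, 'k) mfps poly \<Rightarrow> ('n, 'k) mfps poly" where
  "poly_cartier b r s Q =
     (\<Sum>i\<le>Polynomial.degree Q. Polynomial.monom (cartier b r (Polynomial.coeff Q (p * i + s))) i)"

lemma coeff_poly_cartier:
  "Polynomial.coeff (poly_cartier b r s Q) i = cartier b r (Polynomial.coeff Q (p * i + s))"
proof (cases "i \<le> Polynomial.degree Q")
  case True
  thus ?thesis by (simp add: poly_cartier_def coeff_sum)
next
  case False
  hence "Polynomial.degree Q < p * i + s" using p_gt_1
    by (metis less_imp_le_nat linorder_not_le mult_le_mono1 nat_mult_1 order.trans trans_le_add1)
  hence "Polynomial.coeff Q (p * i + s) = 0" by (rule coeff_eq_0)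
  thus ?thesis using False by (auto simp: poly_cartier_def coeff_sum cartier_0)
qed

text \<open>Each \<open>f ^ (p * i)\<close> is a p-th power and leaves the operator as
  \<open>f ^ i\<close>, so relations between the powers \<open>f ^ (p * i)\<close> become relations
  between powers of \<open>f\<close>.\<close>

lemma poly_poly_cartier:
  assumes "\<And>i. r i < p"
  shows "poly (poly_cartier b r s Q) f =
    cartier b r (\<Sum>i\<le>Polynomial.degree Q. Polynomial.coeff Q (p * i + s) * f ^ (p * i))"
proof -
  have "cartier b r (Polynomial.coeff Q (p * i + s) * f ^ (p * i)) =
      cartier b r (Polynomial.coeff Q (p * i + s)) * f ^ i" for i
  proof -
    have "Polynomial.coeff Q (p * i + s) * f ^ (p * i) = (f ^ i) ^ p * Polynomial.coeff Q (p * i + s)"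
      by (simp add: mult.commute flip: power_mult)
    thus ?thesis
      unfolding cartier_power_mult[of r b "f ^ i", OF assms, symmetric]
        mult.commute[of "cartier b r _"] by (rule arg_cong)
  qed
  thus ?thesis
    by (simp add: poly_cartier_def poly_sum poly_monom cartier_sum)
qed

lemma poly_cartier_polys_over:
  assumes "Q \<in> polys_over mpolys"
  shows "poly_cartier b r s Q \<in> polys_over mpolys"
  using assms cartier_mpolys by (auto simp: polys_over_def coeff_poly_cartier)

text \<open>Separability is not automatic, as \<open>k(t)\<close> is imperfect. Were the derivative
  to vanish at \<open>f\<close>, minimality would make it the zero polynomial and \<open>A\<close> a
  polynomial in \<open>y ^ p\<close>; a section operator would then yield a nonzero relation for
  \<open>f\<close> of degree at most \<open>D / p\<close>.\<close>

lemma poly_pderiv_nonzero: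
  fixes f :: "('n::finite, 'k) mfps"
  assumes A: "annihilates A f"
    and A_min: "\<And>B. annihilates B f \<Longrightarrow> Polynomial.degree A \<le> Polynomial.degree B"
  shows "poly (pderiv A) f \<noteq> 0"
proof
  assume root: "poly (pderiv A) f = 0"
  define D where "D = Polynomial.degree A"
  have D: "D > 0"
  proof (rule ccontr)
    assume "\<not> ?thesis"
    then obtain c where "A = [:c:]" unfolding D_def by (metis degree_eq_zeroE not_gr_zero)
    thus False using A by (auto simp: annihilates_iff)
  qed
  have "pderiv A \<in> polys_over mpolys"
    using A by (auto simp: annihilates_iff polys_over_def coeff_pderiv simp del: of_nat_Suc
      intro!: mpolys.mult mpolys.of_nat)
  moreover have "Polynomial.degree (pderiv A) < D"
  proof -
    have "Polynomial.degree (pderiv A) \<le> D - 1"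
      by (rule degree_le) (auto simp: coeff_pderiv coeff_eq_0 D_def)
    thus ?thesis using D by linarith
  qed
  ultimately have "pderiv A = 0"
    using root A_min[of "pderiv A"] unfolding D_def annihilates_iff by fastforce
  have dvd: "p dvd j" if "Polynomial.coeff A j \<noteq> 0" for j
  proof (cases j)
    case (Suc k)
    have "of_nat (Suc k) * Polynomial.coeff A (Suc k) = Polynomial.coeff (pderiv A) k"
      by (simp only: coeff_pderiv)
    hence "of_nat (Suc k) = (0 :: ('n, 'k) mfps)"
      using that Suc \<open>pderiv A = 0\<close> by (simp del: of_nat_Suc)
    thus ?thesis using Suc prime_CHAR_mfps(2) by (metis of_nat_eq_0_iff_char_dvd)
  qed auto
  have lc: "Polynomial.coeff A D \<noteq> 0" using A by (simp add: D_def annihilates_iff)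
  from dvd[OF this] obtain D' where D': "D = p * D'" by blast
  \<comment> \<open>The operator is chosen so that the leading coefficient survives:
    \<open>m\<close> is one of its exponents, \<open>b\<close> a coordinate that is nonzero there,
    and \<open>r\<close> the residue of \<open>m\<close>.\<close>
  obtain m where m: "mfps_nth (Polynomial.coeff A D) m \<noteq> 0"
    using lc mfps_eqI[of "Polynomial.coeff A D" 0] by (auto simp only: zero_mfps.rep_eq)
  obtain b where b: "coord b (mfps_nth (Polynomial.coeff A D) m) \<noteq> 0"
    using ex_coord_nonzero[OF m] by blast
  define r where "r = (\<lambda>i. m i mod p)"
  have r: "r i < p" for i using p_pos by (simp add: r_def)
  let ?C = "poly_cartier b r 0 A"
  \<comment> \<open>Running \<open>i\<close> up to \<open>D\<close> overshoots the degree by zero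
    terms, but matches the range in \<open>poly_poly_cartier\<close>.\<close>
  have "poly A f = (\<Sum>j\<in>(\<lambda>i. p * i) ` {..D}. Polynomial.coeff A j * f ^ j)"
    unfolding poly_altdef
  proof (rule sum.mono_neutral_cong)
    show "Polynomial.coeff A i * f ^ i = 0"
      if "i \<in> {..Polynomial.degree A} - (\<lambda>i. p * i) ` {..D}" for i
    proof -
      have "\<not> p dvd i"
      proof
        assume "p dvd i"
        then obtain k where k: "i = p * k" by (rule dvdE)
        have "1 * k \<le> p * k" using p_pos by (intro mult_le_mono1) simp
        also have "p * k \<le> D" using that k by (simp add: D_def)
        finally have "k \<le> D" by simp
        hence "i \<in> (\<lambda>i. p * i) ` {..D}" unfolding k by (intro imageI) simp
        thus False using that by simp
      qed
      thus ?thesis using dvd by auto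
    qed
  qed (auto simp: D_def coeff_eq_0)
  also have "\<dots> = (\<Sum>i\<le>D. Polynomial.coeff A (p * i + 0) * f ^ (p * i))"
    using p_pos by (subst sum.reindex) (auto simp: inj_on_def)
  finally have "poly ?C f = 0"
    using A by (simp add: poly_poly_cartier[OF r] annihilates_iff cartier_0 flip: D_def)
  moreover have "mfps_nth (Polynomial.coeff ?C D') (\<lambda>i. m i div p) \<noteq> 0"
    using b by (simp add: coeff_poly_cartier nth_cartier r_def D')
  hence "?C \<noteq> 0" by (auto simp: mfps_nth_ops)
  moreover have "?C \<in> polys_over mpolys"
    using A poly_cartier_polys_over by (auto simp: annihilates_iff)
  ultimately have "D \<le> Polynomial.degree ?C"
    using A_min by (auto simp: annihilates_iff D_def)
  moreover have "Polynomial.degree ?C \<le> D'"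
  proof (rule degree_le, intro allI impI)
    fix i assume "D' < i"
    hence "D < p * i" using p_pos D' by simp
    thus "Polynomial.coeff ?C i = 0"
      by (simp add: coeff_poly_cartier coeff_eq_0 D_def cartier_0)
  qed
  ultimately have "p * D' \<le> D'" using D' by linarith
  thus False using D D' p_gt_1 by simp
qed

end

text \<open>Dividing \<open>(y - f) ^ p = y ^ p - f ^ p\<close> by \<open>y - f\<close> leaves a
  geometric sum, so the coefficients are powers of \<open>f\<close> without binomial
  factors.\<close>

lemma linear_power_prime_minus_1:
  fixes f :: "'a::idom"
  assumes "prime CHAR('a)" and "p = CHAR('a)"
  shows "[:- f, 1:] ^ (p - 1) = (\<Sum>l<p. Polynomial.monom (f ^ (p - 1 - l)) l)"
proof -
  have p: "p > 0" using assms by (simp add: prime_gt_0_nat)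
  have prime: "prime CHAR('a poly)" "p = CHAR('a poly)" using assms by simp_all
  let ?X = "[:0, 1:] :: 'a poly" and ?F = "[:f:]"
  have "[:- f, 1:] * [:- f, 1:] ^ (p - 1) = (?X + (- ?F)) ^ p"
    using p by (simp add: power_eq_if del: mult_pCons_left)
  also have "\<dots> = ?X ^ p - ?F ^ p"
    using freshmans_dream[OF prime, of ?X "- ?F"] minus_power_prime_CHAR[OF prime(2), of ?F] assms(1)
    by (simp only: assms(2) diff_conv_add_uminus)
  also have "\<dots> = (?X - ?F) * (\<Sum>l<p. ?F ^ (p - Suc l) * ?X ^ l)"
    by (rule power_diff_sumr2)
  also have "?X - ?F = [:- f, 1:]" by simp
  also have "(\<Sum>l<p. ?F ^ (p - Suc l) * ?X ^ l) = (\<Sum>l<p. Polynomial.monom (f ^ (p - 1 - l)) l)"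
    by (intro sum.cong) (simp_all add: monom_altdef poly_const_pow)
  finally show ?thesis by (simp del: mult_pCons_left)
qed

text \<open>
  This is the residue formula for \<open>P / A\<close> at \<open>y = f\<close>, seen through the Cartier operator in \<open>y\<close>:
  only the exponents congruent to \<open>-1\<close> modulo \<open>p\<close> of \<open>P * A ^ (p - 1)\<close> matter.
\<close>

lemma root_extraction:
  fixes f :: "'a::idom" and P A :: "'a poly"
  assumes prime: "prime CHAR('a)" "p = CHAR('a)" and A: "poly A f = 0"
  defines "Q \<equiv> P * A ^ (p - 1)"
  shows "(\<Sum>i\<le>Polynomial.degree Q. Polynomial.coeff Q (p * i + (p - 1)) * f ^ (p * i)) =
           poly P f * poly (pderiv A) f ^ (p - 1)"
proof -
  have p: "p > 0" using prime by (simp add: prime_gt_0_nat)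
  obtain B where B: "A = [:- f, 1:] * B" using A by (metis poly_eq_0_iff_dvd dvdE)
  have deriv: "poly (pderiv A) f = poly B f" unfolding B pderiv_mult by (simp add: pderiv_pCons)
  define R where "R = P * B ^ (p - 1)"
  have Q: "Q = (\<Sum>l<p. Polynomial.monom (f ^ (p - 1 - l)) l) * R"
    unfolding Q_def R_def B power_mult_distrib linear_power_prime_minus_1[OF prime] by simp
  \<comment> \<open>Every \<open>l < p\<close> contributes to the exponent
    \<open>p * i + (p - 1)\<close>, so a whole block of \<open>p\<close> consecutive coefficients of
    \<open>R\<close> is collected, weighted by the matching powers of \<open>f\<close>.\<close>
  have coeff_Q: "Polynomial.coeff Q (p * i + (p - 1)) =
      (\<Sum>l<p. f ^ l * Polynomial.coeff R (p * i + l))" for i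
  proof -
    have "Polynomial.coeff Q (p * i + (p - 1)) =
      (\<Sum>l<p. f ^ (p - 1 - l) * Polynomial.coeff R (p * i + (p - 1) - l))"
      unfolding Q sum_distrib_right coeff_sum
      by (intro sum.cong) (auto simp: coeff_monom_mult)
    also have "\<dots> = (\<Sum>l<p. f ^ l * Polynomial.coeff R (p * i + l))"
      by (rule sum.reindex_bij_witness[of _ "\<lambda>l. p - 1 - l" "\<lambda>l. p - 1 - l"]) auto
    finally show ?thesis .
  qed
  \<comment> \<open>Beyond the last block \<open>R\<close> has no coefficients, so the blocks add up
    to \<open>poly R f\<close>.\<close>
  have R_high: "Polynomial.coeff R k = 0" if "k \<ge> (Polynomial.degree Q + 1) * p" for k
  proof (cases "R = 0")
    case False
    have "Polynomial.degree Q = Polynomial.degree ([:- f, 1:] ^ (p - 1)) + Polynomial.degree R"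
      unfolding Q linear_power_prime_minus_1[OF prime, symmetric]
      using False by (subst degree_mult_eq) auto
    hence "Polynomial.degree R < (Polynomial.degree Q + 1) * 1" by simp
    also have "\<dots> \<le> (Polynomial.degree Q + 1) * p"
      by (rule mult_le_mono2) (use p in simp)
    also have "\<dots> \<le> k" by (rule that)
    finally show ?thesis by (rule coeff_eq_0)
  qed auto
  have "(\<Sum>i\<le>Polynomial.degree Q. Polynomial.coeff Q (p * i + (p - 1)) * f ^ (p * i)) =
      (\<Sum>i<Polynomial.degree Q + 1. \<Sum>l<p. Polynomial.coeff R (p * i + l) * f ^ (p * i + l))"
    unfolding coeff_Q sum_distrib_right Suc_eq_plus1[symmetric] lessThan_Suc_atMost
    by (intro sum.cong refl) (simp add: power_add mult_ac)
  also have "\<dots> = (\<Sum>i<Polynomial.degree Q + 1. \<Sum>k\<in>{i*p..<i*p+p}. Polynomial.coeff R k * f ^ k)"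
  proof (rule sum.cong[OF refl])
    fix i
    show "(\<Sum>l<p. Polynomial.coeff R (p * i + l) * f ^ (p * i + l)) =
        (\<Sum>k\<in>{i*p..<i*p+p}. Polynomial.coeff R k * f ^ k)"
      by (rule sum.reindex_bij_witness[of _ "\<lambda>k. k - i * p" "\<lambda>l. p * i + l"]) (auto simp: mult.commute)
  qed
  also have "\<dots> = (\<Sum>k<(Polynomial.degree Q + 1) * p. Polynomial.coeff R k * f ^ k)"
    by (rule sum.nat_group)
  also have "\<dots> = (\<Sum>k\<le>Polynomial.degree R. Polynomial.coeff R k * f ^ k)"
    using R_high by (intro sum.mono_neutral_cong) (auto simp: coeff_eq_0 not_less)
  also have "\<dots> = poly R f" by (simp add: poly_altdef)
  finally show ?thesis by (simp add: R_def deriv)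
qed

section \<open>Fractions over the derivative with bounded numerators\<close>

lemma t_exponents_multE:
  assumes "m \<in> t_exponents (A * B)"
  obtains u v where "m = u + v" "u \<in> t_exponents A" "v \<in> t_exponents B"
proof -
  from assms obtain j where "mfps_nth (Polynomial.coeff (A * B) j) m \<noteq> 0"
    by (auto simp: t_exponents_def)
  then obtain i where "mfps_nth (Polynomial.coeff A i * Polynomial.coeff B (j - i)) m \<noteq> 0"
    unfolding coeff_mult mfps_nth_sum by (meson sum.not_neutral_contains_not_neutral)
  then obtain u v where "m = u + v" "mfps_nth (Polynomial.coeff A i) u \<noteq> 0"
      "mfps_nth (Polynomial.coeff B (j - i)) v \<noteq> 0" by (rule mfps_mult_nonzeroE)
  thus ?thesis using that by (auto simp: t_exponents_def)
qed

lemma weighted_degree_power: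
  fixes A :: "('n::finite, 'k::field) mfps poly"
  assumes "\<And>m. m \<in> t_exponents A \<Longrightarrow> weighted_degree w m \<le> H" and "m \<in> t_exponents (A ^ k)"
  shows "weighted_degree w m \<le> k * H"
  using assms(2)
proof (induction k arbitrary: m)
  case 0
  then obtain j :: nat where j: "mfps_nth (if j = 0 then 1 else 0 :: ('n, 'k) mfps) m \<noteq> 0"
    by (auto simp: t_exponents_def coeff_1 of_bool_def)
  have "m = 0"
  proof (rule ccontr)
    assume "m \<noteq> 0"
    hence "mfps_nth (if j = 0 then 1 else 0 :: ('n, 'k) mfps) m = 0"
      by (cases "j = 0") (simp_all only: if_True if_False one_mfps.rep_eq zero_mfps.rep_eq refl)
    thus False using j by contradiction
  qed
  thus ?case by (simp add: weighted_degree_def)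
next
  case (Suc k)
  from Suc.prems obtain u v where "m = u + v" "u \<in> t_exponents A" "v \<in> t_exponents (A ^ k)"
    by (auto elim: t_exponents_multE)
  thus ?case using assms(1)[of u] Suc.IH[of v] by (simp only: weighted_degree_add mult_Suc add_mono)
qed

text \<open>Weights let both bounds of the theorem share one argument: the weights that are 1 on a
  single variable and 0 elsewhere describe a box of exponents, the constant weight 1 describes a
  simplex.\<close>

locale annihilated_series = frobenius_coordinates p coord
  for p :: nat and coord :: "'k::field \<Rightarrow> 'k \<Rightarrow> 'k" +
  fixes f :: "('n::finite, 'k) mfps" and A :: "('n, 'k) mfps poly"
    and weights :: "('n \<Rightarrow> nat) set" and H :: "('n \<Rightarrow> nat) \<Rightarrow> nat"
  assumes A: "annihilates A f"
    and pderiv_nonzero: "poly (pderiv A) f \<noteq> 0"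
    and A_weights: "w \<in> weights \<Longrightarrow> m \<in> t_exponents A \<Longrightarrow> weighted_degree w m \<le> H w"
begin

definition exponents :: "('n \<Rightarrow> nat) set" where
  "exponents = {m. \<forall>w\<in>weights. weighted_degree w m \<le> H w}"

definition numerators :: "('n, 'k) mfps poly set" where
  "numerators = {P \<in> polys_over mpolys.
     Polynomial.degree P \<le> Polynomial.degree A \<and> t_exponents P \<subseteq> exponents}"

text \<open>
  The power series among the elements \<open>P(t, f) / A\<^sub>y(t, f)\<close> of the fraction field.
\<close>

definition quotient_series :: "('n, 'k) mfps set" where
  "quotient_series = {g. \<exists>P\<in>numerators. poly (pderiv A) f * g = poly P f}"

lemma f_quotient_series: "f \<in> quotient_series"
proof -
  have "t_exponents A \<subseteq> exponents" using A_weights by (auto simp: exponents_def)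
  moreover have "t_exponents (pCons 0 (pderiv A)) \<subseteq> t_exponents A"
  proof
    fix m assume "m \<in> t_exponents (pCons 0 (pderiv A))"
    then obtain j where "mfps_nth (Polynomial.coeff (pCons 0 (pderiv A)) j) m \<noteq> 0"
      by (auto simp: t_exponents_def)
    hence "mfps_nth (Polynomial.coeff A j) m \<noteq> 0"
      by (cases j) (auto simp: coeff_pCons coeff_pderiv mfps_nth_ops mfps_nth_of_nat_mult
          simp del: of_nat_Suc)
    thus "m \<in> t_exponents A" by (auto simp: t_exponents_def)
  qed
  moreover have "pCons 0 (pderiv A) \<in> polys_over mpolys"
    unfolding mpolys.pCons_polys_over
    using A by (auto simp: annihilates_iff mpolys.zero polys_over_def
      coeff_pderiv simp del: of_nat_Suc intro!: mpolys.mult mpolys.of_nat)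
  moreover have "Polynomial.degree (pCons 0 (pderiv A)) \<le> Polynomial.degree A"
    by (rule degree_le) (auto simp: coeff_pCons coeff_pderiv coeff_eq_0 split: nat.splits)
  ultimately have "pCons 0 (pderiv A) \<in> numerators" by (auto simp: numerators_def)
  thus ?thesis unfolding quotient_series_def
    by (auto intro!: bexI[of _ "pCons 0 (pderiv A)"])
qed

text \<open>With \<open>u = A\<^sub>y(t, f)\<close> the projection formula gives
  \<open>u * cartier b r g = cartier b r (u ^ p * g)\<close>, and
  \<open>u ^ p * g = P(t, f) * u ^ (p - 1)\<close> is what \<open>root_extraction\<close> reads off
  \<open>P * A ^ (p - 1)\<close>. This product satisfies the bounds multiplied by \<open>p\<close>,
  and the section operator divides them by \<open>p\<close> again.\<close>

lemma cartier_numerator: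
  assumes g: "poly (pderiv A) f * g = poly P f" and P: "P \<in> numerators" and r: "\<And>i. r i < p"
  shows "poly (pderiv A) f * cartier b r g = poly (poly_cartier b r (p - 1) (P * A ^ (p - 1))) f"
    and "poly_cartier b r (p - 1) (P * A ^ (p - 1)) \<in> numerators"
proof -
  interpret S: sub_idom "polys_over mpolys :: ('n, 'k) mfps poly set" by (rule mpolys.polys_over)
  define u where "u = poly (pderiv A) f"
  define Q where "Q = P * A ^ (p - 1)"
  have A': "A \<in> polys_over mpolys" "A \<noteq> 0" "poly A f = 0" using A by (auto simp: annihilates_iff)
  have "u * cartier b r g = cartier b r (u ^ p * g)" by (rule cartier_power_mult[OF r, symmetric])
  also have "u ^ p * g = poly P f * u ^ (p - 1)"
    using p_pos g by (simp add: power_eq_if mult_ac u_def)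
  also have "\<dots> = (\<Sum>i\<le>Polynomial.degree Q. Polynomial.coeff Q (p * i + (p - 1)) * f ^ (p * i))"
    unfolding Q_def u_def by (rule root_extraction[OF prime_CHAR_mfps A'(3), symmetric])
  also have "cartier b r \<dots> = poly (poly_cartier b r (p - 1) Q) f"
    by (rule poly_poly_cartier[OF r, symmetric])
  finally show "poly (pderiv A) f * cartier b r g = poly (poly_cartier b r (p - 1) (P * A ^ (p - 1))) f"
    by (simp add: u_def Q_def)
  have Q: "Q \<in> polys_over mpolys"
    unfolding Q_def using P A' by (auto simp: numerators_def intro: S.mult S.power)
  have degQ: "Polynomial.degree Q \<le> p * Polynomial.degree A"
  proof -
    have "Polynomial.degree Q \<le> Polynomial.degree P + Polynomial.degree (A ^ (p - 1))"
      unfolding Q_def by (rule degree_mult_le)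
    also have "\<dots> \<le> Polynomial.degree A + (p - 1) * Polynomial.degree A"
      using P by (intro add_mono) (auto simp: numerators_def degree_power_eq A'(2))
    also have "\<dots> = p * Polynomial.degree A" using p_pos by (simp add: mult_eq_if)
    finally show ?thesis .
  qed
  have "poly_cartier b r (p - 1) Q \<in> polys_over mpolys" by (rule poly_cartier_polys_over[OF Q])
  moreover have "Polynomial.degree (poly_cartier b r (p - 1) Q) \<le> Polynomial.degree A"
  proof (rule degree_le, intro allI impI)
    fix i assume "Polynomial.degree A < i"
    hence "Polynomial.degree Q < p * i" using degQ p_pos by (meson le_less_trans mult_less_mono2)
    thus "Polynomial.coeff (poly_cartier b r (p - 1) Q) i = 0"
      by (simp add: coeff_poly_cartier coeff_eq_0 cartier_0)
  qed
  moreover have "t_exponents (poly_cartier b r (p - 1) Q) \<subseteq> exponents"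
  proof
    fix m assume "m \<in> t_exponents (poly_cartier b r (p - 1) Q)"
    then obtain j where "coord b (mfps_nth (Polynomial.coeff Q j) (\<lambda>i. p * m i + r i)) \<noteq> 0"
      by (auto simp: t_exponents_def coeff_poly_cartier nth_cartier)
    hence "(\<lambda>i. p * m i + r i) \<in> t_exponents Q"
      using coord_nonzeroD unfolding t_exponents_def by blast
    then obtain x y where xy: "(\<lambda>i. p * m i + r i) = x + y" "x \<in> t_exponents P"
        "y \<in> t_exponents (A ^ (p - 1))"
      unfolding Q_def by (rule t_exponents_multE)
    have "weighted_degree w m \<le> H w" if w: "w \<in> weights" for w
    proof -
      have "p * weighted_degree w m \<le> weighted_degree w (\<lambda>i. p * m i + r i)"
        unfolding weighted_degree_def sum_distrib_left by (intro sum_mono) (simp add: algebra_simps)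
      also have "\<dots> = weighted_degree w x + weighted_degree w y"
        unfolding xy(1) weighted_degree_add ..
      also have "\<dots> \<le> H w + (p - 1) * H w"
        using xy(2,3) P w A_weights weighted_degree_power[of A w "H w"]
        by (intro add_mono) (auto simp: numerators_def exponents_def)
      also have "\<dots> = p * H w" using p_pos by (simp add: mult_eq_if)
      finally show ?thesis using p_pos by simp
    qed
    thus "m \<in> exponents" by (simp add: exponents_def)
  qed
  ultimately show "poly_cartier b r (p - 1) (P * A ^ (p - 1)) \<in> numerators"
    by (simp add: numerators_def Q_def)
qed

lemma cartier_quotient_series:
  assumes "g \<in> quotient_series" "\<And>i. r i < p"
  shows "cartier b r g \<in> quotient_series"
  using assms cartier_numerator unfolding quotient_series_def by blast

text \<open>\<open>k\<close> may be infinite-dimensional over its p-th powers, and \<open>g\<close>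
  has infinitely many coefficients. But a nonzero section of \<open>g\<close> requires a nonzero
  section of the polynomial \<open>Q\<close>, which has only finitely many coefficients. This keeps
  the sum in \<open>diagonal_expand\<close> finite.\<close>

lemma finite_cartier_nonzero:
  assumes g: "g \<in> quotient_series"
  shows "finite {b. \<exists>r. (\<forall>i. r i < p) \<and> cartier b r g \<noteq> 0}"
proof -
  from g obtain P where P: "P \<in> numerators" "poly (pderiv A) f * g = poly P f"
    by (auto simp: quotient_series_def)
  interpret S: sub_idom "polys_over mpolys :: ('n, 'k) mfps poly set" by (rule mpolys.polys_over)
  define Q where "Q = P * A ^ (p - 1)"
  have Q: "Q \<in> polys_over mpolys"
    unfolding Q_def using P A by (auto simp: numerators_def annihilates_iff intro: S.mult S.power)
  let ?B = "\<Union>m\<in>t_exponents Q. \<Union>j\<le>Polynomial.degree Q. {b. coord b (mfps_nth (Polynomial.coeff Q j) m) \<noteq> 0}"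
  have "{b. \<exists>r. (\<forall>i. r i < p) \<and> cartier b r g \<noteq> 0} \<subseteq> ?B"
  proof
    fix b assume "b \<in> {b. \<exists>r. (\<forall>i. r i < p) \<and> cartier b r g \<noteq> 0}"
    then obtain r where r: "\<And>i. r i < p" and nz: "cartier b r g \<noteq> 0" by blast
    have "poly (pderiv A) f * cartier b r g \<noteq> 0" using nz pderiv_nonzero by simp
    hence "poly (poly_cartier b r (p - 1) Q) f \<noteq> 0"
      unfolding cartier_numerator(1)[OF P(2,1) r] Q_def .
    hence "poly_cartier b r (p - 1) Q \<noteq> 0" by auto
    then obtain m where "m \<in> t_exponents (poly_cartier b r (p - 1) Q)"
      using t_exponents_nonempty by blast
    then obtain j where j: "coord b (mfps_nth (Polynomial.coeff Q j) (\<lambda>i. p * m i + r i)) \<noteq> 0"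
      by (auto simp: t_exponents_def coeff_poly_cartier nth_cartier)
    hence nz: "mfps_nth (Polynomial.coeff Q j) (\<lambda>i. p * m i + r i) \<noteq> 0" by (rule coord_nonzeroD)
    hence "(\<lambda>i. p * m i + r i) \<in> t_exponents Q" unfolding t_exponents_def by blast
    moreover have "j \<in> {..Polynomial.degree Q}"
      by (rule ccontr) (use nz in \<open>simp add: coeff_eq_0 mfps_nth_ops\<close>)
    ultimately show "b \<in> ?B" using j by (intro UN_I CollectI)
  qed
  moreover have "finite ?B"
    using finite_t_exponents[OF Q] finite_coord by auto
  ultimately show ?thesis by (rule finite_subset)
qed

end

section \<open>Diagonals\<close>

text \<open>Gaussian elimination over a domain: one equation and one unknown are removed with the
  pivot \<open>a k j\<close>, cross-multiplying instead of dividing.\<close>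

lemma underdetermined_system:
  fixes a :: "'i \<Rightarrow> 'j \<Rightarrow> 'r::idom"
  assumes "finite J" "finite I" "card J < card I"
  shows "\<exists>\<alpha>. (\<exists>i\<in>I. \<alpha> i \<noteq> 0) \<and> (\<forall>j\<in>J. (\<Sum>i\<in>I. \<alpha> i * a i j) = 0)"
  using assms
proof (induction J arbitrary: I a rule: finite_induct)
  case empty
  hence "I \<noteq> {}" by auto
  thus ?case by (intro exI[of _ "\<lambda>_. 1"]) auto
next
  case (insert j J)
  show ?case
  proof (cases "\<forall>i\<in>I. a i j = 0")
    case True
    have "card J < card I" using insert by simp
    from insert.IH[OF insert.prems(1) this] obtain \<alpha> where
      "\<exists>i\<in>I. \<alpha> i \<noteq> 0" "\<forall>j\<in>J. (\<Sum>i\<in>I. \<alpha> i * a i j) = 0" by blast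
    thus ?thesis using True by (intro exI[of _ \<alpha>]) simp
  next
    case False
    then obtain k where k: "k \<in> I" "a k j \<noteq> 0" by blast
    have "card J < card (I - {k})" using insert k by simp
    from insert.IH[OF _ this, of "\<lambda>i l. a k j * a i l - a i j * a k l"] insert.prems(1)
    obtain \<alpha> where \<alpha>: "\<exists>i\<in>I - {k}. \<alpha> i \<noteq> 0"
      "\<And>l. l \<in> J \<Longrightarrow> (\<Sum>i\<in>I - {k}. \<alpha> i * (a k j * a i l - a i j * a k l)) = 0" by auto
    \<comment> \<open>The value at \<open>k\<close> solves equation \<open>j\<close>; scaling all
      other unknowns by the pivot avoids a division.\<close>
    define \<beta> where "\<beta> = (\<lambda>i. if i = k then - (\<Sum>i\<in>I - {k}. \<alpha> i * a i j) else a k j * \<alpha> i)"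
    have "(\<Sum>i\<in>I. \<beta> i * a i l) = (\<Sum>i\<in>I - {k}. \<alpha> i * (a k j * a i l - a i j * a k l))" for l
    proof -
      have "(\<Sum>i\<in>I. \<beta> i * a i l) = \<beta> k * a k l + (\<Sum>i\<in>I - {k}. \<beta> i * a i l)"
        using k insert.prems(1) by (simp add: sum.remove)
      also have "(\<Sum>i\<in>I - {k}. \<beta> i * a i l) = (\<Sum>i\<in>I - {k}. a k j * \<alpha> i * a i l)"
        by (intro sum.cong) (auto simp: \<beta>_def)
      finally show ?thesis
        by (simp add: \<beta>_def sum_distrib_right sum_distrib_left sum_subtractf algebra_simps)
    qed
    moreover have "\<exists>i\<in>I. \<beta> i \<noteq> 0" using \<alpha>(1) k by (auto simp: \<beta>_def)
    ultimately show ?thesis using \<alpha>(2) by (intro exI[of _ \<beta>]) (auto simp: mult.commute)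
  qed
qed

text \<open>The coefficients along the line from \<open>e\<close> in direction
  \<open>(1, ..., 1)\<close>. The lines from exponents with a vanishing entry partition all
  exponents.\<close>

definition diagonal_at :: "('n \<Rightarrow> nat) \<Rightarrow> ('n, 'a) mfps \<Rightarrow> 'a fps" where
  "diagonal_at e g = Abs_fps (\<lambda>M. mfps_nth g (\<lambda>i. e i + M))"

text \<open>The polynomial \<open>\<alpha>(t\<^sub>1 \<dots> t\<^sub>n)\<close>; \<open>m\<close> is constant iff it equals its minimum everywhere.\<close>

definition diagonal_poly :: "'a::zero poly \<Rightarrow> ('n::finite, 'a) mfps" where
  "diagonal_poly \<alpha> = Abs_mfps (\<lambda>m. if m = (\<lambda>_. Min (range m)) then Polynomial.coeff \<alpha> (Min (range m)) else 0)"

lemma diagonal_conv_diagonal_at: "diagonal g = diagonal_at (\<lambda>_. 0) g"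
  by (simp add: diagonal_def diagonal_at_def)

lemma diagonal_at_sum:
  fixes g :: "'i \<Rightarrow> ('n::finite, 'a::comm_ring_1) mfps"
  shows "diagonal_at e (sum g I) = (\<Sum>i\<in>I. diagonal_at e (g i))"
  by (rule fps_ext) (simp add: diagonal_at_def mfps_nth_sum fps_sum_nth)

lemma diagonal_at_0: "diagonal_at e (0 :: ('n::finite, 'a::comm_ring_1) mfps) = 0"
  by (rule fps_ext) (simp add: diagonal_at_def mfps_nth_ops)

text \<open>Multiplication by a polynomial in the product of all variables only shifts along the
  direction \<open>(1, ..., 1)\<close>, so it acts on each line separately. The vanishing entry
  makes \<open>e\<close> the first exponent of its line.\<close>

lemma diagonal_at_diagonal_poly_mult:
  fixes g :: "('n::finite, 'a::comm_ring_1) mfps"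
  assumes e: "e i0 = 0"
  shows "diagonal_at e (diagonal_poly \<alpha> * g) = fps_of_poly \<alpha> * diagonal_at e g"
proof (rule fps_ext)
  fix M
  let ?T = "diagonal_poly \<alpha> :: ('n, 'a) mfps"
  let ?E = "exponent_splits (\<lambda>i. e i + M)"
  let ?h = "\<lambda>s. ((\<lambda>_. s), (\<lambda>i. e i + (M - s))) :: ('n \<Rightarrow> nat) \<times> ('n \<Rightarrow> nat)"
  have T_const: "mfps_nth ?T (\<lambda>_. s) = Polynomial.coeff \<alpha> s" for s
    by (simp add: diagonal_poly_def)
  have "diagonal_at e (?T * g) $ M = (\<Sum>(u, v)\<in>?E. mfps_nth ?T u * mfps_nth g v)"
    by (simp add: diagonal_at_def times_mfps.rep_eq)
  also have "\<dots> = (\<Sum>(u, v)\<in>?h ` {..M}. mfps_nth ?T u * mfps_nth g v)"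
  proof (rule sum.mono_neutral_right)
    show "?h ` {..M} \<subseteq> ?E" by (auto simp: exponent_splits_def fun_eq_iff)
    show "\<forall>z\<in>?E - ?h ` {..M}. (case z of (u, v) \<Rightarrow> mfps_nth ?T u * mfps_nth g v) = 0"
    proof
      fix z assume z: "z \<in> ?E - ?h ` {..M}"
      then obtain u v where uv: "z = (u, v)" "\<And>i. u i + v i = e i + M"
        by (auto simp: exponent_splits_def fun_eq_iff)
      have "mfps_nth ?T u = 0"
      proof (rule ccontr)
        assume "mfps_nth ?T u \<noteq> 0"
        then obtain s where s: "u = (\<lambda>_. s)" by (auto simp: diagonal_poly_def split: if_splits)
        have "s \<le> M" using uv(2)[of i0] e s by simp
        moreover have "v = (\<lambda>i. e i + (M - s))"
        proof
          fix i show "v i = e i + (M - s)" using uv(2)[of i] s \<open>s \<le> M\<close> by simp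
        qed
        ultimately show False using z uv(1) s by blast
      qed
      thus "(case z of (u, v) \<Rightarrow> mfps_nth ?T u * mfps_nth g v) = 0" using uv(1) by simp
    qed
  qed auto
  also have "\<dots> = (\<Sum>s\<le>M. Polynomial.coeff \<alpha> s * mfps_nth g (\<lambda>i. e i + (M - s)))"
    by (subst sum.reindex) (auto simp: inj_on_def T_const fun_eq_iff)
  also have "\<dots> = (fps_of_poly \<alpha> * diagonal_at e g) $ M"
    by (simp add: fps_mult_nth diagonal_at_def atLeast0AtMost)
  finally show "diagonal_at e (?T * g) $ M = (fps_of_poly \<alpha> * diagonal_at e g) $ M" .
qed

text \<open>Subtracting its minimum from every entry moves an exponent back to the start of its
  line, so these lines cover everything.\<close>

lemma mfps_eq_0_if_diagonals:
  fixes g :: "('n::finite, 'a::comm_ring_1) mfps"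
  assumes "\<And>e i. e i = 0 \<Longrightarrow> diagonal_at e g = 0"
  shows "g = 0"
proof (rule mfps_eqI)
  fix m :: "'n \<Rightarrow> nat"
  define M where "M = Min (range m)"
  have "M \<in> range m" unfolding M_def by (rule Min_in) auto
  then obtain i where "m i = M" by auto
  hence "diagonal_at (\<lambda>i. m i - M) g $ M = 0" by (subst assms[of _ i]) auto
  moreover have "(\<lambda>i. m i - M + M) = m"
    by (rule ext) (simp add: M_def)
  ultimately show "mfps_nth g m = mfps_nth 0 m" by (simp add: diagonal_at_def mfps_nth_ops)
qed

lemma diagonal_at_mpolys:
  assumes "g \<in> mpolys"
  shows "\<exists>\<alpha>. diagonal_at e g = fps_of_poly \<alpha>"
proof -
  have "inj (\<lambda>M i. e i + M)" by (auto simp: inj_on_def fun_eq_iff)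
  hence "finite ((\<lambda>M i. e i + M) -` {m. mfps_nth g m \<noteq> 0})"
    using assms by (intro finite_vimageI) (auto simp: mpolys_def)
  moreover have "{M. diagonal_at e g $ M \<noteq> 0} = (\<lambda>M i. e i + M) -` {m. mfps_nth g m \<noteq> 0}"
    by (auto simp: diagonal_at_def)
  ultimately have "Polynomial.coeff (Abs_poly (fps_nth (diagonal_at e g))) = fps_nth (diagonal_at e g)"
    by (intro Abs_poly_inverse) (simp add: MOST_iff_cofinite)
  thus ?thesis by (intro exI[of _ "Abs_poly (fps_nth (diagonal_at e g))"] fps_ext) simp
qed

text \<open>Additivity of the Frobenius map separates the constant term from \<open>t\<close> times
  the shifted series, and the p-th power of \<open>t\<close> lets the induction descend from
  \<open>M\<close> to \<open>M - p\<close>.\<close>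

lemma fps_nth_power_prime:
  fixes g :: "'a::comm_ring_1 fps"
  assumes "prime CHAR('a)" "p = CHAR('a)"
  shows "g ^ p $ M = (if p dvd M then (g $ (M div p)) ^ p else 0)"
proof (induction M arbitrary: g rule: less_induct)
  case (less M)
  have p: "p > 0" using assms by (simp add: prime_gt_0_nat)
  have "g = fps_const (g $ 0) + fps_X * fps_shift 1 g"
    by (rule fps_ext) auto
  hence "g ^ p = (fps_const (g $ 0) + fps_X * fps_shift 1 g) ^ p" by simp
  also have "\<dots> = fps_const ((g $ 0) ^ p) + fps_X ^ p * fps_shift 1 g ^ p"
    using freshmans_dream[of p "fps_const (g $ 0)" "fps_X * fps_shift 1 g"] assms
    by (simp add: power_mult_distrib fps_const_power)
  finally have eq: "g ^ p $ M = (if M = 0 then (g $ 0) ^ p else 0) +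
      (if M < p then 0 else fps_shift 1 g ^ p $ (M - p))"
    by (simp add: fps_X_power_mult_nth)
  show ?case
  proof (cases "M < p")
    case True
    thus ?thesis using eq by (auto dest: dvd_imp_le)
  next
    case False
    have "fps_shift 1 g ^ p $ (M - p) = (if p dvd M - p then (fps_shift 1 g $ ((M - p) div p)) ^ p else 0)"
      using False p by (intro less.IH) simp
    moreover have "M div p = (M - p) div p + 1" "p dvd M - p \<longleftrightarrow> p dvd M"
      using False p by (simp_all add: le_div_geq dvd_minus_self)
    ultimately show ?thesis using False p eq by simp
  qed
qed

text \<open>
  For a maximal \<open>k[t]\<close>-independent family \<open>x\<close> in \<open>V\<close> and every \<open>e\<close>, each element of \<open>V\<close> has a
  nonzero multiple in the span of the \<open>p\<^sup>e\<close>-th powers of the \<open>x\<^sub>i\<close>; now compare all \<open>g ^ p\<^sup>j\<close>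
  in the span of the \<open>p\<^sup>N\<close>-th powers.
\<close>

lemma frobenius_dependence:
  fixes V :: "'k::field fps set"
  assumes prime: "prime CHAR('k)" "p = CHAR('k)"
    and rank: "\<And>x :: nat \<Rightarrow> 'k fps. (\<And>i. i \<le> N \<Longrightarrow> x i \<in> V) \<Longrightarrow>
      \<exists>\<alpha>. (\<exists>i\<le>N. \<alpha> i \<noteq> 0) \<and> (\<Sum>i\<le>N. fps_of_poly (\<alpha> i) * x i) = 0"
    and expand: "\<And>g. g \<in> V \<Longrightarrow> \<exists>(I :: 'i set) c y. finite I \<and> (\<forall>i\<in>I. y i \<in> V) \<and>
      g = (\<Sum>i\<in>I. fps_of_poly (c i) * y i ^ p)"
    and g: "g \<in> V"
  shows "\<exists>c. (\<exists>j\<le>N. c j \<noteq> 0) \<and> (\<Sum>j\<le>N. fps_of_poly (c j) * g ^ (p ^ j)) = 0"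
proof -
  have char_fps: "prime CHAR('k fps)" "p = CHAR('k fps)" using prime by simp_all
  define indep where "indep = (\<lambda>s (x :: nat \<Rightarrow> 'k fps). (\<forall>i<s. x i \<in> V) \<and>
    (\<forall>\<alpha>. (\<Sum>i<s. fps_of_poly (\<alpha> i) * x i) = 0 \<longrightarrow> (\<forall>i<s. \<alpha> i = 0)))"
  have indep_le: "s \<le> N" if "\<exists>x. indep s x" for s
  proof (rule ccontr)
    assume "\<not> s \<le> N"
    hence s: "{..N} \<subseteq> {..<s}" by auto
    from that obtain x where "indep s x" by blast
    hence xV: "\<forall>i<s. x i \<in> V"
      and x: "\<And>\<alpha>. (\<Sum>i<s. fps_of_poly (\<alpha> i) * x i) = 0 \<Longrightarrow> \<forall>i<s. \<alpha> i = 0"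
      unfolding indep_def by simp_all
    have "x i \<in> V" if "i \<le> N" for i
      using xV s that by (simp add: subset_eq)
    from rank[of x, OF this] obtain \<alpha> i where \<alpha>: "i \<le> N" "\<alpha> i \<noteq> 0"
      "(\<Sum>i\<le>N. fps_of_poly (\<alpha> i) * x i) = 0" by auto
    have "(\<Sum>i<s. fps_of_poly (if i \<le> N then \<alpha> i else 0) * x i) = (\<Sum>i\<le>N. fps_of_poly (\<alpha> i) * x i)"
      using s by (intro sum.mono_neutral_cong_right) auto
    hence "\<forall>i<s. (if i \<le> N then \<alpha> i else 0) = 0"
      unfolding \<alpha>(3) by (rule x)
    moreover have "i < s" using s \<alpha>(1) by auto
    ultimately show False using \<alpha>(1,2) by auto
  qed
  \<comment> \<open>\<open>s\<close> is the rank of \<open>V\<close> over \<open>k[t]\<close>; the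
    bound \<open>N\<close> makes a maximal independent family exist.\<close>
  define s where "s = (GREATEST s. \<exists>x. indep s x)"
  have "\<exists>x. indep 0 x" by (simp add: indep_def)
  hence "\<exists>x. indep s x" unfolding s_def by (rule GreatestI_nat) (rule indep_le)
  then obtain x where x: "indep s x" by blast
  have s_le: "s \<le> N" using x indep_le by blast
  have span0: "\<exists>c \<beta>. c \<noteq> 0 \<and> fps_of_poly c * g = (\<Sum>i<s. fps_of_poly (\<beta> i) * x i)" if g: "g \<in> V" for g
  proof -
    have "\<not> indep (Suc s) (x(s := g))"
    proof
      assume "indep (Suc s) (x(s := g))"
      hence "Suc s \<le> s" unfolding s_def by (intro Greatest_le_nat[OF _ indep_le]) blast+
      thus False by simp
    qed
    moreover have "\<forall>i<Suc s. (x(s := g)) i \<in> V" using x g by (auto simp: indep_def)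
    ultimately obtain \<alpha> j where \<alpha>: "(\<Sum>i<Suc s. fps_of_poly (\<alpha> i) * (x(s := g)) i) = 0"
        "j < Suc s" "\<alpha> j \<noteq> 0"
      unfolding indep_def by blast
    have "(\<Sum>i<s. fps_of_poly (\<alpha> i) * (x(s := g)) i) = (\<Sum>i<s. fps_of_poly (\<alpha> i) * x i)"
      by (intro sum.cong) auto
    with \<alpha>(1) have eq: "(\<Sum>i<s. fps_of_poly (\<alpha> i) * x i) + fps_of_poly (\<alpha> s) * g = 0" by simp
    have "\<alpha> s \<noteq> 0"
    proof
      assume "\<alpha> s = 0"
      hence "(\<Sum>i<s. fps_of_poly (\<alpha> i) * x i) = 0" using eq by simp
      moreover have "(\<Sum>i<s. fps_of_poly (\<alpha> i) * x i) = 0 \<longrightarrow> (\<forall>i<s. \<alpha> i = 0)"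
        using x by (simp add: indep_def)
      ultimately have "\<forall>i<s. \<alpha> i = 0" by simp
      thus False using \<alpha>(2,3) \<open>\<alpha> s = 0\<close> by (auto simp: less_Suc_eq)
    qed
    moreover have "fps_of_poly (\<alpha> s) * g = (\<Sum>i<s. fps_of_poly (- \<alpha> i) * x i)"
      using eq unfolding add_eq_0_iff by (simp add: fps_of_poly_uminus sum_negf)
    ultimately show ?thesis by (intro exI[of _ "\<alpha> s"] exI[of _ "\<lambda>i. - \<alpha> i"] conjI)
  qed
  \<comment> \<open>Induction on \<open>e\<close>: expand \<open>g\<close> in p-th powers of
    elements of \<open>V\<close>, and insert the Frobenius images of the relations known for these
    elements.\<close>
  have span: "\<exists>c \<beta>. c \<noteq> 0 \<and> fps_of_poly c * g = (\<Sum>i<s. fps_of_poly (\<beta> i) * x i ^ (p ^ e))"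
    if g: "g \<in> V" for g e
    using g
  proof (induction e arbitrary: g)
    case 0
    thus ?case using span0 by simp
  next
    case (Suc e)
    from expand[OF Suc.prems] obtain I :: "'i set" and c y where
      I: "finite I" "\<forall>i\<in>I. y i \<in> V" "g = (\<Sum>i\<in>I. fps_of_poly (c i) * y i ^ p)" by blast
    from Suc.IH I(2) have "\<forall>l\<in>I. \<exists>d \<beta>. d \<noteq> 0 \<and>
      fps_of_poly d * y l = (\<Sum>i<s. fps_of_poly (\<beta> i) * x i ^ (p ^ e))" by blast
    then obtain d \<beta> where d: "\<And>l. l \<in> I \<Longrightarrow> d l \<noteq> 0"
      "\<And>l. l \<in> I \<Longrightarrow> fps_of_poly (d l) * y l = (\<Sum>i<s. fps_of_poly (\<beta> l i) * x i ^ (p ^ e))"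
      by metis
    have pow: "fps_of_poly (d l ^ p) * y l ^ p = (\<Sum>i<s. fps_of_poly (\<beta> l i ^ p) * x i ^ (p ^ Suc e))"
      if "l \<in> I" for l
    proof -
      have "fps_of_poly (d l ^ p) * y l ^ p = (fps_of_poly (d l) * y l) ^ p"
        by (simp add: fps_of_poly_power power_mult_distrib)
      also have "\<dots> = (\<Sum>i<s. (fps_of_poly (\<beta> l i) * x i ^ (p ^ e)) ^ p)"
        unfolding d(2)[OF that] by (rule freshmans_dream_sum[OF char_fps])
      finally show ?thesis
        by (simp add: fps_of_poly_power power_mult_distrib mult.commute flip: power_mult)
    qed
    \<comment> \<open>The factors \<open>d l ^ p\<close> differ from term to term;
      \<open>C l\<close> supplies what is missing to their product.\<close>
    define C where "C = (\<lambda>l. c l * (\<Prod>m\<in>I - {l}. d m ^ p))"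
    have "fps_of_poly (\<Prod>l\<in>I. d l ^ p) * g =
        (\<Sum>l\<in>I. fps_of_poly (C l) * (fps_of_poly (d l ^ p) * y l ^ p))"
      unfolding I(3) sum_distrib_left
    proof (intro sum.cong refl)
      fix l assume "l \<in> I"
      hence "(\<Prod>l\<in>I. d l ^ p) = d l ^ p * (\<Prod>m\<in>I - {l}. d m ^ p)"
        using I(1) by (simp add: prod.remove)
      thus "fps_of_poly (\<Prod>l\<in>I. d l ^ p) * (fps_of_poly (c l) * y l ^ p) =
          fps_of_poly (C l) * (fps_of_poly (d l ^ p) * y l ^ p)"
        by (simp add: C_def fps_of_poly_mult mult_ac)
    qed
    also have "\<dots> = (\<Sum>l\<in>I. \<Sum>i<s. fps_of_poly (C l * \<beta> l i ^ p) * x i ^ (p ^ Suc e))"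
      by (intro sum.cong refl)
         (simp only: pow sum_distrib_left fps_of_poly_mult mult.assoc)
    also have "\<dots> = (\<Sum>i<s. fps_of_poly (\<Sum>l\<in>I. C l * \<beta> l i ^ p) * x i ^ (p ^ Suc e))"
      by (subst sum.swap) (simp only: fps_of_poly_sum sum_distrib_right)
    finally show ?case
      using d(1) I(1) by (intro exI[of _ "\<Prod>l\<in>I. d l ^ p"] exI conjI) auto
  qed
  \<comment> \<open>The exponent \<open>p ^ (N - j)\<close> is chosen so that raising to the power
    \<open>p ^ j\<close> leads to the same family \<open>x i ^ (p ^ N)\<close> for every
    \<open>j\<close>.\<close>
  have "\<forall>j. \<exists>c \<beta>. c \<noteq> 0 \<and> fps_of_poly c * g = (\<Sum>i<s. fps_of_poly (\<beta> i) * x i ^ (p ^ (N - j)))"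
    using span[OF g] by blast
  then obtain c \<beta> where c: "\<And>j. c j \<noteq> 0"
    "\<And>j. fps_of_poly (c j) * g = (\<Sum>i<s. fps_of_poly (\<beta> j i) * x i ^ (p ^ (N - j)))" by metis
  have pow: "fps_of_poly (c j ^ (p ^ j)) * g ^ (p ^ j) =
      (\<Sum>i<s. fps_of_poly (\<beta> j i ^ (p ^ j)) * x i ^ (p ^ N))" if "j \<le> N" for j
  proof -
    have "fps_of_poly (c j ^ (p ^ j)) * g ^ (p ^ j) = (fps_of_poly (c j) * g) ^ (p ^ j)"
      by (simp add: fps_of_poly_power power_mult_distrib)
    also have "\<dots> = (\<Sum>i<s. (fps_of_poly (\<beta> j i) * x i ^ (p ^ (N - j))) ^ (p ^ j))"
      unfolding c(2) by (rule freshmans_dream_sum'[OF char_fps(1)]) (use char_fps(2) in simp)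
    finally show ?thesis
      using that by (simp add: fps_of_poly_power power_mult_distrib flip: power_mult power_add)
  qed
  \<comment> \<open>There are \<open>N + 1\<close> unknowns, one for each \<open>j\<close>, against
    \<open>s \<le> N\<close> equations.\<close>
  have "card {..<s} < card {..N}" using s_le by simp
  from underdetermined_system[OF _ _ this, of "\<lambda>j i. \<beta> j i ^ (p ^ j)"] obtain \<gamma> where
    \<gamma>: "\<exists>j\<in>{..N}. \<gamma> j \<noteq> 0" "\<forall>i\<in>{..<s}. (\<Sum>j\<le>N. \<gamma> j * \<beta> j i ^ (p ^ j)) = 0" by auto
  have "(\<Sum>j\<le>N. fps_of_poly (\<gamma> j * c j ^ (p ^ j)) * g ^ (p ^ j)) =
      (\<Sum>j\<le>N. \<Sum>i<s. fps_of_poly (\<gamma> j * \<beta> j i ^ (p ^ j)) * x i ^ (p ^ N))"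
  proof (intro sum.cong refl)
    fix j assume j: "j \<in> {..N}"
    have "fps_of_poly (\<gamma> j * c j ^ (p ^ j)) * g ^ (p ^ j) =
        fps_of_poly (\<gamma> j) * (fps_of_poly (c j ^ (p ^ j)) * g ^ (p ^ j))"
      by (simp only: fps_of_poly_mult mult.assoc)
    thus "fps_of_poly (\<gamma> j * c j ^ (p ^ j)) * g ^ (p ^ j) =
        (\<Sum>i<s. fps_of_poly (\<gamma> j * \<beta> j i ^ (p ^ j)) * x i ^ (p ^ N))"
      using j by (simp only: pow atMost_iff sum_distrib_left fps_of_poly_mult mult.assoc)
  qed
  also have "\<dots> = (\<Sum>i<s. fps_of_poly (\<Sum>j\<le>N. \<gamma> j * \<beta> j i ^ (p ^ j)) * x i ^ (p ^ N))"
    by (subst sum.swap) (simp only: fps_of_poly_sum sum_distrib_right)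
  also have "\<dots> = 0" using \<gamma>(2) by simp
  finally show ?thesis
    using \<gamma>(1) c(1) by (intro exI[of _ "\<lambda>j. \<gamma> j * c j ^ (p ^ j)"]) auto
qed

section \<open>Rank and Frobenius expansion of the diagonals\<close>

context annihilated_series
begin

definition boundary_exponents :: "('n \<Rightarrow> nat) set" where
  "boundary_exponents = {e \<in> exponents. \<exists>i. e i = 0}"

text \<open>The relation is found before taking diagonals: its coefficients are polynomials in the
  product of all variables that annihilate the family of numerators. Cut into lines in direction
  \<open>(1, ..., 1)\<close>, this is one equation over \<open>k[t]\<close> for each power of
  \<open>y\<close> and each boundary exponent.\<close>

lemma diagonal_rank:
  assumes fin: "finite exponents" "finite I"
    and card: "(Polynomial.degree A + 1) * card boundary_exponents < card I"
    and x: "\<And>i. i \<in> I \<Longrightarrow> x i \<in> quotient_series"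
  shows "\<exists>\<alpha>. (\<exists>i\<in>I. \<alpha> i \<noteq> 0) \<and> (\<Sum>i\<in>I. fps_of_poly (\<alpha> i) * diagonal (x i)) = 0"
proof -
  let ?D = "Polynomial.degree A"
  have "\<forall>i\<in>I. \<exists>P. P \<in> numerators \<and> poly (pderiv A) f * x i = poly P f"
    using x by (auto simp: quotient_series_def)
  then obtain P where P: "\<And>i. i \<in> I \<Longrightarrow> P i \<in> numerators"
    "\<And>i. i \<in> I \<Longrightarrow> poly (pderiv A) f * x i = poly (P i) f" by metis
  have P': "Polynomial.coeff (P i) j \<in> mpolys" if "i \<in> I" for i j
    using P(1)[OF that] by (auto simp: numerators_def polys_over_def)
  have "\<forall>i j e. \<exists>\<alpha>. i \<in> I \<longrightarrow> diagonal_at e (Polynomial.coeff (P i) j) = fps_of_poly \<alpha>"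
    using diagonal_at_mpolys[OF P'] by blast
  then obtain a where a: "\<And>i j e. i \<in> I \<Longrightarrow>
      diagonal_at e (Polynomial.coeff (P i) j) = fps_of_poly (a i j e)" by metis
  have "card ({..?D} \<times> boundary_exponents) < card I"
    using card by (simp add: card_cartesian_product)
  moreover have "finite ({..?D} \<times> boundary_exponents)"
    using fin by (simp add: boundary_exponents_def)
  ultimately obtain \<alpha> where \<alpha>: "\<exists>i\<in>I. \<alpha> i \<noteq> 0"
    "\<forall>z\<in>{..?D} \<times> boundary_exponents. (\<Sum>i\<in>I. \<alpha> i * a i (fst z) (snd z)) = 0"
    using underdetermined_system[OF _ fin(2), of "{..?D} \<times> boundary_exponents"
      "\<lambda>i z. a i (fst z) (snd z)"] by blast
  have coeff_zero: "(\<Sum>i\<in>I. diagonal_poly (\<alpha> i) * Polynomial.coeff (P i) j) = 0" if j: "j \<le> ?D" for j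
  proof (rule mfps_eq_0_if_diagonals)
    fix e :: "'n \<Rightarrow> nat" and i0 assume e: "e i0 = 0"
    have "diagonal_at e (\<Sum>i\<in>I. diagonal_poly (\<alpha> i) * Polynomial.coeff (P i) j) =
        (\<Sum>i\<in>I. fps_of_poly (\<alpha> i) * diagonal_at e (Polynomial.coeff (P i) j))"
      by (simp add: diagonal_at_sum diagonal_at_diagonal_poly_mult[of e i0, OF e])
    also have "\<dots> = 0"
    proof (cases "e \<in> exponents")
      case True
      hence "(j, e) \<in> {..?D} \<times> boundary_exponents" using e j by (auto simp: boundary_exponents_def)
      hence "(\<Sum>i\<in>I. \<alpha> i * a i j e) = 0" using \<alpha>(2) by force
      moreover have "(\<Sum>i\<in>I. fps_of_poly (\<alpha> i) * diagonal_at e (Polynomial.coeff (P i) j)) =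
          fps_of_poly (\<Sum>i\<in>I. \<alpha> i * a i j e)"
        unfolding fps_of_poly_sum by (intro sum.cong) (auto simp: a fps_of_poly_mult)
      ultimately show ?thesis by simp
    next
      case False
      \<comment> \<open>Weighted degrees do not decrease along a line, so a line that starts outside
        \<open>exponents\<close> never enters it.\<close>
      have "diagonal_at e (Polynomial.coeff (P i) j) = 0" if i: "i \<in> I" for i
      proof (rule fps_ext, rule ccontr)
        fix M assume "diagonal_at e (Polynomial.coeff (P i) j) $ M \<noteq> 0 $ M"
        hence "(\<lambda>i. e i + M) \<in> t_exponents (P i)" by (auto simp: diagonal_at_def t_exponents_def)
        hence *: "(\<lambda>i. e i + M) \<in> exponents" using P(1)[OF i] by (auto simp: numerators_def)
        have "weighted_degree w e \<le> H w" if "w \<in> weights" for w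
        proof -
          have "weighted_degree w e \<le> weighted_degree w (\<lambda>i. e i + M)"
            unfolding weighted_degree_def by (intro sum_mono mult_le_mono2) simp
          also have "\<dots> \<le> H w" using * that by (simp add: exponents_def)
          finally show ?thesis .
        qed
        thus False using False by (simp add: exponents_def)
      qed
      thus ?thesis by simp
    qed
    finally show "diagonal_at e (\<Sum>i\<in>I. diagonal_poly (\<alpha> i) * Polynomial.coeff (P i) j) = 0" .
  qed
  have poly_P: "poly (P i) f = (\<Sum>j\<le>?D. Polynomial.coeff (P i) j * f ^ j)" if "i \<in> I" for i
  proof -
    have "Polynomial.degree (P i) \<le> ?D" using P(1)[OF that] by (simp add: numerators_def)
    thus ?thesis unfolding poly_altdef by (intro sum.mono_neutral_left) (auto simp: coeff_eq_0)
  qed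
  \<comment> \<open>The common denominator carries the relation from the numerators over to the
    series \<open>x i\<close>.\<close>
  have "poly (pderiv A) f * (\<Sum>i\<in>I. diagonal_poly (\<alpha> i) * x i) =
      (\<Sum>i\<in>I. diagonal_poly (\<alpha> i) * (poly (pderiv A) f * x i))"
    by (simp add: sum_distrib_left mult_ac)
  also have "\<dots> = (\<Sum>i\<in>I. \<Sum>j\<le>?D. diagonal_poly (\<alpha> i) * Polynomial.coeff (P i) j * f ^ j)"
    by (intro sum.cong refl) (simp only: P(2) poly_P sum_distrib_left mult.assoc)
  also have "\<dots> = (\<Sum>j\<le>?D. (\<Sum>i\<in>I. diagonal_poly (\<alpha> i) * Polynomial.coeff (P i) j) * f ^ j)"
    by (subst sum.swap) (simp only: sum_distrib_right)
  also have "\<dots> = 0" using coeff_zero by simp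
  finally have "(\<Sum>i\<in>I. diagonal_poly (\<alpha> i) * x i) = 0" using pderiv_nonzero by simp
  hence "diagonal_at (\<lambda>_. 0) (\<Sum>i\<in>I. diagonal_poly (\<alpha> i) * x i) = 0"
    by (simp only: diagonal_at_0)
  hence "(\<Sum>i\<in>I. fps_of_poly (\<alpha> i) * diagonal (x i)) = 0"
    by (simp add: diagonal_at_sum diagonal_at_diagonal_poly_mult diagonal_conv_diagonal_at)
  thus ?thesis using \<alpha>(1) by blast
qed

text \<open>All entries of a diagonal exponent have the same residue modulo \<open>p\<close>, so the
  constant residue vectors suffice; \<open>sum_coord\<close> rebuilds each coefficient from its
  coordinates.\<close>

lemma diagonal_expand:
  assumes g: "g \<in> quotient_series"
  shows "\<exists>F. finite F \<and> diagonal g = (\<Sum>(\<rho>, b)\<in>{..<p} \<times> F.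
           fps_of_poly (Polynomial.monom b \<rho>) * diagonal (cartier b (\<lambda>_. \<rho>) g) ^ p)"
proof -
  define F where "F = {b. \<exists>r. (\<forall>i. r i < p) \<and> cartier b r g \<noteq> 0}"
  have F: "finite F" unfolding F_def by (rule finite_cartier_nonzero[OF g])
  have char: "prime CHAR('k)" using prime_p p_def by simp
  have "diagonal g = (\<Sum>(\<rho>, b)\<in>{..<p} \<times> F.
           fps_of_poly (Polynomial.monom b \<rho>) * diagonal (cartier b (\<lambda>_. \<rho>) g) ^ p)"
  proof (rule fps_ext)
    fix M
    let ?c = "\<lambda>b. coord b (mfps_nth g (\<lambda>_. M))"
    have nth_term: "(fps_of_poly (Polynomial.monom b \<rho>) * diagonal (cartier b (\<lambda>_. \<rho>) g) ^ p) $ M =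
        (if \<rho> = M mod p then ?c b ^ p * b else 0)" if \<rho>: "\<rho> < p" for \<rho> b
    proof -
      have dvd: "p dvd M - \<rho> \<longleftrightarrow> \<rho> = M mod p" if "\<rho> \<le> M"
        using that \<rho> by (metis mod_eq_dvd_iff_nat mod_less)
      have div: "p * ((M - \<rho>) div p) + \<rho> = M" if "\<rho> = M mod p"
        using that by (simp add: minus_mod_eq_mult_div)
      have "\<rho> \<noteq> M mod p" if "\<not> \<rho> \<le> M"
        using that mod_less_eq_dividend[of M p] by metis
      thus ?thesis
        using dvd div
        by (cases "\<rho> \<le> M") (auto simp: fps_of_poly_monom fps_mult_left_const_nth fps_X_power_mult_nth mult.assoc
          fps_nth_power_prime[OF char p_def] diagonal_def nth_cartier mult.commute)
    qed
    have "(\<Sum>(\<rho>, b)\<in>{..<p} \<times> F.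
           fps_of_poly (Polynomial.monom b \<rho>) * diagonal (cartier b (\<lambda>_. \<rho>) g) ^ p) $ M =
        (\<Sum>\<rho><p. \<Sum>b\<in>F. if \<rho> = M mod p then ?c b ^ p * b else 0)"
      unfolding fps_sum_nth sum.cartesian_product by (intro sum.cong refl) (auto simp: nth_term)
    also have "\<dots> = (\<Sum>\<rho><p. if \<rho> = M mod p then (\<Sum>b\<in>F. ?c b ^ p * b) else 0)"
      by (intro sum.cong) auto
    also have "\<dots> = (\<Sum>b\<in>F. ?c b ^ p * b)" using p_pos by simp
    also have "\<dots> = (\<Sum>b | ?c b \<noteq> 0. ?c b ^ p * b)"
    proof (rule sum.mono_neutral_right[OF F])
      show "{b. ?c b \<noteq> 0} \<subseteq> F"
      proof
        fix b assume b: "b \<in> {b. ?c b \<noteq> 0}"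
        have "(\<lambda>i. p * (M div p) + M mod p) = (\<lambda>i :: 'n. M)" by simp
        hence "mfps_nth (cartier b (\<lambda>_. M mod p) g) (\<lambda>_. M div p) \<noteq> 0"
          using b by (simp add: nth_cartier)
        hence "cartier b (\<lambda>_. M mod p) g \<noteq> 0" by (auto simp: mfps_nth_ops)
        moreover have "\<forall>i :: 'n. M mod p < p" using p_pos by simp
        ultimately show "b \<in> F" unfolding F_def by (intro CollectI exI[of _ "\<lambda>_. M mod p"] conjI)
      qed
    qed (use p_pos in auto)
    also have "\<dots> = diagonal g $ M" by (simp add: sum_coord diagonal_def)
    finally show "diagonal g $ M = (\<Sum>(\<rho>, b)\<in>{..<p} \<times> F.
           fps_of_poly (Polynomial.monom b \<rho>) * diagonal (cartier b (\<lambda>_. \<rho>) g) ^ p) $ M" by simp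
  qed
  thus ?thesis using F by blast
qed

lemma diagonal_dependence:
  assumes fin: "finite exponents"
    and N: "N = (Polynomial.degree A + 1) * card boundary_exponents"
  shows "\<exists>c. (\<exists>j\<le>N. c j \<noteq> 0) \<and> (\<Sum>j\<le>N. fps_of_poly (c j) * diagonal f ^ (p ^ j)) = 0"
proof (rule frobenius_dependence[where V = "diagonal ` quotient_series" and 'i = "nat \<times> 'k"])
  show "prime CHAR('k)" "p = CHAR('k)" using prime_p p_def by simp_all
  show "diagonal f \<in> diagonal ` quotient_series" using f_quotient_series by blast
next
  fix x :: "nat \<Rightarrow> 'k fps" assume "\<And>i. i \<le> N \<Longrightarrow> x i \<in> diagonal ` quotient_series"
  hence "\<forall>i. \<exists>y. i \<le> N \<longrightarrow> y \<in> quotient_series \<and> x i = diagonal y" by auto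
  then obtain y where y: "\<And>i. i \<le> N \<Longrightarrow> y i \<in> quotient_series" "\<And>i. i \<le> N \<Longrightarrow> x i = diagonal (y i)"
    by metis
  have "\<exists>\<alpha>. (\<exists>i\<in>{..N}. \<alpha> i \<noteq> 0) \<and> (\<Sum>i\<le>N. fps_of_poly (\<alpha> i) * diagonal (y i)) = 0"
    by (rule diagonal_rank[OF fin]) (use N y in auto)
  thus "\<exists>\<alpha>. (\<exists>i\<le>N. \<alpha> i \<noteq> 0) \<and> (\<Sum>i\<le>N. fps_of_poly (\<alpha> i) * x i) = 0"
    using y(2) by (auto simp: Bex_def)
next
  fix h assume "h \<in> diagonal ` quotient_series"
  then obtain g where g: "g \<in> quotient_series" "h = diagonal g" by auto
  from diagonal_expand[OF g(1)] obtain F where F: "finite F"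
    "h = (\<Sum>(\<rho>, b)\<in>{..<p} \<times> F.
           fps_of_poly (Polynomial.monom b \<rho>) * diagonal (cartier b (\<lambda>_. \<rho>) g) ^ p)"
    unfolding g(2) by blast
  show "\<exists>(I :: (nat \<times> 'k) set) c y. finite I \<and> (\<forall>i\<in>I. y i \<in> diagonal ` quotient_series) \<and>
      h = (\<Sum>i\<in>I. fps_of_poly (c i) * y i ^ p)"
    by (rule exI[of _ "{..<p} \<times> F"], rule exI[of _ "\<lambda>(\<rho>, b). Polynomial.monom b \<rho>"],
        rule exI[of _ "\<lambda>(\<rho>, b). diagonal (cartier b (\<lambda>_. \<rho>) g)"])
       (use F cartier_quotient_series[OF g(1)] in \<open>auto simp: case_prod_unfold\<close>)
qed

end

section \<open>Degrees and heights\<close>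

text \<open>The argument of \<open>eval\<close> lists the leading coefficient first, whereas
  \<open>Poly\<close> starts with the constant term; hence the reversal.\<close>

lemma eval_type_algebra:
  "ring.eval (ring_of_type_algebra :: 'a::field ring) q x = poly (Poly (rev q)) x"
proof -
  interpret ring "ring_of_type_algebra :: 'a ring" by (rule ring_from_type_algebra)
  have zero: "\<zero>\<^bsub>ring_of_type_algebra\<^esub> = (0 :: 'a)"
    and ops: "a \<otimes>\<^bsub>ring_of_type_algebra\<^esub> b = a * b" "a \<oplus>\<^bsub>ring_of_type_algebra\<^esub> b = a + b"
    for a b :: 'a
    by (simp_all add: ring_of_type_algebra_def)
  have pow: "x [^]\<^bsub>ring_of_type_algebra\<^esub> n = x ^ n" for n :: nat
    by (induction n) (simp_all add: nat_pow_def ring_of_type_algebra_def mult.commute)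
  show ?thesis
  proof (induction q)
    case Nil
    show ?case by (simp add: zero)
  next
    case (Cons a q)
    have "eval (a # q) x = a * x ^ length q + eval q x"
      by (simp add: pow ops)
    thus ?case using Cons by (simp add: Poly_snoc poly_monom)
  qed
qed

context sub_idom
begin

lemma Fract_in_quotients: "a \<in> R \<Longrightarrow> b \<in> R \<Longrightarrow> b \<noteq> 0 \<Longrightarrow> Fract a b \<in> quotients R"
  by (auto simp: quotients_def)

lemma subfield_quotients: "subfield (quotients R) ring_of_type_algebra"
proof -
  interpret F: field "ring_of_type_algebra :: 'a fract ring" by (rule field_from_type_algebra)
  have one_F: "\<one>\<^bsub>ring_of_type_algebra\<^esub> = (1 :: 'a fract)"
    and zero_F: "\<zero>\<^bsub>ring_of_type_algebra\<^esub> = (0 :: 'a fract)"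
    and add_F: "x \<oplus>\<^bsub>ring_of_type_algebra\<^esub> y = x + y"
    and mult_F: "x \<otimes>\<^bsub>ring_of_type_algebra\<^esub> y = x * y"
    and carrier_F: "carrier ring_of_type_algebra = (UNIV :: 'a fract set)" for x y :: "'a fract"
    by (simp_all add: ring_of_type_algebra_def)
  have inv_F: "inv\<^bsub>ring_of_type_algebra\<^esub> x = inverse x" if "x \<noteq> 0" for x :: "'a fract"
    using that by (intro F.comm_inv_char) (simp_all add: one_F mult_F carrier_F)
  have minus_F: "\<ominus>\<^bsub>ring_of_type_algebra\<^esub> x = - x" for x :: "'a fract"
    by (rule F.minus_equality) (simp_all add: carrier_F add_F zero_F)
  show ?thesis
  proof (intro F.subfieldI' F.subringI)
    show "\<one>\<^bsub>ring_of_type_algebra\<^esub> \<in> quotients R"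
      unfolding one_F One_fract_def by (rule Fract_in_quotients[OF one one]) simp
    fix x y :: "'a fract" assume "x \<in> quotients R" "y \<in> quotients R"
    then obtain a b c d where *: "x = Fract a b" "y = Fract c d" "b \<noteq> 0" "d \<noteq> 0"
        "a \<in> R" "b \<in> R" "c \<in> R" "d \<in> R"
      by (auto simp: quotients_def)
    have "x * y = Fract (a * c) (b * d)" "x + y = Fract (a * d + c * b) (b * d)"
      using * by simp_all
    moreover have "a * c \<in> R" "b * d \<in> R" "a * d + c * b \<in> R" "b * d \<noteq> 0"
      using * by (auto intro: mult add)
    ultimately show "x \<otimes>\<^bsub>ring_of_type_algebra\<^esub> y \<in> quotients R"
        "x \<oplus>\<^bsub>ring_of_type_algebra\<^esub> y \<in> quotients R"
      unfolding quotients_def mult_F add_F by blast+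
  next
    fix x :: "'a fract" assume "x \<in> quotients R"
    then obtain a b where *: "x = Fract a b" "b \<noteq> 0" "a \<in> R" "b \<in> R"
      by (auto simp: quotients_def)
    have "- x = Fract (- a) b" using * by simp
    thus "\<ominus>\<^bsub>ring_of_type_algebra\<^esub> x \<in> quotients R"
      unfolding quotients_def minus_F using * uminus by blast
  next
    fix x :: "'a fract" assume x: "x \<in> quotients R - {\<zero>\<^bsub>ring_of_type_algebra\<^esub>}"
    then obtain a b where *: "x = Fract a b" "b \<noteq> 0" "a \<in> R" "b \<in> R"
      by (auto simp: quotients_def)
    have "x \<noteq> 0" using x zero_F by auto
    hence "a \<noteq> 0" using * by (auto simp: Zero_fract_def eq_fract)
    moreover have "inverse x = Fract b a" using * by simp
    ultimately show "inv\<^bsub>ring_of_type_algebra\<^esub> x \<in> quotients R"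
      unfolding quotients_def inv_F[OF \<open>x \<noteq> 0\<close>] using * by blast
  qed (simp add: carrier_F)
qed

lemma to_fract_in_quotients: "a \<in> R \<Longrightarrow> to_fract a \<in> quotients R"
  unfolding to_fract_def by (rule Fract_in_quotients[OF _ one]) simp_all

text \<open>For algebraic \<open>x\<close> the generated field is the simple extension, whose
  dimension is the degree of \<open>Irr\<close>; the length of this coefficient list exceeds the
  degree by one.\<close>

lemma extension_degree_eq:
  assumes "algebraic_over (quotients R) x"
  shows "extension_degree (quotients R) x =
           length (ring.Irr ring_of_type_algebra (quotients R) x) - 1"
proof -
  interpret F: field "ring_of_type_algebra :: 'a fract ring" by (rule field_from_type_algebra)
  have carrier: "carrier ring_of_type_algebra = (UNIV :: 'a fract set)"
    by (simp add: ring_of_type_algebra_def)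
  let ?K = "quotients R"
  note K = subfield_quotients
  have alg: "(F.algebraic over ?K) x" using assms by (simp add: algebraic_over_def)
  have sub: "subfield (F.simple_extension ?K x) ring_of_type_algebra"
    using F.simple_extension_is_subfield[OF K, of x] alg carrier by simp
  have "F.simple_extension ?K x = generate_field ring_of_type_algebra (insert x ?K)"
  proof (rule F.generate_fieldI[OF _ sub])
    show "insert x ?K \<subseteq> F.simple_extension ?K x"
      using F.simple_extension_mem[OF subfieldE(1)[OF K], of x] F.simple_extension_incl[of ?K x] carrier
      by auto
    show "F.simple_extension ?K x \<subseteq> L"
      if "subfield L ring_of_type_algebra" "insert x ?K \<subseteq> L" for L
      by (rule F.simple_extension_subring_incl[OF subfieldE(1)[OF that(1)]]) (use that in auto)
  qed (simp add: carrier)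
  thus ?thesis
    unfolding extension_degree_def using F.simple_extension_dim[OF K _ alg] carrier by simp
qed

lemma poly_map_to_fract:
  fixes Q :: "'a poly"
  shows "poly (map_poly to_fract Q) (to_fract g) = to_fract (poly Q g)"
  by (induction Q) (simp_all add: map_poly_pCons)

text \<open>The minimal polynomial \<open>Irr\<close> divides the image of \<open>Q\<close> over the
  field of quotients, which bounds its degree.\<close>

lemma algebraic_overI:
  assumes Q: "Q \<in> polys_over R" "Q \<noteq> 0" "poly Q g = 0"
  shows "algebraic_over (quotients R) (to_fract g)"
    and "extension_degree (quotients R) (to_fract g) \<le> Polynomial.degree Q"
proof -
  interpret F: field "ring_of_type_algebra :: 'a fract ring" by (rule field_from_type_algebra)
  have carrier: "to_fract g \<in> carrier ring_of_type_algebra"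
    by (simp add: ring_of_type_algebra_def)
  let ?K = "quotients R"
  note K = subfield_quotients
  define q where "q = rev (Polynomial.coeffs (map_poly to_fract Q))"
  have nz: "map_poly to_fract Q \<noteq> 0" using Q(2) by (simp add: map_poly_eq_0_iff)
  have "set q \<subseteq> ?K"
  proof
    fix a assume "a \<in> set q"
    then obtain i where "a = Polynomial.coeff (map_poly to_fract Q) i"
      unfolding q_def by (auto simp: coeffs_def split: if_splits)
    thus "a \<in> ?K" using Q(1) by (simp add: coeff_map_poly polys_over_def to_fract_in_quotients)
  qed
  moreover have "hd q \<noteq> 0"
    using nz by (simp add: q_def hd_rev last_coeffs_eq_coeff_degree)
  ultimately have carrier_q: "q \<in> carrier (univ_poly ring_of_type_algebra ?K)"
    by (simp add: univ_poly_def polynomial_def ring_of_type_algebra_def)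
  have q_ne: "q \<noteq> []" using nz by (simp add: q_def)
  have eval: "F.eval q (to_fract g) = \<zero>\<^bsub>ring_of_type_algebra\<^esub>"
    using Q(3) unfolding eval_type_algebra
    by (simp add: q_def poly_map_to_fract ring_of_type_algebra_def)
  have alg: "(F.algebraic over ?K) (to_fract g)"
    by (rule F.algebraicI[OF carrier_q q_ne eval])
  thus alg': "algebraic_over ?K (to_fract g)" by (simp add: algebraic_over_def)
  have "length (F.Irr ?K (to_fract g)) - 1 \<le> length q - 1"
    by (rule F.pdivides_imp_degree_le[OF subfieldE(1)[OF K] F.IrrE(1)[OF K carrier alg] carrier_q q_ne
          F.Irr_minimal[OF K carrier alg carrier_q eval]])
  also have "length q - 1 = Polynomial.degree Q"
    using nz by (simp add: q_def length_coeffs_degree degree_map_poly)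
  finally show "extension_degree ?K (to_fract g) \<le> Polynomial.degree Q"
    using extension_degree_eq[OF alg'] by simp
qed

lemma clear_denominators:
  assumes "\<And>j. Polynomial.coeff Q j \<in> quotients R"
  shows "\<exists>c\<in>R. \<exists>Q'\<in>polys_over R. c \<noteq> 0 \<and> smult (to_fract c) Q = map_poly to_fract Q'"
  using assms
proof (induction Q)
  case 0
  thus ?case using one sub_idom.zero[OF polys_over]
    by (intro bexI[of _ 1] bexI[of _ 0]) auto
next
  case (pCons a Q)
  have "Polynomial.coeff Q j \<in> quotients R" for j
    using pCons.prems[of "Suc j"] by simp
  from pCons.IH[OF this] obtain c Q' where
    c: "c \<in> R" "Q' \<in> polys_over R" "c \<noteq> 0" "smult (to_fract c) Q = map_poly to_fract Q'"
    by (elim bexE conjE) (rule that)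
  from pCons.prems[of 0] obtain x y where xy: "a = Fract x y" "x \<in> R" "y \<in> R" "y \<noteq> 0"
    by (auto simp: quotients_def)
  have 1: "to_fract (c * y) * a = to_fract (c * x)"
    using xy by (simp add: to_fract_def eq_fract mult_ac)
  have 2: "smult (to_fract (c * y)) Q = smult (to_fract y) (smult (to_fract c) Q)"
    by (simp add: mult.commute)
  have 3: "smult (to_fract y) (map_poly to_fract Q') = map_poly to_fract (smult y Q')"
    by (rule poly_eqI) (simp add: coeff_map_poly)
  have "smult (to_fract (c * y)) (pCons a Q) = map_poly to_fract (pCons (c * x) (smult y Q'))"
    by (simp only: smult_pCons 1 2 c(4) 3 map_poly_pCons to_fract_0)
  moreover have "pCons (c * x) (smult y Q') \<in> polys_over R"
    unfolding pCons_polys_over using c xy by (auto intro: mult smult_polys_over)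
  moreover have "c * y \<in> R" "c * y \<noteq> 0" using c xy by (auto intro: mult)
  ultimately show ?case
    by (intro bexI[where x = "c * y"] bexI[where x = "pCons (c * x) (smult y Q')"] conjI)
qed

text \<open>The minimal polynomial with its denominators cleared; multiplying by a nonzero constant
  keeps its degree.\<close>

lemma algebraic_overD:
  assumes "algebraic_over (quotients R) (to_fract g)"
  shows "\<exists>Q\<in>polys_over R. Q \<noteq> 0 \<and> poly Q g = 0 \<and>
           Polynomial.degree Q = extension_degree (quotients R) (to_fract g)"
proof -
  interpret F: field "ring_of_type_algebra :: 'a fract ring" by (rule field_from_type_algebra)
  let ?K = "quotients R"
  note K = subfield_quotients
  have carrier: "to_fract g \<in> carrier ring_of_type_algebra"
    by (simp add: ring_of_type_algebra_def)
  have alg: "(F.algebraic over ?K) (to_fract g)" using assms by (simp add: algebraic_over_def)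
  define q where "q = F.Irr ?K (to_fract g)"
  note Irr = F.IrrE[OF K carrier alg, folded q_def]
  have q: "q = [] \<or> set q \<subseteq> ?K"
    using Irr(1) by (auto simp: univ_poly_def polynomial_def)
  have "q \<noteq> []"
    using Irr(2) unfolding ring_irreducible_def by (auto simp: univ_poly_def)
  with q have set_q: "set q \<subseteq> ?K" by simp
  have hd_q: "hd q = 1" using Irr(3) by (simp add: ring_of_type_algebra_def)
  define Q0 where "Q0 = Poly (rev q)"
  have root: "poly Q0 (to_fract g) = 0"
    using Irr(4) unfolding eval_type_algebra Q0_def by (simp add: ring_of_type_algebra_def)
  have coeff_Q0: "Polynomial.coeff Q0 j \<in> ?K" for j
  proof (cases "j < length q")
    case True
    hence "rev q ! j \<in> set (rev q)" by (intro nth_mem) simp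
    thus ?thesis using True set_q by (auto simp: Q0_def nth_default_def)
  next
    case False
    thus ?thesis using to_fract_in_quotients[OF zero] by (simp add: Q0_def nth_default_def)
  qed
  have lc: "Polynomial.coeff Q0 (length q - 1) = 1"
    using hd_q \<open>q \<noteq> []\<close> by (simp add: Q0_def nth_default_def rev_nth hd_conv_nth)
  have "Polynomial.degree Q0 \<le> length q - 1"
    by (rule degree_le) (auto simp: Q0_def nth_default_def)
  moreover have "length q - 1 \<le> Polynomial.degree Q0"
    by (rule le_degree) (use lc in simp)
  ultimately have deg: "Polynomial.degree Q0 = length q - 1" by (rule antisym)
  have nz: "Q0 \<noteq> 0" using lc by (metis coeff_0 zero_neq_one)
  from clear_denominators[of Q0, OF coeff_Q0] obtain c Q where
    c: "Q \<in> polys_over R" "c \<noteq> 0" "smult (to_fract c) Q0 = map_poly to_fract Q"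
    by (elim bexE conjE) (rule that)
  have "to_fract (poly Q g) = poly (smult (to_fract c) Q0) (to_fract g)"
    unfolding c(3) by (rule poly_map_to_fract[symmetric])
  hence "poly Q g = 0" using root by simp
  moreover have "Polynomial.degree Q = Polynomial.degree (smult (to_fract c) Q0)"
    unfolding c(3) by (simp add: degree_map_poly)
  hence "Polynomial.degree Q = length q - 1" using c(2) deg by simp
  moreover have "Q \<noteq> 0" using c nz by auto
  ultimately show ?thesis
    using c(1) extension_degree_eq[OF assms] unfolding q_def by (intro bexI[of _ Q]) auto
qed

end

lemma sub_idom_range_fps_of_poly: "sub_idom (range fps_of_poly :: 'a::idom fps set)"
proof
  show "(1 :: 'a fps) \<in> range fps_of_poly" by (rule range_eqI[of _ _ 1]) simp
  show "a - b \<in> range fps_of_poly" "a * b \<in> range fps_of_poly"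
    if "a \<in> range fps_of_poly" "b \<in> range fps_of_poly" for a b :: "'a fps"
    using that by (auto simp flip: fps_of_poly_diff fps_of_poly_mult)
qed

section \<open>Heights as weighted heights, and the number of boundary exponents\<close>

lemma weighted_degree_unit_exponent: "weighted_degree (unit_exponent i 1) = (\<lambda>m. m i)"
  by (rule ext)
     (simp add: weighted_degree_def unit_exponent_def if_distrib[of "\<lambda>x. x * _"] cong: if_cong)

definition weighted_height :: "('n::finite, 'k::field) mfps \<Rightarrow> ('n \<Rightarrow> nat) \<Rightarrow> nat" where
  "weighted_height f w =
     (LEAST r. \<exists>A. annihilates A f \<and> r = Max (weighted_degree w ` t_exponents A))"

lemma partial_height_conv_weighted: "partial_height f i = weighted_height f (unit_exponent i 1)"
  by (simp only: partial_height_def weighted_height_def weighted_degree_unit_exponent)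

lemma total_height_conv_weighted: "total_height f = weighted_height f (\<lambda>_. 1)"
  by (simp add: total_height_def weighted_height_def weighted_degree_def[abs_def])

text \<open>Complementary counting: the exponents without a zero entry fill the box with sides
  \<open>{1..hs i}\<close>.\<close>

lemma card_box_boundary:
  fixes hs :: "'n::finite \<Rightarrow> nat"
  shows "finite {m. \<forall>i. m i \<le> hs i}"
    and "card {m. (\<forall>i. m i \<le> hs i) \<and> (\<exists>i. m i = 0)} = (\<Prod>i\<in>UNIV. hs i + 1) - (\<Prod>i\<in>UNIV. hs i)"
proof -
  have box: "{m. \<forall>i. m i \<le> hs i} = (\<Pi>\<^sub>E i\<in>UNIV. {..hs i})" by (auto simp: PiE_def Pi_def)
  have inner: "{m. (\<forall>i. m i \<le> hs i) \<and> (\<forall>i. m i \<noteq> 0)} = (\<Pi>\<^sub>E i\<in>UNIV. {1..hs i})"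
    by (auto simp: PiE_def Pi_def Suc_le_eq)
  show fin: "finite {m. \<forall>i. m i \<le> hs i}" unfolding box by (rule finite_PiE) auto
  have "{m. (\<forall>i. m i \<le> hs i) \<and> (\<exists>i. m i = 0)} =
      {m. \<forall>i. m i \<le> hs i} - {m. (\<forall>i. m i \<le> hs i) \<and> (\<forall>i. m i \<noteq> 0)}"
    by (intro equalityI subsetI) auto
  also have "card \<dots> = card {m. \<forall>i. m i \<le> hs i} - card {m. (\<forall>i. m i \<le> hs i) \<and> (\<forall>i. m i \<noteq> 0)}"
    by (intro card_Diff_subset finite_subset[OF _ fin]) auto
  also have "\<dots> = (\<Prod>i\<in>UNIV. hs i + 1) - (\<Prod>i\<in>UNIV. hs i)"
    unfolding box inner by (simp add: card_PiE)
  finally show "card {m. (\<forall>i. m i \<le> hs i) \<and> (\<exists>i. m i = 0)} = (\<Prod>i\<in>UNIV. hs i + 1) - (\<Prod>i\<in>UNIV. hs i)" .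
qed

text \<open>Sorting by the value of the entry at the new index gives a sum of binomial coefficients
  that the hockey-stick identity closes.\<close>

lemma card_sum_le:
  fixes V :: "'n set"
  assumes "finite V"
  shows "finite {m. (\<forall>i. i \<notin> V \<longrightarrow> m i = (0::nat)) \<and> (\<Sum>i\<in>V. m i) \<le> h} \<and>
    card {m. (\<forall>i. i \<notin> V \<longrightarrow> m i = (0::nat)) \<and> (\<Sum>i\<in>V. m i) \<le> h} = (card V + h) choose card V"
  using assms
proof (induction V arbitrary: h rule: finite_induct)
  case empty
  have "{m :: 'n \<Rightarrow> nat. \<forall>i. m i = 0} = {\<lambda>_. 0}" by auto
  thus ?case by simp
next
  case (insert x V)
  let ?S = "\<lambda>h. {m. (\<forall>i. i \<notin> V \<longrightarrow> m i = (0::nat)) \<and> (\<Sum>i\<in>V. m i) \<le> h}"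
  let ?T = "{m. (\<forall>i. i \<notin> insert x V \<longrightarrow> m i = (0::nat)) \<and> (\<Sum>i\<in>insert x V. m i) \<le> h}"
  have upd: "(\<Sum>i\<in>V. (m(x := j)) i) = (\<Sum>i\<in>V. m i)" for m :: "'n \<Rightarrow> nat" and j
    using insert.hyps by (intro sum.cong) auto
  have T: "?T = (\<Union>j\<le>h. (\<lambda>m. m(x := j)) ` ?S (h - j))"
  proof (intro equalityI subsetI)
    fix m assume m: "m \<in> ?T"
    hence "m x \<le> h" "(\<Sum>i\<in>V. m i) \<le> h - m x" using insert.hyps by auto
    hence "(\<Sum>i\<in>V. (m(x := 0)) i) \<le> h - m x" unfolding upd by simp
    moreover have "\<forall>i. i \<notin> V \<longrightarrow> (m(x := 0)) i = 0" using m by auto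
    ultimately have "m(x := 0) \<in> ?S (h - m x)" by blast
    moreover have "m = (m(x := 0))(x := m x)" by simp
    ultimately show "m \<in> (\<Union>j\<le>h. (\<lambda>m. m(x := j)) ` ?S (h - j))" using \<open>m x \<le> h\<close> by blast
  next
    fix m assume "m \<in> (\<Union>j\<le>h. (\<lambda>m. m(x := j)) ` ?S (h - j))"
    then obtain j m' where j: "j \<le> h" "m' \<in> ?S (h - j)" "m = m'(x := j)" by blast
    have "(\<Sum>i\<in>insert x V. m i) = j + (\<Sum>i\<in>V. m' i)"
      unfolding sum.insert[OF insert.hyps] j(3) upd by simp
    thus "m \<in> ?T" using j by auto
  qed
  have fin: "finite (?S k)" and card: "card (?S k) = (card V + k) choose card V" for k
    using insert.IH by auto
  have inj: "inj_on (\<lambda>m. m(x := j)) (?S k)" for j k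
  proof (rule inj_onI)
    fix m m' assume "m \<in> ?S k" "m' \<in> ?S k" "m(x := j) = m'(x := j)"
    thus "m = m'" using insert.hyps(2) by (auto simp: fun_eq_iff split: if_splits) metis
  qed
  have finT: "finite ?T" unfolding T using fin by blast
  have "card ?T = (\<Sum>j\<le>h. card ((\<lambda>m. m(x := j)) ` ?S (h - j)))"
    unfolding T
  proof (rule card_UN_disjoint)
    show "\<forall>i\<in>{..h}. \<forall>j\<in>{..h}. i \<noteq> j \<longrightarrow>
        (\<lambda>m. m(x := i)) ` ?S (h - i) \<inter> (\<lambda>m. m(x := j)) ` ?S (h - j) = {}"
    proof (intro ballI impI equals0I)
      fix i j m assume "i \<noteq> j"
        and m: "m \<in> (\<lambda>m. m(x := i)) ` ?S (h - i) \<inter> (\<lambda>m. m(x := j)) ` ?S (h - j)"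
      from m obtain a b where ab: "m = a(x := i)" "m = b(x := j)" by blast
      have "m x = i" unfolding ab(1) by simp
      moreover have "m x = j" unfolding ab(2) by simp
      ultimately show False using \<open>i \<noteq> j\<close> by simp
    qed
  qed (use fin in auto)
  also have "\<dots> = (\<Sum>j\<le>h. (card V + (h - j)) choose card V)"
    by (simp add: card_image[OF inj] card)
  also have "\<dots> = (\<Sum>k\<le>h. (card V + k) choose k)"
  proof (rule sum.reindex_bij_witness[of _ "\<lambda>j. h - j" "\<lambda>j. h - j"])
    show "(card V + (h - j)) choose (h - j) = (card V + (h - j)) choose card V" for j
      using binomial_symmetric[of "card V" "card V + (h - j)"] by simp
  qed auto
  also have "\<dots> = Suc (card V + h) choose h" by (rule sum_choose_lower)
  also have "\<dots> = Suc (card V + h) choose Suc (card V)"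
    using binomial_symmetric[of h "Suc (card V + h)"] by simp
  finally have "card ?T = Suc (card V + h) choose Suc (card V)" .
  thus ?case using insert.hyps finT by simp
qed

text \<open>Adding 1 to every entry maps the simplex of size \<open>h - n\<close> injectively into
  the exponents without a zero entry, which gives the subtracted term; for \<open>h < n\<close> that
  term is 0.\<close>

lemma card_simplex_boundary:
  defines "n \<equiv> card (UNIV :: 'n::finite set)"
  shows "finite {m :: 'n \<Rightarrow> nat. (\<Sum>i\<in>UNIV. m i) \<le> h}"
    and "card {m :: 'n \<Rightarrow> nat. (\<Sum>i\<in>UNIV. m i) \<le> h \<and> (\<exists>i. m i = 0)} \<le>
           ((n + h) choose n) - (h choose n)"
proof -
  let ?S = "\<lambda>h. {m :: 'n \<Rightarrow> nat. (\<Sum>i\<in>UNIV. m i) \<le> h}"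
  let ?T = "{m :: 'n \<Rightarrow> nat. (\<Sum>i\<in>UNIV. m i) \<le> h \<and> (\<forall>i. m i \<noteq> 0)}"
  have fin: "finite (?S k)" and card: "card (?S k) = (n + k) choose n" for k
    using card_sum_le[of "UNIV :: 'n set" k] by (simp_all add: n_def)
  show "finite (?S h)" by (rule fin)
  have T: "h choose n \<le> card ?T"
  proof (cases "n \<le> h")
    case True
    have inj: "inj_on (\<lambda>m i. m i + 1) (?S (h - n))" by (auto simp: inj_on_def fun_eq_iff)
    have img: "card ((\<lambda>m i. m i + 1) ` ?S (h - n)) = h choose n"
      unfolding card_image[OF inj] card using True by simp
    have "(\<lambda>m i. m i + 1) ` ?S (h - n) \<subseteq> ?T"
    proof
      fix m assume "m \<in> (\<lambda>m i. m i + 1) ` ?S (h - n)"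
      then obtain k where k: "m = (\<lambda>i. k i + 1)" "(\<Sum>i\<in>UNIV. k i) \<le> h - n" by auto
      have "(\<Sum>i\<in>UNIV. m i) = (\<Sum>i\<in>UNIV. k i) + n" unfolding k(1) sum.distrib n_def by simp
      thus "m \<in> ?T" using k True by simp
    qed
    moreover have "finite ?T" by (rule finite_subset[OF _ fin[of h]]) auto
    ultimately have "card ((\<lambda>m i. m i + 1) ` ?S (h - n)) \<le> card ?T" by (intro card_mono)
    thus ?thesis unfolding img .
  qed (simp add: binomial_eq_0)
  have "{m :: 'n \<Rightarrow> nat. (\<Sum>i\<in>UNIV. m i) \<le> h \<and> (\<exists>i. m i = 0)} = ?S h - ?T"
    by (intro equalityI subsetI) auto
  also have "card \<dots> = card (?S h) - card ?T"
    by (rule card_Diff_subset) (auto intro: finite_subset[OF _ fin[of h]])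
  also have "\<dots> \<le> ((n + h) choose n) - (h choose n)" using T card[of h] by simp
  finally show "card {m :: 'n \<Rightarrow> nat. (\<Sum>i\<in>UNIV. m i) \<le> h \<and> (\<exists>i. m i = 0)} \<le>
           ((n + h) choose n) - (h choose n)" .
qed

text \<open>Each choice of weights yields one of the two bounds. \<open>N\<close> is any upper
  bound, so estimates for the degree of \<open>A\<close> and for the number of boundary exponents
  suffice.\<close>

lemma diagonal_dependence_weights:
  fixes f :: "('n::finite, 'k::field) mfps" and weights :: "('n \<Rightarrow> nat) set"
  defines "E \<equiv> {m. \<forall>w\<in>weights. weighted_degree w m \<le> weighted_height f w}"
  assumes p: "p = CHAR('k)" "p > 0" and alg: "mfps_algebraic f"
    and fin: "finite E"
    and N: "(mfps_degree f + 1) * card {m\<in>E. \<exists>i. m i = 0} \<le> N"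
  shows "N > 0"
    and "\<exists>c :: nat \<Rightarrow> 'k poly. (\<exists>j\<le>N. c j \<noteq> 0) \<and>
           (\<Sum>j\<le>N. fps_of_poly (c j) * diagonal f ^ (p ^ j)) = 0"
proof -
  \<comment> \<open>The zero exponent is always a boundary exponent, which makes \<open>N\<close>
    positive; the degree bound for a vanishing diagonal depends on this.\<close>
  have zero_E: "(\<lambda>_. 0) \<in> {m\<in>E. \<exists>i. m i = 0}" by (auto simp: E_def weighted_degree_def)
  have "card {m\<in>E. \<exists>i. m i = 0} > 0" using zero_E fin by (subst card_gt_0_iff) auto
  thus "N > 0" using N by (cases "N = 0") auto
  have "algebraic_over (quotients mpolys) (to_fract f)" using alg by (simp add: mfps_algebraic_def)
  from mpolys.algebraic_overD[OF this] obtain A0 where A0: "annihilates A0 f"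
      "Polynomial.degree A0 = mfps_degree f"
    by (auto simp: annihilates_iff mfps_degree_def)
  from minimal_annihilator[OF A0(1)] obtain A where A: "annihilates A f"
    and A_min: "\<And>B. annihilates B f \<Longrightarrow> Polynomial.degree A \<le> Polynomial.degree B"
    and A_weights: "\<And>B w m. annihilates B f \<Longrightarrow> m \<in> t_exponents A \<Longrightarrow>
           \<exists>m'\<in>t_exponents B. weighted_degree w m \<le> weighted_degree w m'" by blast
  obtain coord where coord: "frobenius_coordinates p (coord :: 'k \<Rightarrow> 'k \<Rightarrow> 'k)"
    using frobenius_coordinates_exist[OF p] by blast
  \<comment> \<open>Each weighted height is attained by some annihilator \<open>B\<close> of its
    own; \<open>A\<close> lies below all of them simultaneously.\<close>
  have height: "weighted_degree w m \<le> weighted_height f w" if m: "m \<in> t_exponents A" for w m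
  proof -
    have "\<exists>r B. annihilates B f \<and> r = Max (weighted_degree w ` t_exponents B)" using A by blast
    from LeastI_ex[OF this] obtain B where B: "annihilates B f"
        "weighted_height f w = Max (weighted_degree w ` t_exponents B)"
      unfolding weighted_height_def by blast
    from A_weights[OF B(1) m] obtain m' where "m' \<in> t_exponents B"
        "weighted_degree w m \<le> weighted_degree w m'" by blast
    moreover have "finite (t_exponents B)" using B(1) by (auto simp: annihilates_iff intro: finite_t_exponents)
    ultimately show ?thesis unfolding B(2) by (meson Max_ge finite_imageI imageI le_trans)
  qed
  interpret annihilated_series p coord f A weights "weighted_height f"
    by (intro annihilated_series.intro annihilated_series_axioms.intro coord A height
         frobenius_coordinates.poly_pderiv_nonzero[OF coord A A_min])
  have E: "exponents = E" by (simp add: exponents_def E_def)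
  define N0 where "N0 = (Polynomial.degree A + 1) * card boundary_exponents"
  have "Polynomial.degree A \<le> mfps_degree f" using A_min[OF A0(1)] A0(2) by simp
  hence "N0 \<le> (mfps_degree f + 1) * card boundary_exponents"
    unfolding N0_def by (intro mult_le_mono1) simp
  hence "N0 \<le> N" using N by (simp add: boundary_exponents_def E)
  from diagonal_dependence[OF _ N0_def] fin E obtain c where
    c: "\<exists>j\<le>N0. c j \<noteq> 0" "(\<Sum>j\<le>N0. fps_of_poly (c j) * diagonal f ^ (p ^ j)) = 0" by blast
  have "(\<Sum>j\<le>N. fps_of_poly (if j \<le> N0 then c j else 0) * diagonal f ^ (p ^ j)) =
      (\<Sum>j\<le>N0. fps_of_poly (c j) * diagonal f ^ (p ^ j))"
    using \<open>N0 \<le> N\<close> by (intro sum.mono_neutral_cong_right) auto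
  moreover have "\<exists>j\<le>N. (if j \<le> N0 then c j else 0) \<noteq> 0" using c(1) \<open>N0 \<le> N\<close> by (metis le_trans)
  ultimately show "\<exists>c :: nat \<Rightarrow> 'k poly. (\<exists>j\<le>N. c j \<noteq> 0) \<and>
           (\<Sum>j\<le>N. fps_of_poly (c j) * diagonal f ^ (p ^ j)) = 0"
    using c(2) by (intro exI[of _ "\<lambda>j. if j \<le> N0 then c j else 0"]) simp
qed

text \<open>Every term of the relation contains the factor \<open>g\<close>; cancelling it lowers
  the degree from \<open>p ^ N\<close> to \<open>p ^ N - 1\<close>.\<close>

lemma additive_relation_degree:
  fixes g :: "'k::field fps" and c :: "nat \<Rightarrow> 'k poly"
  assumes p: "p > 1" and N: "N > 0" and c: "\<exists>j\<le>N. c j \<noteq> 0"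
    and rel: "(\<Sum>j\<le>N. fps_of_poly (c j) * g ^ (p ^ j)) = 0"
  shows "fps_algebraic g \<and> fps_degree g \<le> p ^ N - 1"
proof -
  interpret S: sub_idom "range fps_of_poly :: 'k fps set" by (rule sub_idom_range_fps_of_poly)
  have main: "fps_algebraic g \<and> fps_degree g \<le> p ^ N - 1"
    if "Q \<in> polys_over (range fps_of_poly)" "Q \<noteq> 0" "poly Q g = 0" "Polynomial.degree Q \<le> p ^ N - 1" for Q
    using S.algebraic_overI[OF that(1-3)] that(4) by (auto simp: fps_algebraic_def fps_degree_def)
  have pos: "p ^ j > 0" for j using p by simp
  show ?thesis
  proof (cases "g = 0")
    case True
    \<comment> \<open>For \<open>g = 0\<close> nothing can be cancelled. The polynomial
      \<open>y\<close> serves instead; its degree 1 is at most \<open>p ^ N - 1\<close> because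
      \<open>N > 0\<close> and \<open>p > 1\<close>.\<close>
    have "[:0, 1:] \<in> polys_over (range (fps_of_poly :: 'k poly \<Rightarrow> 'k fps))"
      using S.pCons_polys_over S.zero S.one sub_idom.zero[OF S.polys_over] by blast
    moreover have "p ^ 1 \<le> p ^ N" using p N by (intro power_increasing) auto
    ultimately show ?thesis using True p by (intro main[of "[:0, 1:]"]) auto
  next
    case False
    define Q where "Q = (\<Sum>j\<le>N. Polynomial.monom (fps_of_poly (c j)) (p ^ j - 1))"
    \<comment> \<open>Distinct \<open>j\<close> give distinct exponents, so no coefficient
      \<open>c j\<close> is merged with another in \<open>Q\<close>.\<close>
    have inj: "p ^ i - 1 = p ^ j - 1 \<longleftrightarrow> i = j" for i j
      using p pos[of i] pos[of j] power_inject_exp[OF p, of i j]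
      by (metis Suc_diff_1)
    have coeff: "Polynomial.coeff Q (p ^ j - 1) = fps_of_poly (c j)" if "j \<le> N" for j
      using that by (simp only: Q_def coeff_sum coeff_monom inj) simp
    have "g * poly Q g = (\<Sum>j\<le>N. fps_of_poly (c j) * g ^ (p ^ j))"
      unfolding Q_def poly_sum sum_distrib_left poly_monom
    proof (intro sum.cong refl)
      fix j
      have "g ^ (p ^ j) = g * g ^ (p ^ j - 1)" using pos[of j] by (metis Suc_diff_1 power_Suc)
      thus "g * (fps_of_poly (c j) * g ^ (p ^ j - 1)) = fps_of_poly (c j) * g ^ (p ^ j)"
        by (simp add: mult_ac)
    qed
    hence "poly Q g = 0" using rel False by simp
    moreover have "Q \<noteq> 0"
    proof
      assume "Q = 0"
      obtain j where "j \<le> N" "c j \<noteq> 0" using c by blast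
      thus False
        using coeff[of j] \<open>Q = 0\<close> fps_of_poly_eq_iff[of "c j" 0] by simp
    qed
    moreover have "Q \<in> polys_over (range fps_of_poly)"
      unfolding Q_def by (intro sub_idom.sum[OF S.polys_over] S.monom_polys_over) auto
    moreover have "Polynomial.degree Q \<le> p ^ N - 1"
      unfolding Q_def
    proof (rule degree_sum_le)
      fix j assume "j \<in> {..N}"
      hence "p ^ j \<le> p ^ N" using p by (intro power_increasing) auto
      thus "Polynomial.degree (Polynomial.monom (fps_of_poly (c j)) (p ^ j - 1)) \<le> p ^ N - 1"
        using degree_monom_le[of "fps_of_poly (c j)" "p ^ j - 1"] by linarith
    qed auto
    ultimately show ?thesis by (intro main)
  qed
qed

theorem theorem5p1:
  fixes f :: "('n::finite, 'k::field) mfps"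
    and p n d h N :: nat and hs :: "'n \<Rightarrow> nat"
  assumes "p = CHAR('k)" and "p > 0"
    and "n = card (UNIV :: 'n set)"
    and "mfps_algebraic f"
    and "d = mfps_degree f"
    and "h = total_height f"
    and "hs = partial_height f"
    and "N = (d + 1) * min ((\<Prod>i\<in>UNIV. hs i + 1) - (\<Prod>i\<in>UNIV. hs i))
                           ((n + h choose n) - (h choose n))"
  shows "(\<exists>c :: nat \<Rightarrow> 'k poly. (\<exists>j\<le>N. c j \<noteq> 0) \<and>
            (\<Sum>j\<le>N. fps_of_poly (c j) * diagonal f ^ (p ^ j)) = 0) \<and>
         fps_algebraic (diagonal f) \<and> fps_degree (diagonal f) \<le> p ^ N - 1"
proof -
  let ?box = "(\<Prod>i\<in>UNIV. hs i + 1) - (\<Prod>i\<in>UNIV. hs i)"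
  let ?simplex = "(n + h choose n) - (h choose n)"
  have "N > 0 \<and> (\<exists>c :: nat \<Rightarrow> 'k poly. (\<exists>j\<le>N. c j \<noteq> 0) \<and>
            (\<Sum>j\<le>N. fps_of_poly (c j) * diagonal f ^ (p ^ j)) = 0)"
  \<comment> \<open>The smaller count decides the weights: one unit weight per variable, or the
    constant weight 1 alone.\<close>
  proof (cases "?box \<le> ?simplex")
    case True
    have E: "{m. \<forall>w\<in>range (\<lambda>i. unit_exponent i 1). weighted_degree w m \<le> weighted_height f w} =
        {m. \<forall>i. m i \<le> hs i}"
      unfolding assms(7)
      by (simp only: partial_height_conv_weighted ball_simps weighted_degree_unit_exponent UNIV_I simp_thms)
    note dep = diagonal_dependence_weights[of p f "range (\<lambda>i. unit_exponent i 1)" N,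
        unfolded E, OF assms(1,2,4) card_box_boundary(1)]
    have "(mfps_degree f + 1) * card {m \<in> {m. \<forall>i. m i \<le> hs i}. \<exists>i. m i = 0} \<le> N"
      using True card_box_boundary(2)[of hs] assms(5,8) by (simp add: min_def)
    from dep[OF this] show ?thesis by blast
  next
    case False
    have E: "{m. \<forall>w\<in>{\<lambda>_. 1}. weighted_degree w m \<le> weighted_height f w} =
        {m. (\<Sum>i\<in>UNIV. m i) \<le> h}"
      unfolding assms(6) total_height_conv_weighted by (simp add: weighted_degree_def)
    note dep = diagonal_dependence_weights[of p f "{\<lambda>_. 1}" N,
        unfolded E, OF assms(1,2,4) card_simplex_boundary(1)]
    have "(mfps_degree f + 1) * card {m \<in> {m :: 'n \<Rightarrow> nat. (\<Sum>i\<in>UNIV. m i) \<le> h}. \<exists>i. m i = 0}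
        \<le> (d + 1) * ?simplex"
      using card_simplex_boundary(2)[where 'n = 'n, of h] assms(3,5) by (intro mult_le_mono) simp_all
    also have "\<dots> = N" using False assms(8) by (simp add: min_def)
    finally show ?thesis using dep by blast
  qed
  moreover have "p > 1"
    using assms(1,2) prime_CHAR_semidom[where 'a = 'k] prime_gt_1_nat by simp
  ultimately show ?thesis using additive_relation_degree by blast
qed

end
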